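(* The dynamical system $(X_Q,Q)$ is uniquely ergodic, and the elements of $X_Q^{gen}$ are regular model sets (i.e. for $\Lambda\in X_Q^{gen}$ and each of the 12 translation classes of marked tiles, the set of $x\in Q$ at which $\Lambda$ has a tile of that class is a regular model set).
   Context: Lattices. $a_1=(1,0)$, $a_2=(-\tfrac12,\tfrac{\sqrt3}2)$, $Q=\mathbb Za_1+\mathbb Za_2\subset\mathbb R^2$, $w_1=\tfrac23a_1+\tfrac13a_2$, $w_2=\tfrac13a_1+\tfrac23a_2$, $\Omega=\{\pm w_1,\pm w_2,\pm(w_2-w_1)\}$. $\overline Q$ is the (compact) completion of $Q$ for the topology with neighborhood basis $2^kQ$ of $0$. Model sets. The cut and project scheme is $\mathbb R^2\leftarrow\mathbb R^2\times\overline Q\to\overline Q$ with lattice $\{(x,x):x\in Q\}$ ($x^\star$ is $x\in Q$ viewed in $\overline Q$). A model set is a set $\{x\in Q:x^\star\in W\}$ with $W\subset\overline Q$, $W^\circ\subset W\subset\overline{W^\circ}=\overline W$ and $\overline W$ compact; it is regular if $\overline W\setminus W^\circ$ has Haar measure $0$. Triangulations. Write ${\bf q}\in\overline Q$ as ${\bf q}=\lim_kv_k$, $v_0=0$, $v_k=q_1+\dots+q_k$, $q_k\in2^{k-1}Q$. $\mathcal T({\bf q})$ is the family of triangulations of the plane, one for each $k\ge0$, by equilateral triangles of side $2^k$ with vertex set $v_k+2^kQ$ (triangles, and edges, of level $k$). An a-line is a line through a point of $Q$ in one of the directions $a_1,a_2,a_1+a_2$; its level is the supremum of the $k$ such that it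 contains a level-$k$ edge. A w-line is a line through a point of $Q$ in one of the directions $w_1,w_2,w_2-w_1$; its level is the supremum of the $k$ such that it contains a centroid of a level-$k$ triangle. ${\bf q}$ is generic if all a-lines and all w-lines have finite level. Tiles and matching rules. The hexagon $H_x$ at $x\in Q$ is the regular hexagon with center $x$ and vertices $x+w$, $w\in\Omega$. A marked tile at $x$ is given by: a stripe direction (one of the lines $\mathbb Ra_1,\mathbb Ra_2,\mathbb R(a_1+a_2)$); a black stripe across $H_x$ parallel to that direction and displaced from $x$ by a fixed small $\epsilon>0$ ($0<\epsilon\le1/4$) to one of the two sides; two further black V-shaped lines, one on each side, each joining the two hexagon edges adjacent to the vertex of $H_x$ lying on that side on the long diagonal perpendicular to the stripe direction, with legs perpendicular to these edges and displaced by $\epsilon$ from the edge midpoints towards that vertex; the long diagonal at angle $\pi/6$ clockwise from the stripe direction colored red, the one at $\pi/6$ counterclockwise colored blue, and the one perpendicular to the stripe direction colored half red and half blue (either way around, split at $x$). $X_Q$ is the set of all choices of a marked tile at every $x\in Q$ such that: (R1) on each common edge of two adjacent hexagons the black lines of the two tiles meet (same displacement from the edge midpoint); (R2) for all $x\in Q$, $w\in\Omega$, the color at the end $x+w$ of the diagonal of $H_x$ and the color at the end $x+2w$ of the diagonal of $H_{x+3w}$ are opposite. The map $\xi$. For each $\Lambda\in X_Q$ there is a unique ${\bf q}=\xi(\Lambda)\in\overline Q$ such that for each $x\in Q$ (other than a point lying on three a-lines of infinite level) the stripe direction at $x$ is that of the a-line through $x$ of strictly largest level in $\mathcal T({\bf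 q})$, and, if this level is a finite number $k$, the stripe is displaced towards the centroid of the unique level-$(k+1)$ triangle having as a midsegment the level-$k$ edge that contains $x$. $X_Q^{gen}$ is the set of $\Lambda\in X_Q$ with $\xi(\Lambda)$ generic. $X_Q$ carries the local topology (two tilings are close if they agree on a large ball around $0$), in which it is compact, and the translation action of $Q$; uniquely ergodic means there is exactly one $Q$-invariant Borel probability measure. *)

theory Defs
  imports "HOL-Probability.Probability" "HOL-Library.Extended_Nat"
begin

section \<open>The lattice and its completion\<close>

text \<open>The plane is the type of complex numbers; \<open>\<i> * d\<close> is \<open>d\<close> rotated counterclockwise by a right angle.\<close>

definition a1 :: complex where "a1 = 1"
definition a2 :: complex where "a2 = Complex (- 1 / 2) (sqrt 3 / 2)"

definition Q :: "complex set" where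
  "Q = {of_int m * a1 + of_int n * a2 | m n. True}"

definition w1 :: complex where "w1 = (2 / 3) * a1 + (1 / 3) * a2"
definition w2 :: complex where "w2 = (1 / 3) * a1 + (2 / 3) * a2"

definition Omega :: "complex set" where
  "Omega = {w1, - w1, w2, - w2, w2 - w1, - (w2 - w1)}"

definition coset :: "nat \<Rightarrow> complex \<Rightarrow> complex set" where
  "coset k x = {x + 2 ^ k * z | z. z \<in> Q}"

lemma zero_in_Q: "0 \<in> Q"
  unfolding Q_def by (rule CollectI, rule exI[of _ 0], rule exI[of _ 0]) simp

lemma add_in_Q:
  assumes "x \<in> Q" "y \<in> Q" shows "x + y \<in> Q"
proof -
  obtain m n m' n' where "x = of_int m * a1 + of_int n * a2" "y = of_int m' * a1 + of_int n' * a2"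
    using assms unfolding Q_def by auto
  then have "x + y = of_int (m + m') * a1 + of_int (n + n') * a2" by (simp add: algebra_simps)
  then show ?thesis unfolding Q_def by blast
qed

lemma uminus_in_Q:
  assumes "x \<in> Q" shows "- x \<in> Q"
proof -
  obtain m n where "x = of_int m * a1 + of_int n * a2" using assms unfolding Q_def by auto
  then have "- x = of_int (- m) * a1 + of_int (- n) * a2" by simp
  then show ?thesis unfolding Q_def by blast
qed

lemma double_in_Q: "x \<in> Q \<Longrightarrow> 2 * x \<in> Q"
  using add_in_Q[of x x] by (simp only: mult_2)

lemma coset_self: "x \<in> coset k x"
  unfolding coset_def using zero_in_Q by force

lemma coset_eqI:
  assumes "y \<in> coset k x" shows "coset k y = coset k x"
proof -
  obtain u where u: "u \<in> Q" "y = x + 2 ^ k * u" using assms unfolding coset_def by auto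
  show ?thesis
  proof (intro subset_antisym subsetI)
    fix z assume "z \<in> coset k y"
    then obtain v where "v \<in> Q" "z = y + 2 ^ k * v" unfolding coset_def by auto
    then have "z = x + 2 ^ k * (u + v)" "u + v \<in> Q" using u add_in_Q by (auto simp: algebra_simps)
    then show "z \<in> coset k x" unfolding coset_def by blast
  next
    fix z assume "z \<in> coset k x"
    then obtain v where "v \<in> Q" "z = x + 2 ^ k * v" unfolding coset_def by auto
    then have "z = y + 2 ^ k * (v + - u)" "v + - u \<in> Q" 
      using u add_in_Q[of v "- u"] uminus_in_Q by (auto simp: algebra_simps)
    then show "z \<in> coset k y" unfolding coset_def by blast
  qed
qed

lemma coset_mono: "coset (Suc k) x \<subseteq> coset k x"
proof
  fix y assume "y \<in> coset (Suc k) x"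
  then obtain z where "z \<in> Q" "y = x + 2 ^ Suc k * z" unfolding coset_def by auto
  then have "2 * z \<in> Q" "y = x + 2 ^ k * (2 * z)" using double_in_Q by auto
  then show "y \<in> coset k x" unfolding coset_def by blast
qed

lemma coset_add: "{u + v | u v. u \<in> coset k x \<and> v \<in> coset k y} = coset k (x + y)"
proof (intro subset_antisym subsetI)
  fix z assume "z \<in> {u + v | u v. u \<in> coset k x \<and> v \<in> coset k y}"
  then obtain s t where "s \<in> Q" "t \<in> Q" "z = (x + 2 ^ k * s) + (y + 2 ^ k * t)"
    unfolding coset_def by auto
  then have "s + t \<in> Q" "z = x + y + 2 ^ k * (s + t)" using add_in_Q by (auto simp: algebra_simps)
  then show "z \<in> coset k (x + y)" unfolding coset_def by blast
next
  fix z assume "z \<in> coset k (x + y)"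
  then obtain s where "s \<in> Q" "z = x + (y + 2 ^ k * s)" unfolding coset_def by (auto simp: add.assoc)
  then show "z \<in> {u + v | u v. u \<in> coset k x \<and> v \<in> coset k y}"
    using coset_self[of x k] unfolding coset_def[of k y] by blast
qed

lemma coset_uminus: "uminus ` coset k x = coset k (- x)"
proof -
  have *: "uminus ` coset k x \<subseteq> coset k (- x)" for x
  proof
    fix y assume "y \<in> uminus ` coset k x"
    then obtain z where "z \<in> Q" "y = - x + 2 ^ k * (- z)" unfolding coset_def by auto
    then show "y \<in> coset k (- x)" unfolding coset_def using uminus_in_Q by blast
  qed
  have "coset k (- x) = uminus ` uminus ` coset k (- x)" by (simp add: image_image)
  also have "\<dots> \<subseteq> uminus ` coset k x" using *[of "- x"] by auto
  finally show ?thesis using * by blast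
qed

text \<open>The completion of \<open>Q\<close> for the topology with basic neighbourhoods \<open>2\<^sup>k Q\<close> of 0, as the inverse
  limit of the groups \<open>Q / 2\<^sup>k Q\<close>: the point \<open>q = lim v k\<close> with \<open>v (k + 1) - v k \<in> 2\<^sup>k Q\<close> is the nested
  sequence of cosets \<open>v k + 2\<^sup>k Q\<close> (lemma \<open>star_tendsto\<close> below).\<close>

typedef qbar = "{c :: nat \<Rightarrow> complex set. \<forall>k. (\<exists>x\<in>Q. c k = coset k x) \<and> c (Suc k) \<subseteq> c k}"
  morphisms cosets_of Abs_qbar
proof
  show "(\<lambda>k. coset k 0) \<in> {c. \<forall>k. (\<exists>x\<in>Q. c k = coset k x) \<and> c (Suc k) \<subseteq> c k}"
    using zero_in_Q coset_mono by auto
qed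

setup_lifting type_definition_qbar

lift_definition star :: "complex \<Rightarrow> qbar" is "\<lambda>x k. if x \<in> Q then coset k x else coset k 0"
  using zero_in_Q coset_mono by auto

instantiation qbar :: ab_group_add
begin

lift_definition zero_qbar :: qbar is "\<lambda>k. coset k 0"
  using zero_in_Q coset_mono by auto

lift_definition plus_qbar :: "qbar \<Rightarrow> qbar \<Rightarrow> qbar" is
  "\<lambda>p q k. {u + v | u v. u \<in> p k \<and> v \<in> q k}"
proof (intro conjI)
  fix p q :: "nat \<Rightarrow> complex set" and k
  assume p: "\<And>k. (\<exists>x\<in>Q. p k = coset k x) \<and> p (Suc k) \<subseteq> p k"
    and q: "\<And>k. (\<exists>x\<in>Q. q k = coset k x) \<and> q (Suc k) \<subseteq> q k"
  then obtain x y where "x \<in> Q" "p k = coset k x" "y \<in> Q" "q k = coset k y" by meson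
  then show "\<exists>x\<in>Q. {u + v | u v. u \<in> p k \<and> v \<in> q k} = coset k x"
    using coset_add add_in_Q by auto
  show "{u + v | u v. u \<in> p (Suc k) \<and> v \<in> q (Suc k)} \<subseteq> {u + v | u v. u \<in> p k \<and> v \<in> q k}"
    using p q by blast
qed

lift_definition uminus_qbar :: "qbar \<Rightarrow> qbar" is "\<lambda>p k. uminus ` p k"
proof (intro conjI)
  fix p :: "nat \<Rightarrow> complex set" and k
  assume p: "\<And>k. (\<exists>x\<in>Q. p k = coset k x) \<and> p (Suc k) \<subseteq> p k"
  then show "\<exists>x\<in>Q. uminus ` p k = coset k x"
    using coset_uminus uminus_in_Q by metis
  show "uminus ` p (Suc k) \<subseteq> uminus ` p k" using p by blast
qed

definition minus_qbar :: "qbar \<Rightarrow> qbar \<Rightarrow> qbar" where "minus_qbar p q = p + - q"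

instance
proof
  fix a b c :: qbar
  show "a + b + c = a + (b + c)"
  proof (transfer, rule ext)
    fix a b c :: "nat \<Rightarrow> complex set" and k
    assume "\<forall>k. (\<exists>x\<in>Q. a k = coset k x) \<and> a (Suc k) \<subseteq> a k"
      "\<forall>k. (\<exists>x\<in>Q. b k = coset k x) \<and> b (Suc k) \<subseteq> b k"
      "\<forall>k. (\<exists>x\<in>Q. c k = coset k x) \<and> c (Suc k) \<subseteq> c k"
    then obtain x y z where xyz: "a k = coset k x" "b k = coset k y" "c k = coset k z" by meson
    show "{u + v | u v. u \<in> {u + v | u v. u \<in> a k \<and> v \<in> b k} \<and> v \<in> c k}
      = {u + v | u v. u \<in> a k \<and> v \<in> {u + v | u v. u \<in> b k \<and> v \<in> c k}}"
      unfolding xyz coset_add by (simp add: add.assoc)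
  qed
  show "a + b = b + a"
  proof (transfer, rule ext)
    fix a b :: "nat \<Rightarrow> complex set" and k
    assume "\<forall>k. (\<exists>x\<in>Q. a k = coset k x) \<and> a (Suc k) \<subseteq> a k"
      "\<forall>k. (\<exists>x\<in>Q. b k = coset k x) \<and> b (Suc k) \<subseteq> b k"
    then obtain x y where xy: "a k = coset k x" "b k = coset k y" by meson
    show "{u + v | u v. u \<in> a k \<and> v \<in> b k} = {u + v | u v. u \<in> b k \<and> v \<in> a k}"
      unfolding xy coset_add by (simp add: add.commute)
  qed
  show "0 + a = a"
  proof (transfer, rule ext)
    fix a :: "nat \<Rightarrow> complex set" and k
    assume "\<forall>k. (\<exists>x\<in>Q. a k = coset k x) \<and> a (Suc k) \<subseteq> a k"
    then obtain x where x: "a k = coset k x" by meson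
    show "{u + v | u v. u \<in> coset k 0 \<and> v \<in> a k} = a k"
      unfolding x coset_add by simp
  qed
  show "- a + a = 0"
  proof (transfer, rule ext)
    fix a :: "nat \<Rightarrow> complex set" and k
    assume "\<forall>k. (\<exists>x\<in>Q. a k = coset k x) \<and> a (Suc k) \<subseteq> a k"
    then obtain x where x: "a k = coset k x" by meson
    show "{u + v | u v. u \<in> uminus ` a k \<and> v \<in> a k} = coset k 0"
      unfolding x coset_uminus coset_add by simp
  qed
  show "a - b = a + - b" by (rule minus_qbar_def)
qed

end

instantiation qbar :: topological_space
begin

definition open_qbar :: "qbar set \<Rightarrow> bool" where
  "open_qbar U \<longleftrightarrow> (\<forall>q\<in>U. \<exists>k. \<forall>p. cosets_of p k = cosets_of q k \<longrightarrow> p \<in> U)"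

lemma cosets_of_eq_le:
  assumes "cosets_of p k = cosets_of q k" "j \<le> k"
  shows "cosets_of p j = cosets_of q j"
proof -
  have dec: "cosets_of r k \<subseteq> cosets_of r j" for r
    by (rule lift_Suc_antimono_le[of "cosets_of r"]) (use cosets_of[of r] assms(2) in auto)
  have ex: "\<exists>x. cosets_of r i = coset i x" for r i using cosets_of[of r] by blast
  obtain x y z where x: "cosets_of p k = coset k x" "cosets_of p j = coset j y"
    "cosets_of q j = coset j z" using ex by metis
  then have "x \<in> coset j y" "x \<in> coset j z"
    using dec[of p] dec[of q] coset_self[of x k] assms(1) by auto
  then show ?thesis using coset_eqI x by metis
qed

instance
proof
  show "open (UNIV :: qbar set)" by (simp add: open_qbar_def)
next
  fix S T :: "qbar set" assume "open S" "open T"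
  show "open (S \<inter> T)" unfolding open_qbar_def
  proof
    fix q assume "q \<in> S \<inter> T"
    then obtain k l where "\<forall>p. cosets_of p k = cosets_of q k \<longrightarrow> p \<in> S"
      "\<forall>p. cosets_of p l = cosets_of q l \<longrightarrow> p \<in> T"
      using \<open>open S\<close> \<open>open T\<close> unfolding open_qbar_def by blast
    then have "\<forall>p. cosets_of p (max k l) = cosets_of q (max k l) \<longrightarrow> p \<in> S \<inter> T"
      using cosets_of_eq_le by (metis IntI max.cobounded1 max.cobounded2)
    then show "\<exists>k. \<forall>p. cosets_of p k = cosets_of q k \<longrightarrow> p \<in> S \<inter> T" ..
  qed
next
  fix K :: "qbar set set" assume "\<forall>S\<in>K. open S"
  then show "open (\<Union>K)" unfolding open_qbar_def by (meson UnionE UnionI)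
qed

end

lemma star_add: "x \<in> Q \<Longrightarrow> y \<in> Q \<Longrightarrow> star (x + y) = star x + star y"
  by transfer (simp add: coset_add add_in_Q)

lemma star_tendsto:
  assumes "\<And>k. v k \<in> Q" "\<And>k. v k \<in> cosets_of q k"
  shows "(\<lambda>k. star (v k)) \<longlonglongrightarrow> q"
proof (rule topological_tendstoI)
  fix U assume "open U" "q \<in> U"
  then obtain k where k: "\<And>p. cosets_of p k = cosets_of q k \<Longrightarrow> p \<in> U"
    unfolding open_qbar_def by blast
  have "star (v n) \<in> U" if "k \<le> n" for n
  proof (rule k)
    obtain x where "cosets_of q n = coset n x" using cosets_of[of q] by blast
    then have "cosets_of (star (v n)) n = cosets_of q n"
      using assms coset_eqI by (metis star.rep_eq)
    then show "cosets_of (star (v n)) k = cosets_of q k" using that by (rule cosets_of_eq_le)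
  qed
  then show "\<forall>\<^sub>F n in sequentially. star (v n) \<in> U"
    by (auto simp: eventually_sequentially)
qed


section \<open>Model sets\<close>

text \<open>Haar measure of the compact group \<open>qbar\<close>, normalised to total mass 1.\<close>

definition haar :: "qbar measure \<Rightarrow> bool" where
  "haar \<mu> \<longleftrightarrow> sets \<mu> = sets borel \<and> prob_space \<mu> \<and> (\<forall>p. distr \<mu> \<mu> ((+) p) = \<mu>)"

text \<open>The condition \<open>interior W \<subseteq> W\<close> on windows holds for every set and is omitted.\<close>

definition model_window :: "qbar set \<Rightarrow> bool" where
  "model_window W \<longleftrightarrow> W \<subseteq> closure (interior W) \<and> closure (interior W) = closure W
    \<and> compact (closure W)"

definition regular_model_set :: "complex set \<Rightarrow> bool" where
  "regular_model_set S \<longleftrightarrow> (\<exists>W \<mu>. model_window W \<and> S = {x \<in> Q. star x \<in> W}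
    \<and> haar \<mu> \<and> emeasure \<mu> (closure W - interior W) = 0)"


section \<open>Triangulations\<close>

datatype direction = D1 | D2 | D12

primrec dir_vec :: "direction \<Rightarrow> complex" where
  "dir_vec D1 = a1"
| "dir_vec D2 = a2"
| "dir_vec D12 = a1 + a2"

definition line :: "complex \<Rightarrow> complex \<Rightarrow> complex set" where
  "line x d = {x + of_real t * d | t. True}"

text \<open>The level-\<open>k\<close> vertex set \<open>v k + 2\<^sup>k Q\<close> of the triangulation family of \<open>q\<close> is \<open>cosets_of q k\<close>.\<close>

definition level_triangle :: "qbar \<Rightarrow> nat \<Rightarrow> complex \<Rightarrow> complex \<Rightarrow> complex \<Rightarrow> bool" where
  "level_triangle q k A B C \<longleftrightarrow> {A, B, C} \<subseteq> cosets_of q k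
    \<and> dist A B = 2 ^ k \<and> dist B C = 2 ^ k \<and> dist A C = 2 ^ k"

definition level_edges :: "qbar \<Rightarrow> nat \<Rightarrow> complex set set" where
  "level_edges q k = {closed_segment A B | A B. {A, B} \<subseteq> cosets_of q k \<and> dist A B = 2 ^ k}"

definition centroid :: "complex \<Rightarrow> complex \<Rightarrow> complex \<Rightarrow> complex" where
  "centroid A B C = (A + B + C) / 3"

definition a_lines :: "complex set set" where
  "a_lines = {line x (dir_vec d) | x d. x \<in> Q}"

definition w_lines :: "complex set set" where
  "w_lines = {line x w | x w. x \<in> Q \<and> w \<in> {w1, w2, w2 - w1}}"

definition a_level :: "qbar \<Rightarrow> complex set \<Rightarrow> enat" where
  "a_level q l = Sup {enat k | k. \<exists>e\<in>level_edges q k. e \<subseteq> l}"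

definition w_level :: "qbar \<Rightarrow> complex set \<Rightarrow> enat" where
  "w_level q l = Sup {enat k | k. \<exists>A B C. level_triangle q k A B C \<and> centroid A B C \<in> l}"

definition generic :: "qbar \<Rightarrow> bool" where
  "generic q \<longleftrightarrow> (\<forall>l\<in>a_lines. a_level q l < \<infinity>) \<and> (\<forall>l\<in>w_lines. w_level q l < \<infinity>)"


section \<open>Marked tiles and matching rules\<close>

text \<open>The long diagonals of a hexagon have half-length \<open>1 / sqrt 3\<close>.
  \<open>LeftSide\<close> and \<open>RightSide\<close> are the two sides of the line through the tile centre in the oriented
  direction \<open>dir_vec d\<close>; \<open>normal d s\<close> is the unit normal pointing to side \<open>s\<close>.\<close>

datatype side = LeftSide | RightSide

primrec opposite :: "side \<Rightarrow> side" where
  "opposite LeftSide = RightSide"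
| "opposite RightSide = LeftSide"

primrec normal :: "direction \<Rightarrow> side \<Rightarrow> complex" where
  "normal d LeftSide = \<i> * dir_vec d"
| "normal d RightSide = - (\<i> * dir_vec d)"

text \<open>The twelve translation classes of marked tiles: stripe direction, side to which the stripe is
  displaced, and side on which the long diagonal perpendicular to the stripe is red.\<close>

datatype tile = Tile (stripe_dir: direction) (stripe_side: side) (red_side: side)

definition hex_edges :: "complex \<Rightarrow> complex set set" where
  "hex_edges x = {closed_segment (x + w) (x + w') | w w'.
     w \<in> Omega \<and> w' \<in> Omega \<and> dist w w' = 1 / sqrt 3}"

definition stripe :: "real \<Rightarrow> complex \<Rightarrow> tile \<Rightarrow> complex set" where
  "stripe \<epsilon> x T = (let a = dir_vec (stripe_dir T); n = normal (stripe_dir T) (stripe_side T)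
     in closed_segment (x + \<epsilon> *\<^sub>R n - a / 2) (x + \<epsilon> *\<^sub>R n + a / 2))"

text \<open>On side \<open>s\<close> the vertex on the diagonal perpendicular to the stripe is \<open>v = x + n / sqrt 3\<close>, and
  the edges at \<open>v\<close> have the midpoints \<open>m = x + b / 2\<close> with \<open>b = (sqrt 3 n + a) / 2\<close> or
  \<open>b = (sqrt 3 n - a) / 2\<close>. The legs start at distance \<open>\<epsilon>\<close> from \<open>m\<close> towards \<open>v\<close> (\<open>sgn z\<close> is
  \<open>z / norm z\<close>); running parallel to \<open>b\<close>, that is perpendicular to the edges, they meet at
  \<open>x + 2 \<epsilon> n\<close>.\<close>

definition V_line :: "real \<Rightarrow> complex \<Rightarrow> tile \<Rightarrow> side \<Rightarrow> complex set" where
  "V_line \<epsilon> x T s = (let a = dir_vec (stripe_dir T); n = normal (stripe_dir T) s;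
      v = x + n / sqrt 3;
      m = x + (sqrt 3 *\<^sub>R n + a) / 4; m' = x + (sqrt 3 *\<^sub>R n - a) / 4
     in closed_segment (x + (2 * \<epsilon>) *\<^sub>R n) (m + \<epsilon> *\<^sub>R sgn (v - m))
      \<union> closed_segment (x + (2 * \<epsilon>) *\<^sub>R n) (m' + \<epsilon> *\<^sub>R sgn (v - m')))"

definition black :: "real \<Rightarrow> complex \<Rightarrow> tile \<Rightarrow> complex set" where
  "black \<epsilon> x T = stripe \<epsilon> x T \<union> V_line \<epsilon> x T LeftSide \<union> V_line \<epsilon> x T RightSide"

definition long_diagonal :: "complex \<Rightarrow> complex \<Rightarrow> complex set" where
  "long_diagonal x u = closed_segment (x - u / sqrt 3) (x + u / sqrt 3)"

definition red :: "complex \<Rightarrow> tile \<Rightarrow> complex set" where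
  "red x T = long_diagonal x (dir_vec (stripe_dir T) * cis (- (pi / 6)))
    \<union> closed_segment x (x + normal (stripe_dir T) (red_side T) / sqrt 3)"

definition blue :: "complex \<Rightarrow> tile \<Rightarrow> complex set" where
  "blue x T = long_diagonal x (dir_vec (stripe_dir T) * cis (pi / 6))
    \<union> closed_segment x (x + normal (stripe_dir T) (opposite (red_side T)) / sqrt 3)"

definition rule_R1 :: "real \<Rightarrow> (complex \<Rightarrow> tile) \<Rightarrow> bool" where
  "rule_R1 \<epsilon> \<Lambda> \<longleftrightarrow> (\<forall>x\<in>Q. \<forall>y\<in>Q. x \<noteq> y \<longrightarrow>
     (\<forall>E \<in> hex_edges x \<inter> hex_edges y. black \<epsilon> x (\<Lambda> x) \<inter> E = black \<epsilon> y (\<Lambda> y) \<inter> E))"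

definition rule_R2 :: "(complex \<Rightarrow> tile) \<Rightarrow> bool" where
  "rule_R2 \<Lambda> \<longleftrightarrow> (\<forall>x\<in>Q. \<forall>w\<in>Omega.
      (x + w \<in> red x (\<Lambda> x) \<and> x + 2 * w \<in> blue (x + 3 * w) (\<Lambda> (x + 3 * w)))
    \<or> (x + w \<in> blue x (\<Lambda> x) \<and> x + 2 * w \<in> red (x + 3 * w) (\<Lambda> (x + 3 * w))))"

text \<open>Tilings are extensional functions on \<open>Q\<close>, so that equality of tilings is equality on \<open>Q\<close>.\<close>

definition XQ :: "real \<Rightarrow> (complex \<Rightarrow> tile) set" where
  "XQ \<epsilon> = {\<Lambda> \<in> Q \<rightarrow>\<^sub>E UNIV. rule_R1 \<epsilon> \<Lambda> \<and> rule_R2 \<Lambda>}"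


section \<open>The map \<open>\<xi>\<close> and generic tilings\<close>

text \<open>In the last conjunct the level-\<open>k\<close> edge containing \<open>x\<close> is the midsegment parallel to \<open>B C\<close> of
  the triangle \<open>A B C\<close>. It is unique when \<open>k\<close> is the largest level of an a-line through \<open>x\<close>, since
  \<open>x\<close> is then not a level-\<open>k\<close> vertex.\<close>

definition xi_rel :: "(complex \<Rightarrow> tile) \<Rightarrow> qbar \<Rightarrow> bool" where
  "xi_rel \<Lambda> q \<longleftrightarrow> (\<forall>x\<in>Q. \<not> (\<forall>d. a_level q (line x (dir_vec d)) = \<infinity>) \<longrightarrow>
     (let d = stripe_dir (\<Lambda> x); n = normal d (stripe_side (\<Lambda> x)) in
       (\<forall>d'. d' \<noteq> d \<longrightarrow> a_level q (line x (dir_vec d')) < a_level q (line x (dir_vec d)))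
     \<and> (\<forall>k. a_level q (line x (dir_vec d)) = enat k \<longrightarrow>
          (\<exists>A B C. level_triangle q (Suc k) A B C
            \<and> closed_segment (midpoint A B) (midpoint A C) \<in> level_edges q k
            \<and> x \<in> closed_segment (midpoint A B) (midpoint A C)
            \<and> n \<bullet> (centroid A B C - x) > 0))))"

definition xi :: "(complex \<Rightarrow> tile) \<Rightarrow> qbar" where
  "xi \<Lambda> = (THE q. xi_rel \<Lambda> q)"

definition XQ_gen :: "real \<Rightarrow> (complex \<Rightarrow> tile) set" where
  "XQ_gen \<epsilon> = {\<Lambda> \<in> XQ \<epsilon>. generic (xi \<Lambda>)}"


section \<open>Dynamics\<close>

definition translate :: "complex \<Rightarrow> (complex \<Rightarrow> tile) \<Rightarrow> complex \<Rightarrow> tile" where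
  "translate t \<Lambda> = (\<lambda>x\<in>Q. \<Lambda> (x - t))"

definition local_open :: "(complex \<Rightarrow> tile) set \<Rightarrow> (complex \<Rightarrow> tile) set \<Rightarrow> bool" where
  "local_open X U \<longleftrightarrow> U \<subseteq> X \<and>
     (\<forall>\<Lambda>\<in>U. \<exists>R. \<forall>\<Lambda>'\<in>X. (\<forall>x \<in> Q \<inter> ball 0 R. \<Lambda>' x = \<Lambda> x) \<longrightarrow> \<Lambda>' \<in> U)"

definition local_topology :: "(complex \<Rightarrow> tile) set \<Rightarrow> (complex \<Rightarrow> tile) topology" where
  "local_topology X = topology (local_open X)"

lemma local_openD:
  assumes "local_open X U" "\<Lambda> \<in> U"
  obtains R where "\<And>\<Lambda>'. \<Lambda>' \<in> X \<Longrightarrow> (\<And>x. x \<in> Q \<Longrightarrow> x \<in> ball 0 R \<Longrightarrow> \<Lambda>' x = \<Lambda> x) \<Longrightarrow> \<Lambda>' \<in> U"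
  using assms unfolding local_open_def by (metis IntE)

lemma local_openI:
  assumes "U \<subseteq> X"
    "\<And>\<Lambda>. \<Lambda> \<in> U \<Longrightarrow> \<exists>R. \<forall>\<Lambda>'\<in>X. (\<forall>x \<in> Q \<inter> ball 0 R. \<Lambda>' x = \<Lambda> x) \<longrightarrow> \<Lambda>' \<in> U"
  shows "local_open X U"
  using assms unfolding local_open_def by blast

lemma openin_local_topology: "openin (local_topology X) = local_open X"
  unfolding local_topology_def
proof (rule topology_inverse', unfold istopology_def, intro conjI allI impI)
  fix S T assume S: "local_open X S" and T: "local_open X T"
  show "local_open X (S \<inter> T)"
  proof (rule local_openI)
    show "S \<inter> T \<subseteq> X" using S unfolding local_open_def by blast
    fix \<Lambda> assume "\<Lambda> \<in> S \<inter> T"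
    then have 1: "\<Lambda> \<in> S" "\<Lambda> \<in> T" by auto
    obtain R where R: "\<And>\<Lambda>'. \<Lambda>' \<in> X \<Longrightarrow> (\<And>x. x \<in> Q \<Longrightarrow> x \<in> ball 0 R \<Longrightarrow> \<Lambda>' x = \<Lambda> x) \<Longrightarrow> \<Lambda>' \<in> S"
      using local_openD[OF S 1(1)] by metis
    obtain R' where R': "\<And>\<Lambda>'. \<Lambda>' \<in> X \<Longrightarrow> (\<And>x. x \<in> Q \<Longrightarrow> x \<in> ball 0 R' \<Longrightarrow> \<Lambda>' x = \<Lambda> x) \<Longrightarrow> \<Lambda>' \<in> T"
      using local_openD[OF T 1(2)] by metis
    have "\<Lambda>' \<in> S \<inter> T"
      if "\<Lambda>' \<in> X" "\<forall>x \<in> Q \<inter> ball 0 (max R R'). \<Lambda>' x = \<Lambda> x" for \<Lambda>'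
      using that by (intro IntI R R') auto
    then show "\<exists>R. \<forall>\<Lambda>'\<in>X. (\<forall>x \<in> Q \<inter> ball 0 R. \<Lambda>' x = \<Lambda> x) \<longrightarrow> \<Lambda>' \<in> S \<inter> T" by blast
  qed
next
  fix K assume K: "\<forall>S\<in>K. local_open X S"
  show "local_open X (\<Union>K)"
  proof (rule local_openI)
    show "\<Union>K \<subseteq> X" using K unfolding local_open_def by blast
    fix \<Lambda> assume "\<Lambda> \<in> \<Union>K"
    then obtain S where S: "S \<in> K" "\<Lambda> \<in> S" by blast
    then have "\<exists>R. \<forall>\<Lambda>'\<in>X. (\<forall>x \<in> Q \<inter> ball 0 R. \<Lambda>' x = \<Lambda> x) \<longrightarrow> \<Lambda>' \<in> S"
      using K unfolding local_open_def by blast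
    then show "\<exists>R. \<forall>\<Lambda>'\<in>X. (\<forall>x \<in> Q \<inter> ball 0 R. \<Lambda>' x = \<Lambda> x) \<longrightarrow> \<Lambda>' \<in> \<Union>K"
      using S(1) by (meson UnionI)
  qed
qed

definition uniquely_ergodic :: "'a topology \<Rightarrow> 'g set \<Rightarrow> ('g \<Rightarrow> 'a \<Rightarrow> 'a) \<Rightarrow> bool" where
  "uniquely_ergodic T G act \<longleftrightarrow> (\<exists>!\<mu>. sets \<mu> = sets (sigma (topspace T) {U. openin T U})
     \<and> prob_space \<mu> \<and> (\<forall>g\<in>G. distr \<mu> \<mu> (act g) = \<mu>))"

end

theory Submission
  imports Defs
begin

text \<open>Why the theorem holds. With a cyclic orientation of the three directions, the rule for the
  black lines and the rule for the colours take the same form: along the a-lines of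
  direction \<open>e\<close>, and along the w-lines perpendicular to \<open>e\<close>, every tile sends a mark
  forwards and requires a mark from behind; a tile with stripe in direction \<open>e\<close> just passes
  the mark on, and a tile with another direction sends a mark determined by its direction
  and requires the opposite one (\<open>rule_R1_iff\<close>, \<open>rule_R2_iff\<close>).

  In particular two consecutive tiles on such a line never have the same direction unless it
  is \<open>e\<close>. This alone forces a coset of \<open>2Q\<close> such that every other point carries a stripe
  along the level-1 edge on which it lies (\<open>first_level\<close>). The tiles on the coset satisfy
  the same rule again (\<open>renormalise\<close>), so induction produces cosets of \<open>2^k Q\<close> for all \<open>k\<close>,
  which are unique and form the address of the tiling in the completion of \<open>Q\<close>. Once the
  stripe directions are known, a mark is determined at every point whose a-line or w-line
  has finite level, by the nearest tile with another direction on that line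
  (\<open>forced_out_mark\<close>). The result is the same formula for all tilings: the parity of the
  number of the block, of length a power of 2, that contains the point. Hence the tile at
  \<open>x\<close> is a locally constant function of \<open>star x\<close> minus the address, outside the union of the
  six infinite lines through 0 in the completion.

  These lines are null sets for Haar measure, since each of them has infinitely many
  disjoint translates (\<open>singular_null\<close>). Therefore, firstly, if no point of \<open>Q\<close> lies on them
  relative to the address, then the points with a given tile form a regular model set whose
  window is open (\<open>regular_model_set_tile\<close>). Secondly, almost every address determines a
  tiling (\<open>decode_matching\<close>), and an invariant measure on tilings projects to Haar measure
  on addresses, from which it can be recovered; so there is exactly one, the image of Haar
  measure (\<open>nu_unique\<close>). Haar measure itself is constructed as the law of random binary
  digits (\<open>haar_Haar\<close>).

  It remains to identify the address with the value of the map \<open>\<xi>\<close> (\<open>xi_address\<close>), by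
  computing the levels of lines as divisibility conditions, and to see that genericity
  excludes the six lines (\<open>generic_decodable\<close>).\<close>


section \<open>Lattice coordinates and the combinatorial matching rule\<close>

text \<open>The rotation through 120 degrees permutes the directions \<open>D1\<close>, \<open>D2\<close>, \<open>D12\<close> cyclically,
  provided \<open>D12\<close> is oriented as \<open>- (a1 + a2)\<close>. With this orientation, opposite to that of
  \<open>dir_vec\<close>, all notions below are invariant under the rotation, so that most arguments need
  only one direction.\<close>

primrec rot :: "direction \<Rightarrow> direction" where
  "rot D1 = D2" | "rot D2 = D12" | "rot D12 = D1"

text \<open>A lattice point is the pair of its coefficients on \<open>a1\<close> and \<open>a2\<close>. In direction \<open>e\<close> it has
  the coordinates \<open>coord e z = (p, t)\<close> for which the point is the rotation, taking \<open>a1\<close> to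
  the oriented direction \<open>e\<close>, of \<open>p a1 + t a2\<close>: the first runs along the direction, the
  second transversally to it. The inverse is \<open>point e\<close>.\<close>

primrec coord :: "direction \<Rightarrow> int \<times> int \<Rightarrow> int \<times> int" where
  "coord D1 z = z"
| "coord D2 z = (snd z - fst z, - fst z)"
| "coord D12 z = (- snd z, fst z - snd z)"

primrec point :: "direction \<Rightarrow> int \<times> int \<Rightarrow> int \<times> int" where
  "point D1 w = w"
| "point D2 w = (- snd w, fst w - snd w)"
| "point D12 w = (snd w - fst w, - fst w)"

definition scl :: "int \<Rightarrow> int \<times> int \<Rightarrow> int \<times> int" where
  "scl c z = (c * fst z, c * snd z)"

text \<open>The a-lines of direction \<open>e\<close> are the level sets of the form \<open>t\<close> on the coordinates \<open>(p, t)\<close>,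
  the w-lines perpendicular to \<open>e\<close> those of \<open>2 p - t\<close>. The Boolean selects the kind of line
  (true for w-lines), and \<open>step\<close> is the translation from one lattice point to the next on
  such a line; both kinds of step increase \<open>p\<close> by 1.\<close>

definition line_form :: "bool \<Rightarrow> int \<times> int \<Rightarrow> int" where
  "line_form b w = (if b then 2 * fst w - snd w else snd w)"

definition step :: "bool \<Rightarrow> direction \<Rightarrow> int \<times> int" where
  "step b e = point e (1, if b then 2 else 0)"

text \<open>The side of the stripe and the red side, read relative to the cyclic orientation of the
  directions. In this reading the rule for black lines along the a-lines and the rule for
  colours along the w-lines become the same condition.\<close>

definition mark :: "bool \<Rightarrow> tile \<Rightarrow> bool" where
  "mark b T \<longleftrightarrow> ((if b then red_side T else stripe_side T) = LeftSide) \<noteq> (stripe_dir T = D12)"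

text \<open>For black lines, \<open>out_mark\<close> tells whether the black line leaving the tile through the edge
  in direction \<open>e\<close> passes to the left of the midpoint, and \<open>in_mark\<close> the same for the
  opposite edge. For colours, \<open>out_mark\<close> tells whether the diagonal perpendicular to \<open>e\<close> is
  red at its left end, and \<open>in_mark\<close> whether it is blue at its right end; reading blue there
  turns the demand of opposite colours into an equality. A tile whose stripe has direction
  \<open>e\<close> passes a mark on unchanged, every other tile emits a mark and requires the opposite
  one.\<close>

definition out_mark :: "bool \<Rightarrow> direction \<Rightarrow> tile \<Rightarrow> bool" where
  "out_mark b e T \<longleftrightarrow> (if stripe_dir T = e then mark b T else stripe_dir T = rot e)"

definition in_mark :: "bool \<Rightarrow> direction \<Rightarrow> tile \<Rightarrow> bool" where
  "in_mark b e T \<longleftrightarrow> (if stripe_dir T = e then mark b T else stripe_dir T \<noteq> rot e)"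

definition matching :: "(int \<times> int \<Rightarrow> tile) \<Rightarrow> bool" where
  "matching L \<longleftrightarrow> (\<forall>b e x. out_mark b e (L x) = in_mark b e (L (x + step b e)))"

definition eqmod :: "nat \<Rightarrow> int \<times> int \<Rightarrow> int \<times> int \<Rightarrow> bool" where
  "eqmod k x y \<longleftrightarrow> 2 ^ k dvd fst x - fst y \<and> 2 ^ k dvd snd x - snd y"

definition mkTile :: "direction \<Rightarrow> bool \<Rightarrow> bool \<Rightarrow> tile" where
  "mkTile d s r = Tile d (if s = (d \<noteq> D12) then LeftSide else RightSide)
     (if r = (d \<noteq> D12) then LeftSide else RightSide)"

lemma all_direction: "(\<forall>e. P e) \<longleftrightarrow> P D1 \<and> P D2 \<and> P D12"
  by (metis direction.exhaust)

lemma coord_point [simp]: "coord e (point e w) = w"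
  by (cases e) auto

lemma point_coord [simp]: "point e (coord e w) = w"
  by (cases e) auto

lemma coord_add: "coord e (x + y) = coord e x + coord e y"
  by (cases e) auto

lemma coord_diff: "coord e (x - y) = coord e x - coord e y"
  by (cases e) auto

lemma coord_uminus: "coord e (- x) = - coord e x"
  by (cases e) auto

lemma coord_scl: "coord e (scl c x) = scl c (coord e x)"
  by (cases e) (auto simp: scl_def algebra_simps)

lemma scl_one [simp]: "scl 1 x = x"
  by (simp add: scl_def)

lemma line_form_scl: "line_form b (scl c x) = c * line_form b x"
  by (auto simp: line_form_def scl_def algebra_simps)

lemma line_form_diff: "line_form b (x - y) = line_form b x - line_form b y"
  by (auto simp: line_form_def algebra_simps)

lemma line_form_add: "line_form b (x + y) = line_form b x + line_form b y"
  by (auto simp: line_form_def algebra_simps)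

lemma line_form_uminus: "line_form b (- x) = - line_form b x"
  by (auto simp: line_form_def algebra_simps)

lemma coord_step: "coord e (step b e) = (1, if b then 2 else 0)"
  by (simp add: step_def)

lemma line_form_step: "line_form b (coord e (step b e)) = 0"
  by (simp add: coord_step line_form_def)

lemma eqmod_iff: "eqmod k x y \<longleftrightarrow> (\<exists>z. x = y + scl (2 ^ k) z)"
proof
  assume "eqmod k x y"
  then obtain a b where "fst x - fst y = 2 ^ k * a" "snd x - snd y = 2 ^ k * b"
    unfolding eqmod_def dvd_def by auto
  then have "x = y + scl (2 ^ k) (a, b)" by (simp add: scl_def prod_eq_iff)
  then show "\<exists>z. x = y + scl (2 ^ k) z" ..
qed (auto simp: eqmod_def scl_def)

lemma eqmod_refl [simp]: "eqmod k x x"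
  by (simp add: eqmod_def)

lemma eqmod_sym: "eqmod k x y \<Longrightarrow> eqmod k y x"
  by (metis dvd_minus_iff eqmod_def minus_diff_eq)

lemma eqmod_trans: "eqmod k x y \<Longrightarrow> eqmod k y z \<Longrightarrow> eqmod k x z"
  unfolding eqmod_def using dvd_add[of "2 ^ k" "fst x - fst y" "fst y - fst z"]
    dvd_add[of "2 ^ k" "snd x - snd y" "snd y - snd z"] by simp

lemma eqmod_diff:
  assumes "eqmod k x y" "eqmod k x' y'" shows "eqmod k (x - x') (y - y')"
proof -
  obtain z z' where "x = y + scl (2 ^ k) z" "x' = y' + scl (2 ^ k) z'"
    using assms eqmod_iff by metis
  then have "x - x' = y - y' + scl (2 ^ k) (z - z')"
    by (simp add: scl_def prod_eq_iff algebra_simps)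
  then show ?thesis unfolding eqmod_iff ..
qed

lemma eqmod_mono: "eqmod k x y \<Longrightarrow> j \<le> k \<Longrightarrow> eqmod j x y"
  unfolding eqmod_def by (meson dvd_trans le_imp_power_dvd)

lemma eqmod_line_form:
  assumes "eqmod k x y" shows "2 ^ k dvd line_form b (coord e x) - line_form b (coord e y)"
  and "2 ^ k dvd fst (coord e x) - fst (coord e y)"
proof -
  obtain z where "x = y + scl (2 ^ k) z" using assms eqmod_iff by blast
  then show "2 ^ k dvd line_form b (coord e x) - line_form b (coord e y)"
    "2 ^ k dvd fst (coord e x) - fst (coord e y)"
    by (auto simp: coord_add line_form_add coord_scl line_form_scl) (simp add: scl_def)
qed

lemma mkTile_sel [simp]:
  "stripe_dir (mkTile d s r) = d" "mark False (mkTile d s r) = s" "mark True (mkTile d s r) = r"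
  by (auto simp: mkTile_def mark_def)

lemma tile_eqI:
  assumes "stripe_dir T = stripe_dir T'" "\<And>b. mark b T = mark b T'"
  shows "T = T'"
proof -
  have side: "a = b" if "(a = LeftSide) = (b = LeftSide)" for a b :: side
    using that by (cases a; cases b) auto
  have "stripe_side T = stripe_side T'" "red_side T = red_side T'"
    using assms(1) assms(2)[of False] assms(2)[of True] unfolding mark_def by (auto intro!: side)
  then show ?thesis using assms(1) by (simp add: tile.expand)
qed

section \<open>The vertices of the level-1 triangles\<close>

text \<open>A tile whose stripe is not in direction \<open>e\<close> emits a mark that only its own direction
  determines, and requires the opposite mark on the other side; so two consecutive tiles on
  a line of direction \<open>e\<close> can have equal stripe directions only if that direction is \<open>e\<close>.\<close>

lemma matching_same_dir:
  assumes "matching L" "stripe_dir (L x) = stripe_dir (L (x + step b e))"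
  shows "stripe_dir (L x) = e"
proof (rule ccontr)
  assume ne: "stripe_dir (L x) \<noteq> e"
  have "out_mark b e (L x) = in_mark b e (L (x + step b e))" using assms(1) unfolding matching_def
    by blast
  then show False using ne assms(2) unfolding out_mark_def in_mark_def by auto
qed

text \<open>The stripes of all six neighbours lie on lines through \<open>x\<close>, as at a vertex of a level-1
  triangle.\<close>

definition corner :: "(int \<times> int \<Rightarrow> direction) \<Rightarrow> int \<times> int \<Rightarrow> bool" where
  "corner d x \<longleftrightarrow> (\<forall>e. d (x + step False e) = e \<and> d (x - step False e) = e)"

text \<open>The direction of the level-1 edge whose midpoint is \<open>y\<close>, when the vertices of level 1 are
  the points with two even coordinates.\<close>

definition parity_dir :: "int \<times> int \<Rightarrow> direction" where
  "parity_dir y = (if odd (fst y) then if odd (snd y) then D12 else D1 else D2)"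

text \<open>That equal directions of consecutive tiles on a line force the direction of the line is all
  that the position of the level-1 vertices depends on. The lemmas \<open>n1\<close>, ..., \<open>n6\<close> are the
  instances for the three kinds of a-lines and the three kinds of w-lines.\<close>

locale local_rule =
  fixes d :: "int \<times> int \<Rightarrow> direction"
  assumes same_dir: "d x = d (x + step b e) \<Longrightarrow> d x = e"
begin

lemma n1: "d (m, n) = d (m + 1, n) \<Longrightarrow> d (m, n) = D1"
  using same_dir[of "(m, n)" False D1] by (simp add: step_def)
lemma n2: "d (m, n) = d (m, n + 1) \<Longrightarrow> d (m, n) = D2"
  using same_dir[of "(m, n)" False D2] by (simp add: step_def)
lemma n3: "d (m, n) = d (m + 1, n + 1) \<Longrightarrow> d (m, n) = D12"
  using same_dir[of "(m + 1, n + 1)" False D12] by (simp add: step_def)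
lemma n4: "d (m, n) = d (m + 1, n + 2) \<Longrightarrow> d (m, n) = D1"
  using same_dir[of "(m, n)" True D1] by (simp add: step_def)
lemma n5: "d (m, n) = d (m + 2, n + 1) \<Longrightarrow> d (m, n) = D2"
  using same_dir[of "(m + 2, n + 1)" True D2] by (simp add: step_def)
lemma n6: "d (m + 1, n) = d (m, n + 1) \<Longrightarrow> d (m + 1, n) = D12"
  using same_dir[of "(m, n + 1)" True D12] by (simp add: step_def)

text \<open>If the stripes of two adjacent neighbours of a point lie on lines through the point, then so
  does that of the next neighbour around the point: one of the two wrong directions is
  excluded by the adjacent neighbour along an a-line, the other one by the reflected
  neighbour along a w-line. Six such turns lead all around the point.\<close>

lemma turn1: "d (m + 1, n) = D1 \<Longrightarrow> d (m + 1, n + 1) = D12 \<Longrightarrow> d (m, n + 1) = D2"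
  using n1[of m "n + 1"] n6[of m n] by (cases "d (m, n + 1)") (auto simp: ac_simps)
lemma turn2: "d (m + 1, n + 1) = D12 \<Longrightarrow> d (m, n + 1) = D2 \<Longrightarrow> d (m - 1, n) = D1"
  using n3[of "m - 1" n] n5[of "m - 1" n] by (cases "d (m - 1, n)") (auto simp: ac_simps)
lemma turn3: "d (m, n + 1) = D2 \<Longrightarrow> d (m - 1, n) = D1 \<Longrightarrow> d (m - 1, n - 1) = D12"
  using n2[of "m - 1" "n - 1"] n4[of "m - 1" "n - 1"]
    by (cases "d (m - 1, n - 1)") (auto simp: ac_simps)
lemma turn4: "d (m - 1, n) = D1 \<Longrightarrow> d (m - 1, n - 1) = D12 \<Longrightarrow> d (m, n - 1) = D2"
  using n1[of "m - 1" "n - 1"] n6[of "m - 1" "n - 1"]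
    by (cases "d (m, n - 1)") (auto simp: ac_simps)
lemma turn5: "d (m - 1, n - 1) = D12 \<Longrightarrow> d (m, n - 1) = D2 \<Longrightarrow> d (m + 1, n) = D1"
  using n3[of "m" "n - 1"] n5[of "m - 1" "n - 1"] by (cases "d (m + 1, n)") (auto simp: ac_simps)
lemma turn6: "d (m, n - 1) = D2 \<Longrightarrow> d (m + 1, n) = D1 \<Longrightarrow> d (m + 1, n + 1) = D12"
  using n2[of "m + 1" "n"] n4[of "m" "n - 1"] by (cases "d (m + 1, n + 1)") (auto simp: ac_simps)

lemma corner_iff: "corner d (m, n) \<longleftrightarrow>
   d (m + 1, n) = D1 \<and> d (m + 1, n + 1) = D12 \<and> d (m, n + 1) = D2 \<and>
   d (m - 1, n) = D1 \<and> d (m - 1, n - 1) = D12 \<and> d (m, n - 1) = D2"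
  unfolding corner_def step_def
  by (auto simp: all_direction)
    

text \<open>Consider the directions on the triangle \<open>(0, 0)\<close>, \<open>(1, 0)\<close>, \<open>(1, 1)\<close>. If they are cyclic,
  each stripe following a side, then the reflected vertex \<open>(0, -1)\<close> has no possible
  direction. If each stripe is parallel to the opposite side, then \<open>(0, -1)\<close> is a corner. In
  all other cases one of the three vertices sees the other two stripes on lines through it
  and is a corner.\<close>

lemma corner_exists: "\<exists>x. corner d x"
proof -
  note dirs = n1[of 0 0] n2[of 1 0] n3[of 0 0]
    n2[of 0 "- 1"] n3[of 0 "- 1"] n4[of 0 "- 1"]
  have c: "\<exists>x. corner d x" if "d (m + 1, n) = D1" "d (m + 1, n + 1) = D12" for m n
    using that turn1 turn2 turn3 turn4 corner_iff by metis
  have c2: "\<exists>x. corner d x" if "d (m + 1, n + 1) = D12" "d (m, n + 1) = D2" for m n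
    using that turn2 turn3 turn4 turn5 corner_iff by metis
  have c3: "\<exists>x. corner d x" if "d (m, n + 1) = D2" "d (m - 1, n) = D1" for m n
    using that turn3 turn4 turn5 turn6 corner_iff by metis
  have c4: "\<exists>x. corner d x" if "d (m - 1, n - 1) = D12" "d (m, n - 1) = D2" for m n
    using that turn5 turn6 turn1 turn2 corner_iff by metis
  from c[of 0 0] c3[of 1 0] c4[of 1 1] c2[of 0 "- 1"] dirs show ?thesis
    by (cases "d (0, 0)"; cases "d (1, 0)"; cases "d (1, 1)"; cases "d (0, - 1)") simp_all
qed

text \<open>Some neighbour of the shifted point has two neighbours whose directions are known, and these
  leave only one direction for it; turns then lead around the shifted point.\<close>

lemma corner_shift:
  assumes "corner d (m, n)"
  shows "corner d (m + 2, n)" "corner d (m - 2, n)" "corner d (m, n + 2)" "corner d (m, n - 2)"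
proof -
  have c: "d (m + 1, n) = D1" "d (m + 1, n + 1) = D12" "d (m, n + 1) = D2"
   "d (m - 1, n) = D1" "d (m - 1, n - 1) = D12" "d (m, n - 1) = D2"
    using assms corner_iff by auto
  have 1: "d (m + 2, n + 1) = D2" 
    using n3[of "m + 1" n] n1[of "m + 1" "n + 1"] c
      by (cases "d (m + 2, n + 1)") (auto simp: ac_simps)
  show "corner d (m + 2, n)"
    using turn3[of "m + 2" n] turn4[of "m + 2" n] turn5[of "m + 2" n] turn6[of "m + 2" n] 1 c
    by (simp add: corner_iff ac_simps)
  have 2: "d (m - 2, n - 1) = D2"
    using n3[of "m - 2" "n - 1"] n1[of "m - 2" "n - 1"] c
      by (cases "d (m - 2, n - 1)") (auto simp: ac_simps)
  show "corner d (m - 2, n)"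
    using turn6[of "m - 2" n] turn1[of "m - 2" n] turn2[of "m - 2" n] turn3[of "m - 2" n] 2 c
    by (simp add: corner_iff ac_simps)
  have 3: "d (m + 1, n + 2) = D1"
    using n3[of m "n + 1"] n2[of "m + 1" "n + 1"] c
      by (cases "d (m + 1, n + 2)") (auto simp: ac_simps)
  show "corner d (m, n + 2)"
    using turn5[of m "n + 2"] turn6[of m "n + 2"] turn1[of m "n + 2"] turn2[of m "n + 2"]
      turn3[of m "n + 2"] turn4[of m "n + 2"] 3 c
    by (simp add: corner_iff ac_simps)
  have 4: "d (m - 1, n - 2) = D1"
    using n3[of "m - 1" "n - 2"] n2[of "m - 1" "n - 2"] c
      by (cases "d (m - 1, n - 2)") (auto simp: ac_simps)
  show "corner d (m, n - 2)"
    using turn2[of m "n - 2"] turn3[of m "n - 2"] turn4[of m "n - 2"] turn5[of m "n - 2"]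
      turn6[of m "n - 2"] turn1[of m "n - 2"] 4 c
    by (simp add: corner_iff ac_simps)
qed

lemma corner_lattice:
  assumes "corner d (m, n)" shows "corner d (m + 2 * i, n + 2 * j)"
proof -
  have "corner d (m + 2 * i, n)"
  proof (induction i rule: int_induct[where k = 0])
    case (step1 i) then show ?case using corner_shift(1) by (fastforce simp: algebra_simps)
  next
    case (step2 i) then show ?case using corner_shift(2) by (fastforce simp: algebra_simps)
  qed (use assms in simp)
  note base = this
  show ?thesis
  proof (induction j rule: int_induct[where k = 0])
    case (step1 i) then show ?case using corner_shift(3) by (fastforce simp: algebra_simps)
  next
    case (step2 i) then show ?case using corner_shift(4) by (fastforce simp: algebra_simps)
  qed (use base in simp)
qed

lemma first_level: "\<exists>v. \<forall>x. \<not> eqmod 1 x v \<longrightarrow> d x = parity_dir (x - v)"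
proof -
  obtain m n where c: "corner d (m, n)" using corner_exists by (metis surj_pair)
  have "d x = parity_dir (x - (m, n))" if ne: "\<not> eqmod 1 x (m, n)" for x
  proof -
    define r s where "r = (fst x - m) div 2" and "s = (snd x - n) div 2"
    have r: "fst x = m + 2 * r + (if odd (fst x - m) then 1 else 0)"
      unfolding r_def by presburger
    have s: "snd x = n + 2 * s + (if odd (snd x - n) then 1 else 0)"
      unfolding s_def by presburger
    have k: "corner d (m + 2 * r, n + 2 * s)" using corner_lattice[OF c] .
    have "odd (fst x - m) \<or> odd (snd x - n)" using ne by (auto simp: eqmod_def)
    then show ?thesis
      using k[unfolded corner_iff] r s by (cases x) (auto simp: parity_dir_def split: if_splits)
  qed
  then show ?thesis by blast
qed

end


section \<open>The model tiling around a singular point\<close>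

text \<open>The 2-adic valuation of \<open>a\<close> is smaller than that of \<open>b\<close>, where 0 has infinite valuation.\<close>

definition val_less :: "int \<Rightarrow> int \<Rightarrow> bool" where
  "val_less a b \<longleftrightarrow> (\<exists>j. 2 ^ j dvd b \<and> \<not> 2 ^ j dvd a)"

text \<open>The direction of the line of largest level through \<open>z\<close> in the family of triangulations with
  vertex sets \<open>2^k Q\<close>: it is determined by the parities of the odd part of \<open>z\<close>.\<close>

definition odd_dir :: "int \<times> int \<Rightarrow> direction" where
  "odd_dir z = (if val_less (fst z) (snd z) then D1 else if val_less (snd z) (fst z) then D2 else
    D12)"

text \<open>On the line of level \<open>k = multiplicity 2 t\<close>, a mark is constant on the blocks of \<open>2^k\<close>
  consecutive points and alternates from block to block.\<close>

definition block_even :: "int \<Rightarrow> int \<Rightarrow> bool" where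
  "block_even p t \<longleftrightarrow> even (p div 2 ^ multiplicity 2 t)"

definition model_mark :: "bool \<Rightarrow> direction \<Rightarrow> int \<times> int \<Rightarrow> bool" where
  "model_mark b e z = block_even (fst (coord e z)) (line_form b (coord e z))"

text \<open>The tiling belonging to the address 0. It is meaningful only at the points \<open>z\<close> on none of
  the six infinite lines through 0, that is, where no \<open>line_form\<close> vanishes; \<open>off_lines k z\<close>
  says that this is visible modulo \<open>2^k\<close>.\<close>

definition model_tile :: "int \<times> int \<Rightarrow> tile" where
  "model_tile z = mkTile (odd_dir z) (model_mark False (odd_dir z) z) (model_mark True (odd_dir
    z) z)"

definition off_lines :: "nat \<Rightarrow> int \<times> int \<Rightarrow> bool" where
  "off_lines k z \<longleftrightarrow> (\<forall>b e. \<not> 2 ^ k dvd line_form b (coord e z))"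

text \<open>\<open>L\<close> has the stripe directions of the family of triangulations whose level-\<open>k\<close> vertices are
  \<open>v + 2^k Q\<close>, at all points other than these vertices.\<close>

definition hierarchy :: "nat \<Rightarrow> int \<times> int \<Rightarrow> (int \<times> int \<Rightarrow> tile) \<Rightarrow> bool" where
  "hierarchy k v L \<longleftrightarrow> (\<forall>x. \<not> eqmod k x v \<longrightarrow> stripe_dir (L x) = odd_dir (x - v))"

lemma model_tile_sel [simp]:
  "stripe_dir (model_tile z) = odd_dir z" "mark b (model_tile z) = model_mark b (odd_dir z) z"
  by (cases b; simp add: model_tile_def)+

lemma structD: "hierarchy k v L \<Longrightarrow> \<not> eqmod k x v \<Longrightarrow> stripe_dir (L x) = odd_dir (x - v)"
  unfolding hierarchy_def by blast

lemma val_less_scl: 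
  assumes "odd a \<or> odd b" shows "val_less (2 ^ j * a) (2 ^ j * b) \<longleftrightarrow> odd a \<and> even b"
proof
  assume "val_less (2 ^ j * a) (2 ^ j * b)"
  then obtain i where i: "2 ^ i dvd 2 ^ j * b" "\<not> 2 ^ i dvd 2 ^ j * a" unfolding val_less_def
    by auto
  have "\<not> i \<le> j"
    using i(2) dvd_mult2[of "2 ^ i" "2 ^ j" a] le_imp_power_dvd[of i j "2::int"] by blast
  then have "2 ^ j * 2 dvd (2 ^ i :: int)"
    using le_imp_power_dvd[of "Suc j" i "2::int"] by (simp add: mult.commute)
  then have "2 ^ j * 2 dvd 2 ^ j * b" using i(1) dvd_trans by blast
  then have "even b" by simp
  then show "odd a \<and> even b" using assms by blast
next
  assume "odd a \<and> even b"
  then show "val_less (2 ^ j * a) (2 ^ j * b)" unfolding val_less_def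
    by (intro exI[of _ "Suc j"]) simp
qed

lemma odd_dir_scl:
  assumes "\<not> eqmod 1 y 0" shows "odd_dir (scl (2 ^ j) y) = parity_dir y"
  using assms val_less_scl[of "fst y" "snd y" j] val_less_scl[of "snd y" "fst y" j]
  by (auto simp: odd_dir_def scl_def parity_dir_def eqmod_def)

lemma odd_part:
  assumes "\<not> eqmod k z 0"
  obtains j y where "j < k" "z = scl (2 ^ j) y" "\<not> eqmod 1 y 0"
proof -
  define j where "j = (GREATEST j. eqmod j z 0)"
  have bound: "i \<le> k" if "eqmod i z 0" for i
    using that assms eqmod_mono nle_le by metis
  have e: "eqmod j z 0" unfolding j_def
    using GreatestI_nat[of "\<lambda>j. eqmod j z 0" 0 k] bound by (auto simp: eqmod_def)
  have n: "\<not> eqmod (Suc j) z 0" unfolding j_def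
    using Greatest_le_nat[of "\<lambda>j. eqmod j z 0" _ k] bound by (metis Suc_n_not_le_n)
  obtain y where y: "z = scl (2 ^ j) y" using e eqmod_iff by auto
  have "\<not> eqmod 1 y 0"
    using n y by (auto simp: eqmod_def scl_def)
  moreover have "j < k" using e bound assms by (metis le_neq_implies_less)
  ultimately show ?thesis using that y by blast
qed

lemma odd_dir_period:
  assumes "\<not> eqmod k z 0" "eqmod k z' z" shows "odd_dir z' = odd_dir z"
proof -
  obtain j y where y: "j < k" "z = scl (2 ^ j) y" "\<not> eqmod 1 y 0" using odd_part assms(1) .
  obtain w where w: "z' = z + scl (2 ^ k) w" using assms(2) eqmod_iff by blast
  define y' where "y' = y + scl (2 ^ (k - j)) w"
  have "2 ^ k = 2 ^ j * (2 ^ (k - j) :: int)" using y(1) by (simp flip: power_add)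
  then have z': "z' = scl (2 ^ j) y'" unfolding y'_def w y(2) by (simp add: scl_def algebra_simps)
  have "even (2 ^ (k - j) :: int)" using y(1) by simp
  then have "odd (fst y') = odd (fst y)" "odd (snd y') = odd (snd y)" 
    unfolding y'_def by (auto simp: scl_def)
  then have "\<not> eqmod 1 y' 0" "parity_dir y' = parity_dir y" using y(3)
    by (auto simp: eqmod_def parity_dir_def)
  then show ?thesis using odd_dir_scl[of y' j] odd_dir_scl[of y j] y(2,3) z' by simp
qed

text \<open>The direction is a comparison of valuations in every one of the rotated coordinate systems.\<close>

lemma odd_dir_coord:
  assumes "z \<noteq> 0"
  shows "odd_dir z = e \<longleftrightarrow> val_less (fst (coord e z)) (snd (coord e z))"
    and "odd_dir z = rot e \<longleftrightarrow> val_less (snd (coord e z)) (fst (coord e z))"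
proof -
  obtain k where "\<not> eqmod k z 0"
  proof -
    define N where "N = nat (\<bar>fst z\<bar> + \<bar>snd z\<bar>)"
    have lt: "int N < 2 ^ N" using of_nat_less_two_power[of N, where 'a = int] by simp
    have "\<not> (2 ^ N dvd fst z \<and> 2 ^ N dvd snd z)"
      using zdvd_imp_le[of "2 ^ N" "\<bar>fst z\<bar>"] zdvd_imp_le[of "2 ^ N" "\<bar>snd z\<bar>"] lt assms
      unfolding N_def by (auto simp: prod_eq_iff)
    then show ?thesis using that[of N] by (auto simp: eqmod_def)
  qed
  then obtain j y where y: "z = scl (2 ^ j) y" "\<not> eqmod 1 y 0" using odd_part by metis
  have o: "odd (fst (coord e y)) \<or> odd (snd (coord e y))"
    using y(2) by (cases e) (auto simp: eqmod_def)
  show "odd_dir z = e \<longleftrightarrow> val_less (fst (coord e z)) (snd (coord e z))"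
    unfolding y(1) odd_dir_scl[OF y(2)] coord_scl using val_less_scl[OF o, of j] y(2)
    by (cases e) (auto simp: scl_def parity_dir_def eqmod_def)
  show "odd_dir z = rot e \<longleftrightarrow> val_less (snd (coord e z)) (fst (coord e z))"
    unfolding y(1) odd_dir_scl[OF y(2)] coord_scl
      using val_less_scl[of "snd (coord e y)" "fst (coord e y)" j] o y(2)
    by (cases e) (auto simp: scl_def parity_dir_def eqmod_def)
qed

lemma mult2_decomp:
  fixes t :: int assumes "t \<noteq> 0"
  obtains u where "t = 2 ^ multiplicity 2 t * u" "odd u"
  using multiplicity_decompose'[of t 2] assms that by auto

text \<open>On a line of level \<open>\<kappa>\<close>, of either kind, the points dividing the line into blocks are those
  whose position \<open>p\<close> is a multiple of \<open>2^\<kappa>\<close>. They are the points with stripe not in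
  direction \<open>e\<close>, and the other two directions alternate along them. This is what makes the
  marks of \<open>model_mark\<close> consistent with the directions.\<close>

lemma odd_dir_line:
  assumes nz: "line_form b (coord e z) \<noteq> 0"
  defines "\<kappa> \<equiv> multiplicity 2 (line_form b (coord e z))"
  shows "odd_dir z = e \<longleftrightarrow> \<not> 2 ^ \<kappa> dvd fst (coord e z)"
    and "2 ^ \<kappa> dvd fst (coord e z) \<Longrightarrow> odd_dir z = rot e \<longleftrightarrow> model_mark b e z"
proof -
  obtain p t where pt: "coord e z = (p, t)" by (metis surj_pair)
  obtain u where u: "line_form b (p, t) = 2 ^ \<kappa> * u" "odd u"
    using mult2_decomp[OF nz] unfolding pt \<kappa>_def by metis
  have z0: "z \<noteq> 0" using nz by (cases e; cases b) (auto simp: line_form_def zero_prod_def)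
  note d = odd_dir_coord[OF z0, of e, unfolded pt, simplified]
  \<comment> \<open>at the block boundaries \<open>p = 2^\<kappa> q\<close>, the direction depends only on the parity of \<open>q\<close>\<close>
  have A: "\<not> val_less p t \<and> (val_less t p \<longleftrightarrow> even q)" if "p = 2 ^ \<kappa> * q" for q
  proof -
    define s where "s = (if b then 2 * q - u else u)"
    have "t = 2 ^ \<kappa> * s" "odd s" using u that unfolding s_def
      by (auto simp: line_form_def algebra_simps split: if_splits)
    then show ?thesis using val_less_scl[of q s \<kappa>] val_less_scl[of s q \<kappa>] that by auto
  qed
  \<comment> \<open>inside a block; on a w-line \<open>t = 2 p - 2^\<kappa> u\<close> has valuation one more than \<open>p\<close>, or higher\<close>
  have B: "val_less p t" if "\<not> 2 ^ \<kappa> dvd p"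
  proof (cases b)
    case False then show ?thesis using that u(1) unfolding val_less_def line_form_def
      by (intro exI[of _ \<kappa>]) auto
  next
    case True
    have p0: "p \<noteq> 0" using that by auto
    then obtain r where r: "p = 2 ^ multiplicity 2 p * r" "odd r" using mult2_decomp by metis
    define j where "j = multiplicity 2 p"
    have "j < \<kappa>"
    proof (rule ccontr)
      assume "\<not> j < \<kappa>"
      then have "(2::int) ^ \<kappa> dvd 2 ^ j" by (intro le_imp_power_dvd) simp
      then show False using that r(1) unfolding j_def by (metis dvd_mult2)
    qed
    then have "(2::int) ^ Suc j dvd 2 ^ \<kappa>" by (intro le_imp_power_dvd) simp
    then have "2 ^ Suc j dvd line_form b (p, t)" using u(1) by auto
    moreover have "2 ^ Suc j dvd 2 * p" unfolding j_def by (subst (2) r(1)) simp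
    ultimately have "2 ^ Suc j dvd t"
      using True dvd_diff[of "2 ^ Suc j" "2 * p" "line_form b (p, t)"]
      by (simp add: line_form_def)
    moreover have "\<not> 2 ^ Suc j dvd p" 
      using r(2) unfolding j_def by (subst (2) r(1)) simp
    ultimately show ?thesis unfolding val_less_def by blast
  qed
  show "odd_dir z = e \<longleftrightarrow> \<not> 2 ^ \<kappa> dvd fst (coord e z)"
    using A B d unfolding pt by (auto elim!: dvdE)
  show "odd_dir z = rot e \<longleftrightarrow> model_mark b e z" if "2 ^ \<kappa> dvd fst (coord e z)"
    using that A d(2) pt unfolding model_mark_def block_even_def \<kappa>_def[symmetric]
      by (auto elim!: dvdE)
qed

lemma div_minus_one:
  fixes p q :: int assumes "q > 0"
  shows "(p - 1) div q = (if q dvd p then p div q - 1 else p div q)"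
    and "\<not> q dvd p \<Longrightarrow> (p - 1) mod q = p mod q - 1"
proof -
  have 1: "p = q * (p div q) + p mod q" by simp
  have 2: "0 \<le> p mod q" "p mod q < q" using assms by auto
  show "(p - 1) div q = (if q dvd p then p div q - 1 else p div q)"
  proof (cases "q dvd p")
    case True
    then have "p - 1 = q * (p div q - 1) + (q - 1)" using 1 by (auto simp: algebra_simps)
    then have "(p - 1) div q = p div q - 1"
      using assms by (intro int_div_pos_eq[where r = "q - 1"]) auto
    then show ?thesis using True by simp
  next
    case False
    then have "p mod q \<noteq> 0" by auto
    then have "(p - 1) div q = p div q"
      using 1 2 by (intro int_div_pos_eq[where r = "p mod q - 1"]) auto
    then show ?thesis using False by simp
  qed
  show "(p - 1) mod q = p mod q - 1" if "\<not> q dvd p"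
  proof -
    have "p mod q \<noteq> 0" using that by auto
    then show ?thesis using 1 2 by (intro int_mod_pos_eq[where q = "p div q"]) auto
  qed
qed

lemma model_tile_out_mark:
  assumes "line_form b (coord e z) \<noteq> 0" shows "out_mark b e (model_tile z) = model_mark b e z"
  using odd_dir_line[OF assms] by (auto simp: out_mark_def)

lemma model_mark_back:
  "model_mark b e (z - step b e) \<longleftrightarrow> (if 2 ^ multiplicity 2 (line_form b (coord e z)) dvd fst
    (coord e z) then \<not> model_mark b e z else model_mark b e z)"
proof -
  have "line_form b (coord e (z - step b e)) = line_form b (coord e z)"
    by (simp add: coord_diff line_form_diff line_form_step)
  moreover have "fst (coord e (z - step b e)) = fst (coord e z) - 1"
    by (simp add: coord_diff coord_step)
  ultimately show ?thesis
    using div_minus_one(1)[of "2 ^ multiplicity 2 (line_form b (coord e z))" "fst (coord e z)"]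
    by (auto simp: model_mark_def block_even_def)
qed

lemma model_tile_in_mark:
  assumes "line_form b (coord e z) \<noteq> 0"
    shows "in_mark b e (model_tile z) = model_mark b e (z - step b e)"
  using odd_dir_line[OF assms] model_mark_back[of b e z] by (auto simp: in_mark_def)

text \<open>\<open>out_mark\<close> at a point and \<open>in_mark\<close> at the next point are both the mark of the block that
  starts at or contains the first of them.\<close>

lemma model_tile_rule:
  assumes "line_form b (coord e z) \<noteq> 0"
  shows "out_mark b e (model_tile z) = in_mark b e (model_tile (z + step b e))"
proof -
  have "line_form b (coord e (z + step b e)) \<noteq> 0" using assms
    by (simp add: coord_add line_form_add line_form_step)
  from model_tile_in_mark[OF this] model_tile_out_mark[OF assms] show ?thesis by simp
qed

lemma not_eqmod_line_form:
  "\<not> 2 ^ k dvd line_form b (coord e (x - v)) \<Longrightarrow> \<not> eqmod k x v"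
  using eqmod_line_form(1)[of k x v b e] by (auto simp: coord_diff line_form_diff)

section \<open>The hierarchy and the marks it forces\<close>

text \<open>The mark at \<open>x\<close> is carried back along the line, through tiles whose stripe has direction
  \<open>e\<close>, to the start of the block, where the tile has another direction and therefore
  determines its mark. The block contains no level-\<open>k\<close> vertex because the line form does not
  vanish modulo \<open>2^k\<close>.\<close>

lemma forced_out_mark:
  assumes "matching L" "hierarchy k v L" "\<not> 2 ^ k dvd line_form b (coord e (x - v))"
  shows "out_mark b e (L x) = model_mark b e (x - v)"
  using assms(3)
proof (induction "nat (fst (coord e (x - v)) mod 2 ^ multiplicity 2 (line_form b (coord e (x -
  v))))" arbitrary: x rule: less_induct)
  case less
  let ?\<kappa> = "multiplicity 2 (line_form b (coord e (x - v)))" and ?p = "fst (coord e (x - v))"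
  have nz: "line_form b (coord e (x - v)) \<noteq> 0" using less.prems by auto
  have dir: "stripe_dir (L x) = odd_dir (x - v)"
    using assms(2) not_eqmod_line_form[OF less.prems] unfolding hierarchy_def by blast
  note dl = odd_dir_line[OF nz]
  show ?case
  proof (cases "2 ^ ?\<kappa> dvd ?p")
    case True
    then show ?thesis using dl dir by (auto simp: out_mark_def)
  next
    case False
    define y where "y = x - step b e"
    have yv: "y - v = (x - v) - step b e" by (simp add: y_def)
    have t: "line_form b (coord e (y - v)) = line_form b (coord e (x - v))"
      unfolding yv by (simp add: coord_diff line_form_diff line_form_step)
    have p: "fst (coord e (y - v)) = ?p - 1" unfolding yv coord_diff[of _ "x - v"]
      by (simp add: coord_step)
    have "stripe_dir (L x) = e" using dl dir False by simp
    then have "out_mark b e (L x) = in_mark b e (L x)" by (simp add: out_mark_def in_mark_def)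
    also have "\<dots> = out_mark b e (L y)" using assms(1) unfolding matching_def y_def
      by (metis diff_add_cancel)
    also have "\<dots> = model_mark b e (y - v)"
    proof (rule less.hyps)
      have "?p mod 2 ^ ?\<kappa> \<noteq> 0" using False by (simp add: dvd_eq_mod_eq_0)
      moreover have "0 \<le> ?p mod 2 ^ ?\<kappa>" by simp
      ultimately have "0 < ?p mod 2 ^ ?\<kappa>" by linarith
      then show "nat (fst (coord e (y - v)) mod 2 ^ multiplicity 2 (line_form b (coord e (y - v))))
        < nat (?p mod 2 ^ ?\<kappa>)"
        using div_minus_one(2)[OF _ False] unfolding t p by simp
    qed (use less.prems t in simp)
    also have "\<dots> = model_mark b e (x - v)" unfolding yv model_mark_back using False by simp
    finally show ?thesis .
  qed
qed

lemma forced: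
  assumes "matching L" "hierarchy k v L" "off_lines k (x - v)"
  shows "L x = model_tile (x - v)"
proof (rule tile_eqI)
  have g: "\<not> 2 ^ k dvd line_form b (coord e (x - v))" for b e using assms(3)
    unfolding off_lines_def by blast
  show d: "stripe_dir (L x) = stripe_dir (model_tile (x - v))"
    using structD[OF assms(2) not_eqmod_line_form[OF g]] by simp
  show "mark b (L x) = mark b (model_tile (x - v))" for b
    using forced_out_mark[OF assms(1,2) g, of b "odd_dir (x - v)"] d by (simp add: out_mark_def)
qed

lemma model_mark_period:
  assumes "eqmod k z' z" "\<not> 2 ^ k dvd line_form b (coord e z)"
  shows "model_mark b e z' = model_mark b e z"
proof -
  obtain w where w: "z' = z + scl (2 ^ k) w" using assms eqmod_iff by blast
  let ?t = "line_form b (coord e z)" and ?\<kappa> = "multiplicity 2 (line_form b (coord e z))"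
  have t': "line_form b (coord e z') = ?t + 2 ^ k * line_form b (coord e w)"
    unfolding w by (simp add: coord_add line_form_add coord_scl line_form_scl)
  have p': "fst (coord e z') = fst (coord e z) + 2 ^ k * fst (coord e w)"
    unfolding w by (simp add: coord_add coord_scl) (simp add: scl_def)
  have d: "2 ^ j dvd line_form b (coord e z') \<longleftrightarrow> 2 ^ j dvd ?t" if "j \<le> k" for j
  proof -
    have "(2::int) ^ j dvd 2 ^ k" using that by (rule le_imp_power_dvd)
    then show ?thesis unfolding t' by (simp add: dvd_add_left_iff)
  qed
  have nz: "?t \<noteq> 0" using assms(2) by auto
  have k: "?\<kappa> < k" 
    using assms(2) nz power_dvd_iff_le_multiplicity[of ?t 2 k] by (simp add: not_le)
  have nz': "line_form b (coord e z') \<noteq> 0" using d[of k] assms(2) by auto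
  have "multiplicity 2 (line_form b (coord e z')) = ?\<kappa>"
    using d[of ?\<kappa>] d[of "Suc ?\<kappa>"] k nz
      by (intro multiplicity_eqI) (auto simp: multiplicity_dvd power_dvd_iff_le_multiplicity simp
      del: power_Suc)
  moreover have "fst (coord e z') div 2 ^ ?\<kappa> = fst (coord e z) div 2 ^ ?\<kappa> + 2 ^ (k - ?\<kappa>) * fst
    (coord e w)"
  proof -
    have "(2::int) ^ k = 2 ^ ?\<kappa> * 2 ^ (k - ?\<kappa>)" using k by (simp flip: power_add)
    then show ?thesis unfolding p' by (simp add: mult.assoc)
  qed
  moreover have "even (2 ^ (k - ?\<kappa>) :: int)" using k by simp
  ultimately show ?thesis unfolding model_mark_def block_even_def by simp
qed

lemma model_tile_period:
  assumes "eqmod k z' z" "off_lines k z" shows "model_tile z' = model_tile z"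
proof -
  have g: "\<not> 2 ^ k dvd line_form b (coord e z)" for b e using assms(2) unfolding off_lines_def
    by blast
  have "\<not> eqmod k z 0" using not_eqmod_line_form[of k False D1 z 0] g[of False D1] by simp
  then have "odd_dir z' = odd_dir z" using odd_dir_period[OF _ assms(1)] by blast
  then show ?thesis unfolding model_tile_def using model_mark_period[OF assms(1) g] by simp
qed

lemma off_lines_period: "eqmod k z' z \<Longrightarrow> off_lines k z' = off_lines k z"
  unfolding off_lines_def by (meson eqmod_line_form(1) dvd_diff_left_iff zdvd_zdiffD eqmod_sym)

lemma off_lines_mono: "off_lines j z \<Longrightarrow> j \<le> k \<Longrightarrow> off_lines k z"
  unfolding off_lines_def using le_imp_power_dvd dvd_trans by blast

lemma off_lines_uminus: "off_lines k (- z) = off_lines k z"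
  unfolding off_lines_def by (simp add: coord_uminus line_form_uminus)

lemma hierarchy_eqmod:
  assumes "hierarchy k v L" "eqmod k v' v" shows "hierarchy k v' L"
  unfolding hierarchy_def
proof (intro allI impI)
  fix x assume n: "\<not> eqmod k x v'"
  then have n2: "\<not> eqmod k x v" using assms(2) eqmod_trans eqmod_sym by blast
  have "eqmod k (x - v') (x - v)" using assms(2) eqmod_diff[of k x x] by simp
  moreover have "\<not> eqmod k (x - v) 0" using n2 by (simp add: eqmod_def)
  ultimately show "stripe_dir (L x) = odd_dir (x - v')"
    using odd_dir_period n2 assms(1) unfolding hierarchy_def by metis
qed

lemma hierarchy_mono: "hierarchy k v L \<Longrightarrow> j \<le> k \<Longrightarrow> hierarchy j v L"
  unfolding hierarchy_def using eqmod_mono by blast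

text \<open>If \<open>v' - v\<close> is \<open>2^j\<close> times an odd point, then some point \<open>v + 2^j u\<close> with odd \<open>u\<close> is given
  different directions by \<open>v\<close> and \<open>v'\<close>.\<close>

lemma hierarchy_unique:
  assumes "hierarchy k v L" "hierarchy k v' L" shows "eqmod k v' v"
proof (rule ccontr)
  assume "\<not> eqmod k v' v"
  then have "\<not> eqmod k (v' - v) 0" by (simp add: eqmod_def)
  then obtain j y where y: "j < k" "v' - v = scl (2 ^ j) y" "\<not> eqmod 1 y 0" using odd_part by metis
  \<comment> \<open>a unit step whose direction differs from that of \<open>y\<close>; then \<open>u\<close> and \<open>u - y\<close> have different directions\<close>
  define u :: "int \<times> int" where "u = (if parity_dir y = D1 then (0, 1) else (1, 0))"
  have u: "\<not> eqmod 1 u 0" "\<not> eqmod 1 (u - y) 0" "parity_dir (u - y) \<noteq> parity_dir u"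
    using y(3) unfolding u_def by (auto simp: eqmod_def parity_dir_def)
  have ne: "\<not> eqmod k (scl (2 ^ j) w) 0" if "\<not> eqmod 1 w 0" for w
  proof
    assume "eqmod k (scl (2 ^ j) w) 0"
    then have "eqmod (Suc j) (scl (2 ^ j) w) 0" using y(1) eqmod_mono by (metis Suc_leI)
    then show False using that by (simp add: eqmod_def scl_def)
  qed
  define x where "x = v + scl (2 ^ j) u"
  have 1: "x - v = scl (2 ^ j) u" by (simp add: x_def)
  have 2: "x - v' = scl (2 ^ j) (u - y)"
  proof -
    have "x - v' = scl (2 ^ j) u - (v' - v)" by (simp add: x_def)
    then show ?thesis unfolding y(2) by (simp add: scl_def algebra_simps)
  qed
  have "\<not> eqmod k x v" using ne[OF u(1)] 1[symmetric] by (simp add: eqmod_def)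
  moreover have "\<not> eqmod k x v'" using ne[OF u(2)] 2[symmetric] by (simp add: eqmod_def)
  ultimately have "odd_dir (x - v) = odd_dir (x - v')" using assms unfolding hierarchy_def by metis
  then show False unfolding 1 2 using odd_dir_scl u by simp
qed

text \<open>On a level-1 edge the marks at the two endpoints are passed on by the tile at the midpoint,
  so the tiles on the level-1 vertices obey the matching rule among themselves. The same
  holds for the marks along w-lines.\<close>

lemma renormalise:
  assumes "matching L" "\<forall>x. \<not> eqmod 1 x v \<longrightarrow> stripe_dir (L x) = parity_dir (x - v)"
  shows "matching (\<lambda>z. L (v + scl 2 z))"
  unfolding matching_def
proof (intro allI)
  fix b e x
  \<comment> \<open>the lattice point between two neighbouring level-1 vertices on the line\<close>
  define y where "y = v + scl 2 x + step b e"
  have y1: "\<not> eqmod 1 y v" unfolding y_def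
    by (cases e; cases b) (auto simp: step_def eqmod_def scl_def)
  have "parity_dir (y - v) = e" unfolding y_def
    by (cases e; cases b) (auto simp: step_def parity_dir_def scl_def)
  then have d: "stripe_dir (L y) = e" using assms(2) y1 by metis
  have "out_mark b e (L (v + scl 2 x)) = in_mark b e (L y)" using assms(1)
    unfolding matching_def y_def by blast
  also have "\<dots> = out_mark b e (L y)" using d by (simp add: out_mark_def in_mark_def)
  also have "\<dots> = in_mark b e (L (y + step b e))" using assms(1) unfolding matching_def by blast
  also have "y + step b e = v + scl 2 (x + step b e)" unfolding y_def
    by (simp add: scl_def prod_eq_iff)
  finally show "out_mark b e (L (v + scl 2 x)) = in_mark b e (L (v + scl 2 (x + step b e)))" .
qed

text \<open>Induction on the level: the level-1 vertices are found by the local argument, and the tiling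
  on these vertices, scaled down by 2, is again a matching tiling.\<close>

lemma hierarchy_exists:
  assumes "matching L" shows "\<exists>v. hierarchy k v L"
  using assms
proof (induction k arbitrary: L)
  case 0
  show ?case by (auto simp: hierarchy_def eqmod_def)
next
  case (Suc k)
  interpret local_rule "\<lambda>x. stripe_dir (L x)"
    by unfold_locales (rule matching_same_dir[OF Suc.prems])
  obtain v1 where v1: "\<forall>x. \<not> eqmod 1 x v1 \<longrightarrow> stripe_dir (L x) = parity_dir (x - v1)"
    using first_level by blast
  obtain w where w: "hierarchy k w (\<lambda>z. L (v1 + scl 2 z))"
    using Suc.IH[OF renormalise[OF Suc.prems v1]] by blast
  define v where "v = v1 + scl 2 w"
  have "stripe_dir (L x) = odd_dir (x - v)" if n: "\<not> eqmod (Suc k) x v" for x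
  proof (cases "eqmod 1 x v1")
    case False
    have o: "odd (fst (x - v1)) = odd (fst (x - v))" "odd (snd (x - v1)) = odd (snd (x - v))"
      by (simp_all add: v_def scl_def)
    then have "\<not> eqmod 1 (x - v) 0" "parity_dir (x - v) = parity_dir (x - v1)"
      using False by (auto simp: eqmod_def parity_dir_def)
    then have "odd_dir (x - v) = parity_dir (x - v1)" using odd_dir_scl[of "x - v" 0] by simp
    then show ?thesis using v1 False by metis
  next
    case True
    obtain z where z: "x = v1 + scl 2 z" using True eqmod_iff[of 1 x v1] by (metis power_one_right)
    have xv: "x - v = scl 2 (z - w)" unfolding z v_def by (simp add: scl_def prod_eq_iff)
    have zw: "\<not> eqmod k z w"
    proof
      assume "eqmod k z w"
      then obtain y where "z = w + scl (2 ^ k) y" using eqmod_iff by blast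
      then have "x = v + scl (2 ^ Suc k) y"
        unfolding z v_def by (simp add: scl_def prod_eq_iff algebra_simps)
      then show False using n eqmod_iff by blast
    qed
    have "stripe_dir (L x) = odd_dir (z - w)" using structD[OF w zw] z by simp
    moreover have "odd_dir (scl 2 (z - w)) = odd_dir (z - w)"
    proof -
      have "\<not> eqmod k (z - w) 0" using zw by (simp add: eqmod_def)
      then obtain j y where y: "z - w = scl (2 ^ j) y" "\<not> eqmod 1 y 0" using odd_part by metis
      have "scl 2 (z - w) = scl (2 ^ Suc j) y" unfolding y(1) by (simp add: scl_def)
      then show ?thesis using odd_dir_scl[OF y(2)] y(1) by metis
    qed
    ultimately show ?thesis unfolding xv by simp
  qed
  then show ?case unfolding hierarchy_def by blast
qed



section \<open>Cylinders in the completion\<close>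

definition pt :: "int \<times> int \<Rightarrow> complex" where
  "pt z = of_int (fst z) * a1 + of_int (snd z) * a2"

lemma pt_add: "pt (x + y) = pt x + pt y"
  by (simp add: pt_def algebra_simps)

lemma pt_diff: "pt (x - y) = pt x - pt y"
  by (simp add: pt_def algebra_simps)

lemma pt_uminus: "pt (- x) = - pt x"
  by (simp add: pt_def algebra_simps)

lemma pt_zero [simp]: "pt 0 = 0"
  by (simp add: pt_def)

lemma pt_scl: "pt (scl c x) = of_int c * pt x"
  by (simp add: pt_def scl_def algebra_simps)

lemma pt_in_Q [simp]: "pt z \<in> Q"
  unfolding Q_def pt_def by blast

lemma Q_pt: "x \<in> Q \<Longrightarrow> \<exists>z. x = pt z"
  unfolding Q_def pt_def by force

lemma Q_eq_range: "Q = range pt"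
  using Q_pt by auto

lemma pt_inj [simp]: "pt x = pt y \<longleftrightarrow> x = y"
proof
  assume "pt x = pt y"
  then have "Re (pt x) = Re (pt y)" "Im (pt x) = Im (pt y)" by auto
  then have "snd x = snd y" "fst x = fst y" by (auto simp: pt_def a1_def a2_def)
  then show "x = y" by (simp add: prod_eq_iff)
qed simp

lemma pt_coset: "pt x \<in> coset k (pt v) \<longleftrightarrow> eqmod k x v"
proof -
  have "pt x \<in> coset k (pt v) \<longleftrightarrow> (\<exists>z. pt x = pt (v + scl (2 ^ k) z))"
    unfolding coset_def Q_eq_range by (auto simp: pt_add pt_scl)
  then show ?thesis unfolding eqmod_iff by simp
qed

lemma coset_pt_eq: "coset k (pt x) = coset k (pt y) \<longleftrightarrow> eqmod k x y"
  using pt_coset coset_self coset_eqI by metis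

definition cyl :: "nat \<Rightarrow> int \<times> int \<Rightarrow> qbar set" where
  "cyl k v = {p. pt v \<in> cosets_of p k}"

lemma cosets_of_cyl: "p \<in> cyl k v \<longleftrightarrow> cosets_of p k = coset k (pt v)"
proof -
  obtain x where "x \<in> Q" "cosets_of p k = coset k x" using cosets_of[of p] by blast
  then show ?thesis unfolding cyl_def using coset_self coset_eqI by (metis mem_Collect_eq)
qed

lemma cyl_exists: "\<exists>v. p \<in> cyl k v"
proof -
  obtain x where "x \<in> Q" "cosets_of p k = coset k x" using cosets_of[of p] by blast
  then show ?thesis using Q_pt cosets_of_cyl by metis
qed

lemma cyl_eqmod: "p \<in> cyl k v \<Longrightarrow> p \<in> cyl k w \<longleftrightarrow> eqmod k w v"
  using cosets_of_cyl coset_pt_eq eqmod_sym by metis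

lemma cyl_mono: "p \<in> cyl k v \<Longrightarrow> j \<le> k \<Longrightarrow> p \<in> cyl j v"
proof -
  assume "p \<in> cyl k v" "j \<le> k"
  moreover have "cosets_of p k \<subseteq> cosets_of p j" if "j \<le> k"
    by (rule lift_Suc_antimono_le[of "cosets_of p"]) (use cosets_of[of p] that in auto)
  ultimately show "p \<in> cyl j v" unfolding cyl_def by blast
qed

lemma cyl_eqI: "(\<And>k v. p \<in> cyl k v \<Longrightarrow> q \<in> cyl k v) \<Longrightarrow> p = q"
  by (metis cyl_exists cosets_of_cyl cosets_of_inject ext)

lemma cyl_star: "star (pt v) \<in> cyl k w \<longleftrightarrow> eqmod k w v"
  unfolding cyl_def by (simp add: star.rep_eq pt_coset)

lemma cyl_add: "p \<in> cyl k v \<Longrightarrow> q \<in> cyl k w \<Longrightarrow> p + q \<in> cyl k (v + w)"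
  unfolding cyl_def by (auto simp: plus_qbar.rep_eq pt_add)

lemma cyl_uminus: "p \<in> cyl k v \<Longrightarrow> - p \<in> cyl k (- v)"
  unfolding cyl_def by (auto simp: uminus_qbar.rep_eq pt_uminus)

lemma cyl_diff: "p \<in> cyl k v \<Longrightarrow> q \<in> cyl k w \<Longrightarrow> p - q \<in> cyl k (v - w)"
  using cyl_add[of p k v "- q" "- w"] cyl_uminus[of q k w] by simp

lemma cyl_diff_iff: "p \<in> cyl k w \<Longrightarrow> q - p \<in> cyl k v \<longleftrightarrow> q \<in> cyl k (v + w)"
  using cyl_add[of "q - p" k v p w] cyl_diff[of q k "v + w" p w] by auto

lemma cyl_add_iff: "p \<in> cyl k w \<Longrightarrow> p + q \<in> cyl k v \<longleftrightarrow> q \<in> cyl k (v - w)"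
  using cyl_add[of p k w q "v - w"] cyl_diff[of "p + q" k v p w] by auto

lemma cyl_vimage_add: "p \<in> cyl k w \<Longrightarrow> (+) p -` cyl k v = cyl k (v - w)"
  unfolding vimage_def using cyl_add_iff by blast

lemma cyl_zero: "cyl 0 v = UNIV"
  using cyl_exists[of _ 0] cyl_eqmod[of _ 0] by (fastforce simp: eqmod_def)

lemma cyl_Int: "cyl k v \<inter> cyl j w = {} \<or> cyl k v \<inter> cyl j w = cyl k v \<or> cyl k v \<inter> cyl j w = cyl j w"
proof -
  have *: "cyl k v \<inter> cyl j w = {} \<or> cyl k v \<inter> cyl j w = cyl k v" if "j \<le> k" for k v j w
  proof -
    have "cyl k v \<subseteq> cyl j v" using cyl_mono that by blast
    moreover have "cyl j v \<inter> cyl j w = {} \<or> cyl j v = cyl j w"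
      using cosets_of_cyl by (auto simp: set_eq_iff)
    ultimately show ?thesis by blast
  qed
  show ?thesis using *[of j k v w] *[of k j w v] nle_le[of j k] by (metis Int_commute)
qed

lemma open_cyl: "open (cyl k v)"
  unfolding open_qbar_def
proof
  fix q assume "q \<in> cyl k v"
  then show "\<exists>j. \<forall>p. cosets_of p j = cosets_of q j \<longrightarrow> p \<in> cyl k v"
    by (intro exI[of _ k]) (simp add: cosets_of_cyl)
qed

lemma open_contains_cyl:
  assumes "open U" "p \<in> U" obtains k v where "p \<in> cyl k v" "cyl k v \<subseteq> U"
proof -
  obtain k where k: "\<And>q. cosets_of q k = cosets_of p k \<Longrightarrow> q \<in> U"
    using assms unfolding open_qbar_def by blast
  obtain v where "p \<in> cyl k v" using cyl_exists by blast
  then show ?thesis using that[of k v] k cosets_of_cyl by (metis subsetI)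
qed

lemma cyl_limit:
  assumes "\<And>k. eqmod k (v (Suc k)) (v k)" shows "\<exists>p. \<forall>k. p \<in> cyl k (v k)"
proof -
  have "coset (Suc k) (pt (v (Suc k))) \<subseteq> coset k (pt (v k))" for k
    using coset_mono[of k "pt (v (Suc k))"] assms[of k] coset_pt_eq by metis
  then have "(\<lambda>k. coset k (pt (v k))) \<in> {c. \<forall>k. (\<exists>x\<in>Q. c k = coset k x) \<and> c (Suc k) \<subseteq> c k}"
    by (auto intro: bexI[of _ "pt _"])
  then have "cosets_of (Abs_qbar (\<lambda>k. coset k (pt (v k)))) = (\<lambda>k. coset k (pt (v k)))"
    by (rule Abs_qbar_inverse)
  then have "\<forall>k. Abs_qbar (\<lambda>k. coset k (pt (v k))) \<in> cyl k (v k)"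
    by (simp add: cosets_of_cyl)
  then show ?thesis ..
qed

text \<open>Every cylinder of level \<open>k\<close> is covered by four cylinders of level \<open>k + 1\<close>.\<close>

lemma split_step:
  assumes "p \<in> cyl k v"
  obtains d where "d \<in> {0, 1} \<times> {0, 1}" "p \<in> cyl (Suc k) (v + scl (2 ^ k) d)"
proof -
  obtain w where w: "p \<in> cyl (Suc k) w" using cyl_exists by blast
  then have "p \<in> cyl k w" using cyl_mono by (metis le_SucI order_refl)
  then have "eqmod k w v" using assms cyl_eqmod by blast
  then obtain z where z: "w = v + scl (2 ^ k) z" using eqmod_iff by blast
  define d where "d = (fst z mod 2, snd z mod 2)"
  have dv: "(2::int) ^ k * 2 dvd 2 ^ k * (m mod 2) - 2 ^ k * m" for m
  proof -
    have "even (m mod 2 - m)" by presburger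
    then have "(2::int) ^ k * 2 dvd 2 ^ k * (m mod 2 - m)" by (rule mult_dvd_mono[OF dvd_refl])
    then show ?thesis by (simp add: algebra_simps)
  qed
  have "eqmod (Suc k) (v + scl (2 ^ k) d) w"
    unfolding z d_def eqmod_def using dv[of "fst z"] dv[of "snd z"]
    by (simp add: scl_def mult.commute[of 2] del: mod2_eq_if)
  then have "p \<in> cyl (Suc k) (v + scl (2 ^ k) d)" using w cyl_eqmod by blast
  moreover have "d \<in> {0, 1} \<times> {0, 1}" unfolding d_def by auto
  ultimately show ?thesis using that by blast
qed

text \<open>If no finite part of an open cover covers the group, then by successive subdivision there is
  a nested sequence of cylinders none of which is finitely covered; but its limit point has
  a cylinder neighbourhood inside a single member of the cover.\<close>

lemma compact_qbar: "compact (UNIV :: qbar set)"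
proof (rule ccontr)
  assume "\<not> ?thesis"
  then obtain C :: "qbar set set" where C: "\<forall>U\<in>C. open U" "UNIV \<subseteq> \<Union>C"
    and nofin: "\<not> (\<exists>D\<subseteq>C. finite D \<and> UNIV \<subseteq> \<Union>D)"
    unfolding compact_eq_Heine_Borel by blast
  define bad where "bad k v \<longleftrightarrow> \<not> (\<exists>D\<subseteq>C. finite D \<and> cyl k v \<subseteq> \<Union>D)" for k v
  have b0: "bad 0 0" unfolding bad_def cyl_zero using nofin .
  have bS: "\<exists>w. bad (Suc k) w \<and> eqmod k w v" if "bad k v" for k v
  proof (rule ccontr)
    assume neg: "\<not> ?thesis"
    have "\<exists>D\<subseteq>C. finite D \<and> cyl (Suc k) (v + scl (2 ^ k) d) \<subseteq> \<Union>D" for d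
      using neg eqmod_iff[of k "v + scl (2 ^ k) d" v] unfolding bad_def by blast
    then obtain D where D: "\<And>d. D d \<subseteq> C \<and> finite (D d) \<and> cyl (Suc k) (v + scl (2 ^ k) d) \<subseteq> \<Union>(D d)"
      by metis
    have "cyl k v \<subseteq> \<Union>(\<Union>d\<in>{0, 1} \<times> {0, 1}. D d)"
    proof
      fix p assume "p \<in> cyl k v"
      then obtain d where "d \<in> {0, 1} \<times> {0, 1}" "p \<in> cyl (Suc k) (v + scl (2 ^ k) d)"
        by (rule split_step)
      then have "p \<in> \<Union>(D d)" "d \<in> {0, 1} \<times> {0, 1}" using D[of d] by auto
      then show "p \<in> \<Union>(\<Union>d\<in>{0, 1} \<times> {0, 1}. D d)" by (metis UN_iff UnionE UnionI)
    qed
    moreover have "(\<Union>d\<in>{0, 1} \<times> {0, 1}. D d) \<subseteq> C" "finite (\<Union>d\<in>{0, 1} \<times> {0, 1}. D d)" using D by auto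
    ultimately show False using that unfolding bad_def by blast
  qed
  have "\<exists>v. \<forall>k. bad k (v k) \<and> eqmod k (v (Suc k)) (v k)"
    by (rule dependent_nat_choice) (use b0 bS in blast)+
  then obtain v where v: "\<And>k. bad k (v k)" "\<And>k. eqmod k (v (Suc k)) (v k)" by blast
  obtain p where p: "\<And>k. p \<in> cyl k (v k)" using cyl_limit[of v] v(2) by blast
  obtain U where U: "U \<in> C" "p \<in> U" using C by blast
  then obtain k w where kw: "p \<in> cyl k w" "cyl k w \<subseteq> U" using open_contains_cyl C by metis
  have "q \<in> cyl k w" if "q \<in> cyl k (v k)" for q
    using cyl_eqmod[OF p] cyl_eqmod[OF that] kw(1) by blast
  then have "cyl k (v k) \<subseteq> U" using kw(2) by blast
  then have "\<exists>D\<subseteq>C. finite D \<and> cyl k (v k) \<subseteq> \<Union>D" using U by (intro exI[of _ "{U}"]) auto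
  then show False using v(1) unfolding bad_def by blast
qed

lemma compact_closure_qbar: "compact (closure (W :: qbar set))"
  using compact_Int_closed[OF compact_qbar, of "closure W"] by simp

section \<open>Haar measure on the completion\<close>

definition cyls :: "qbar set set" where "cyls = insert {} (range (\<lambda>(k, v). cyl k v))"

lemma borel_eq_cyls: "(borel :: qbar measure) = sigma UNIV cyls"
proof (rule measure_eqI)
  have "sigma_sets UNIV {S :: qbar set. open S} = sigma_sets UNIV cyls"
  proof (rule sigma_sets_eqI)
    fix U :: "qbar set" assume "U \<in> {S. open S}"
    then have "open U" by simp
    have "\<exists>S\<in>cyls. p \<in> S \<and> S \<subseteq> U" if "p \<in> U" for p
      using open_contains_cyl[OF \<open>open U\<close> that] unfolding cyls_def
        by (metis insertCI case_prod_conv rangeI)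
    then have "U = \<Union>{S \<in> cyls. S \<subseteq> U}" by blast
    moreover have "countable {S \<in> cyls. S \<subseteq> U}" 
      by (rule countable_subset[of _ cyls]) (auto simp: cyls_def)
    then have "\<Union>{S \<in> cyls. S \<subseteq> U} \<in> sigma_sets UNIV cyls"
      by (intro sigma_sets_UNION) auto
    ultimately show "U \<in> sigma_sets UNIV cyls" by simp
  next
    fix S assume "S \<in> cyls"
    then have "open S" unfolding cyls_def using open_cyl by auto
    then show "S \<in> sigma_sets UNIV {S. open S}" by auto
  qed
  then show "sets borel = sets (sigma UNIV cyls)" by (simp add: borel_def)
qed (simp add: borel_def emeasure_sigma)

lemma cyl_borel [measurable]: "cyl k v \<in> sets borel"
  using open_cyl by simp

lemma measurable_cyl:
  assumes "\<And>k v. f -` cyl k v \<inter> space M \<in> sets M" shows "f \<in> measurable M (borel :: qbar measure)"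
  unfolding borel_eq_cyls
  by (rule measurable_measure_of) (use assms in \<open>auto simp: cyls_def\<close>)

lemma measurable_translate [measurable]: "(+) p \<in> measurable borel (borel :: qbar measure)"
proof (rule measurable_cyl)
  fix k v
  obtain w where "p \<in> cyl k w" using cyl_exists by blast
  then have "(+) p -` cyl k v = cyl k (v - w)" by (rule cyl_vimage_add)
  then show "(+) p -` cyl k v \<inter> space borel \<in> sets borel" by simp
qed

lemma cyl_measure_eqI:
  assumes "sets M = sets borel" "sets N = sets (borel :: qbar measure)" "finite_measure M"
    and "\<And>k v. emeasure M (cyl k v) = emeasure N (cyl k v)"
  shows "M = N"
proof (rule measure_eqI_generator_eq[of cyls UNIV M N "\<lambda>_. UNIV"])
  show "Int_stable cyls"
  proof (rule Int_stableI)
    fix A B assume "A \<in> cyls" "B \<in> cyls"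
    then consider "A \<inter> B = {}" | k v j w where "A = cyl k v" "B = cyl j w"
      unfolding cyls_def by auto
    then show "A \<inter> B \<in> cyls"
    proof cases
      case 1 then show ?thesis unfolding cyls_def by simp
    next
      case 2 then show ?thesis using cyl_Int[of k v j w] \<open>A \<in> cyls\<close> \<open>B \<in> cyls\<close>
        unfolding cyls_def by auto
    qed
  qed
  show "emeasure M UNIV \<noteq> \<infinity>" using assms(3) by (simp add: finite_measure.emeasure_finite)
  show "emeasure M X = emeasure N X" if "X \<in> cyls" for X using that assms(4) unfolding cyls_def
    by auto
  show "range (\<lambda>_. UNIV) \<subseteq> cyls"
    using rangeI[of "\<lambda>(k, v). cyl k v" "(0, 0)"] cyl_zero unfolding cyls_def by auto
qed (use assms in \<open>simp_all add: borel_eq_cyls\<close>)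

definition residue_box :: "nat \<Rightarrow> (int \<times> int) set" where
  "residue_box k = {0..<2 ^ k} \<times> {0..<2 ^ k}"

lemma cyl_partition:
  shows "(\<Union>v\<in>residue_box k. cyl k v) = UNIV" "disjoint_family_on (cyl k) (residue_box k)" "finite
    (residue_box k)" "card (residue_box k) = 4 ^ k"
proof -
  have "p \<in> (\<Union>v\<in>residue_box k. cyl k v)" for p
  proof -
    obtain v where v: "p \<in> cyl k v" using cyl_exists by blast
    define w where "w = (fst v mod 2 ^ k, snd v mod 2 ^ k)"
    have "eqmod k w v" unfolding eqmod_def w_def by (simp add: mod_eq_dvd_iff[symmetric])
    then have "p \<in> cyl k w" using v cyl_eqmod by blast
    moreover have "w \<in> residue_box k" unfolding residue_box_def w_def by simp
    ultimately show ?thesis by blast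
  qed
  then show "(\<Union>v\<in>residue_box k. cyl k v) = UNIV" by blast
  show "disjoint_family_on (cyl k) (residue_box k)"
    unfolding disjoint_family_on_def
  proof (intro ballI impI)
    fix v w assume vw: "v \<in> residue_box k" "w \<in> residue_box k" "v \<noteq> w"
    show "cyl k v \<inter> cyl k w = {}"
    proof (rule ccontr)
      assume "cyl k v \<inter> cyl k w \<noteq> {}"
      then have "eqmod k v w" using cyl_eqmod by blast
      then have "fst v mod 2 ^ k = fst w mod 2 ^ k" "snd v mod 2 ^ k = snd w mod 2 ^ k"
        unfolding eqmod_def by (simp_all add: mod_eq_dvd_iff)
      then show False using vw unfolding residue_box_def by (auto simp: prod_eq_iff)
    qed
  qed
  show "finite (residue_box k)" "card (residue_box k) = 4 ^ k"
    unfolding residue_box_def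
      by (simp_all add: card_cartesian_product nat_power_eq flip: power_mult_distrib)
qed

text \<open>The \<open>4^k\<close> cylinders of level \<open>k\<close> are translates of each other and partition the group.
  Invariance under the dense subgroup \<open>Q\<close> is enough for this, hence for the uniqueness of
  Haar measure.\<close>

lemma invariant_cyl_mass:
  assumes s: "sets M = sets (borel :: qbar measure)" and "prob_space M"
    and inv: "\<And>v. distr M borel ((+) (star (pt v))) = M"
  shows "emeasure M (cyl k v) = (1 / 4) ^ k"
proof -
  interpret prob_space M by fact
  have sp: "space M = UNIV" using s sets_eq_imp_space_eq by fastforce
  have ms: "cyl k v \<in> sets M" for k v using s by simp
  have m0: "measure M (cyl k v) = measure M (cyl k 0)" for v
  proof -
    have [measurable]: "(+) (star (pt v)) \<in> measurable M borel" using s measurable_translate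
      by (metis measurable_cong_sets)
    have "measure M (cyl k v) = measure (distr M borel ((+) (star (pt v)))) (cyl k v)"
      by (simp only: inv)
    also have "\<dots> = measure M ((+) (star (pt v)) -` cyl k v \<inter> space M)"
      by (rule measure_distr) auto
    also have "(+) (star (pt v)) -` cyl k v \<inter> space M = cyl k 0"
      using cyl_vimage_add[of "star (pt v)" k v v] by (simp add: cyl_star sp)
    finally show ?thesis .
  qed
  note P = cyl_partition[of k]
  have "1 = measure M (\<Union>v\<in>residue_box k. cyl k v)" using P(1) prob_space sp by simp
  also have "\<dots> = (\<Sum>v\<in>residue_box k. measure M (cyl k v))"
    using P ms by (intro finite_measure_finite_Union) auto
  also have "\<dots> = (\<Sum>v\<in>residue_box k. measure M (cyl k 0))" by (rule sum.cong[OF refl m0])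
  also have "\<dots> = 4 ^ k * measure M (cyl k 0)" unfolding sum_constant P(4) by simp
  finally have "measure M (cyl k v) = (1 / 4) ^ k" unfolding m0[of v] by (simp add: field_simps)
  then show ?thesis by (simp add: emeasure_eq_measure ennreal_power[symmetric]
    divide_ennreal[symmetric] flip: ennreal_numeral)
qed

text \<open>Haar measure is realised as the law of a random 2-adic expansion: each digit is an
  independent uniform choice among the four representatives of \<open>Q / 2Q\<close>.\<close>

definition digit :: "bool \<times> bool \<Rightarrow> int \<times> int" where
  "digit c = (of_bool (fst c), of_bool (snd c))"

primrec expansion :: "(nat \<Rightarrow> bool \<times> bool) \<Rightarrow> nat \<Rightarrow> int \<times> int" where
  "expansion \<omega> 0 = 0"
| "expansion \<omega> (Suc k) = expansion \<omega> k + scl (2 ^ k) (digit (\<omega> k))"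

lemma expansion_cong: "(\<And>i. i < k \<Longrightarrow> \<omega> i = \<omega>' i) \<Longrightarrow> expansion \<omega> k = expansion \<omega>' k"
  by (induction k) auto

lemma expansion_unique:
  assumes "eqmod k (expansion \<omega> k) (expansion \<omega>' k)" "i < k" shows "\<omega> i = \<omega>' i"
  using assms
proof (induction k arbitrary: i)
  case (Suc k)
  have k: "eqmod k (expansion \<omega> (Suc k)) (expansion \<omega>' (Suc k))"
    using Suc.prems(1) eqmod_mono by (metis le_SucI order_refl)
  have e: "eqmod k (expansion \<omega> j) (expansion \<omega> (Suc k))" if "j = k" for \<omega> j
    unfolding that eqmod_def by (simp add: scl_def)
  have IH: "eqmod k (expansion \<omega> k) (expansion \<omega>' k)"
    using e[of k \<omega>] e[of k \<omega>'] k eqmod_trans eqmod_sym by metis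
  then have "expansion \<omega> k = expansion \<omega>' k" using Suc.IH by (intro expansion_cong)
  then have "2 ^ Suc k dvd 2 ^ k * (fst (digit (\<omega> k)) - fst (digit (\<omega>' k)))"
      "2 ^ Suc k dvd 2 ^ k * (snd (digit (\<omega> k)) - snd (digit (\<omega>' k)))"
    using Suc.prems(1) by (simp_all add: eqmod_def scl_def algebra_simps)
  then have "even (fst (digit (\<omega> k)) - fst (digit (\<omega>' k)))" "even (snd (digit (\<omega> k)) - snd (digit
    (\<omega>' k)))"
    by simp_all
  then have "\<omega> k = \<omega>' k" by (auto simp: digit_def prod_eq_iff)
  then show ?case using Suc.IH[OF IH] Suc.prems(2) by (cases "i = k") auto
qed simp

lemma expansion_exists: "\<exists>\<omega>. eqmod k v (expansion \<omega> k)"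
proof (induction k)
  case (Suc k)
  then obtain \<omega> z where z: "v = expansion \<omega> k + scl (2 ^ k) z" using eqmod_iff by blast
  define \<omega>' where "\<omega>' = (\<lambda>i. if i = k then (odd (fst z), odd (snd z)) else \<omega> i)"
  have e: "expansion \<omega>' k = expansion \<omega> k" by (rule expansion_cong) (simp add: \<omega>'_def)
  have "2 * 2 ^ k dvd 2 ^ k * m - 2 ^ k * of_bool (odd m)" for m :: int
    by (cases "even m") (auto elim!: evenE oddE simp: algebra_simps)
  then have "eqmod (Suc k) v (expansion \<omega>' (Suc k))"
    unfolding z by (simp add: eqmod_def e) (simp add: scl_def digit_def \<omega>'_def)
  then show ?case by blast
qed (simp add: eqmod_def)

definition coins :: "(nat \<Rightarrow> bool \<times> bool) measure" where
  "coins = PiM UNIV (\<lambda>_. measure_pmf (pmf_of_set UNIV))"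

definition coin_limit :: "(nat \<Rightarrow> bool \<times> bool) \<Rightarrow> qbar" where
  "coin_limit \<omega> = (SOME p. \<forall>k. p \<in> cyl k (expansion \<omega> k))"

lemma coin_limit: "coin_limit \<omega> \<in> cyl k (expansion \<omega> k)"
proof -
  have "\<exists>p. \<forall>k. p \<in> cyl k (expansion \<omega> k)"
    by (rule cyl_limit) (simp add: eqmod_def scl_def)
  from someI_ex[OF this] show ?thesis unfolding coin_limit_def by blast
qed

definition Haar :: "qbar measure" where "Haar = distr coins borel coin_limit"

lemma coin_cyl:
  "coin_limit -` cyl k v \<inter> space coins \<in> sets coins"
  "emeasure coins (coin_limit -` cyl k v \<inter> space coins) = (1 / 4) ^ k"
proof -
  interpret product_prob_space "\<lambda>_::nat. measure_pmf (pmf_of_set (UNIV :: (bool \<times> bool) set))"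
    UNIV ..
  have sp: "space coins = UNIV" unfolding coins_def by (simp add: space_PiM)
  obtain \<omega>0 where w0: "eqmod k v (expansion \<omega>0 k)" using expansion_exists by blast
  have eq: "coin_limit -` cyl k v \<inter> space coins = {\<omega>\<in>space coins. \<forall>i\<in>{..<k}. \<omega> i \<in> {\<omega>0 i}}"
  proof (intro set_eqI iffI)
    fix \<omega> assume "\<omega> \<in> coin_limit -` cyl k v \<inter> space coins"
    then have "eqmod k v (expansion \<omega> k)" using coin_limit cyl_eqmod by blast
    then have "eqmod k (expansion \<omega> k) (expansion \<omega>0 k)" using w0 eqmod_sym eqmod_trans by blast
    then show "\<omega> \<in> {\<omega>\<in>space coins. \<forall>i\<in>{..<k}. \<omega> i \<in> {\<omega>0 i}}" using expansion_unique sp by auto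
  next
    fix \<omega> assume "\<omega> \<in> {\<omega>\<in>space coins. \<forall>i\<in>{..<k}. \<omega> i \<in> {\<omega>0 i}}"
    then have "expansion \<omega> k = expansion \<omega>0 k" by (intro expansion_cong) simp
    then have "coin_limit \<omega> \<in> cyl k v" using w0 coin_limit[of \<omega> k] cyl_eqmod by metis
    then show "\<omega> \<in> coin_limit -` cyl k v \<inter> space coins" using sp by simp
  qed
  show "coin_limit -` cyl k v \<inter> space coins \<in> sets coins"
    unfolding eq
  proof (intro sets.sets_Collect_finite_All)
    fix i :: nat
    have "(\<lambda>\<omega>. \<omega> i) \<in> measurable coins (measure_pmf (pmf_of_set UNIV))"
      unfolding coins_def by (rule measurable_component_singleton) simp
    from measurable_sets[OF this, of "{\<omega>0 i}"]
    show "{\<omega> \<in> space coins. \<omega> i \<in> {\<omega>0 i}} \<in> sets coins"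
      by (simp add: vimage_def Int_def conj_commute)
  qed simp
  have "emeasure coins {\<omega>\<in>space coins. \<forall>i\<in>{..<k}. \<omega> i \<in> {\<omega>0 i}}
     = (\<Prod>i\<in>{..<k}. emeasure (measure_pmf (pmf_of_set UNIV)) {\<omega>0 i})"
    unfolding coins_def by (rule emeasure_PiM_Collect) auto
  also have "\<dots> = (1 / 4) ^ k"
  proof -
    have "emeasure (measure_pmf (pmf_of_set UNIV)) {c :: bool \<times> bool} = 1 / 4" for c
      by (simp add: emeasure_pmf_single card_UNIV_bool divide_ennreal[symmetric] flip:
        ennreal_numeral ennreal_1)
    then show ?thesis by simp
  qed
  finally show "emeasure coins (coin_limit -` cyl k v \<inter> space coins) = (1 / 4) ^ k" unfolding eq .
qed

lemma coin_limit_measurable [measurable]: "coin_limit \<in> measurable coins borel"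
  by (rule measurable_cyl) (rule coin_cyl)

lemma sets_Haar [simp]: "sets Haar = sets borel" "space Haar = UNIV"
  unfolding Haar_def by auto

lemma prob_space_Haar: "prob_space Haar"
  unfolding Haar_def
proof (rule prob_space.prob_space_distr)
  interpret product_prob_space "\<lambda>_::nat. measure_pmf (pmf_of_set (UNIV :: (bool \<times> bool) set))"
    UNIV ..
  show "prob_space coins" unfolding coins_def by (rule prob_space_axioms)
qed simp

lemma Haar_cyl: "emeasure Haar (cyl k v) = (1 / 4) ^ k"
  unfolding Haar_def by (simp add: emeasure_distr coin_cyl)

lemma Haar_invariant: "distr Haar borel ((+) p) = Haar"
proof (rule cyl_measure_eqI)
  have m [measurable]: "(+) p \<in> measurable Haar borel"
    using measurable_translate by (simp add: Haar_def)
  show "finite_measure (distr Haar borel ((+) p))"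
    using prob_space.prob_space_distr[OF prob_space_Haar m] prob_space.finite_measure by blast
  fix k v
  obtain w where "p \<in> cyl k w" using cyl_exists by blast
  then have "(+) p -` cyl k v = cyl k (v - w)" by (rule cyl_vimage_add)
  then show "emeasure (distr Haar borel ((+) p)) (cyl k v) = emeasure Haar (cyl k v)"
    by (simp add: emeasure_distr Haar_cyl)
qed simp_all

lemma Haar_unique:
  assumes "sets M = sets (borel :: qbar measure)" "prob_space M" "\<And>v. distr M borel ((+) (star
    (pt v))) = M"
  shows "M = Haar"
  using cyl_measure_eqI[OF assms(1) _ prob_space.finite_measure[OF assms(2)], of Haar]
    invariant_cyl_mass[OF assms] Haar_cyl by simp

lemma haar_Haar: "haar Haar"
proof -
  have "distr Haar Haar ((+) p) = Haar" for p
    using Haar_invariant[of p] distr_cong[of Haar Haar Haar borel] by simp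
  then show ?thesis unfolding haar_def using prob_space_Haar by simp
qed

lemma Haar_translate:
  assumes "A \<in> sets borel" shows "emeasure Haar {p. q + p \<in> A} = emeasure Haar A"
proof -
  have [measurable]: "(+) q \<in> measurable Haar borel"
    using measurable_translate by (simp add: Haar_def)
  have "emeasure Haar A = emeasure (distr Haar borel ((+) q)) A" by (simp only: Haar_invariant)
  also have "\<dots> = emeasure Haar ((+) q -` A)" using assms by (simp add: emeasure_distr)
  finally show ?thesis by (simp add: vimage_def)
qed

section \<open>The singular set is null\<close>

text \<open>The points at which the address 0 leaves the tile undetermined: those on one of the six
  infinite lines through 0 (in the completion), that is, in the kernel of a line form.\<close>

definition singular :: "qbar set" where
  "singular = {p. \<forall>k v. p \<in> cyl k v \<longrightarrow> \<not> off_lines k v}"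

definition singular_line :: "bool \<Rightarrow> direction \<Rightarrow> qbar set" where
  "singular_line b e = {p. \<forall>k v. p \<in> cyl k v \<longrightarrow> 2 ^ k dvd line_form b (coord e v)}"

lemma singular_lineD: "p \<in> singular_line b e \<Longrightarrow> p \<in> cyl k v \<Longrightarrow> 2 ^ k dvd line_form b (coord e v)"
  unfolding singular_line_def by blast

lemma closed_singular: "singular \<in> sets borel"
proof -
  have "- singular = (\<Union>(k, v)\<in>{(k, v). off_lines k v}. cyl k v)" unfolding singular_def by auto
  then have "open (- singular)" using open_cyl by auto
  then show ?thesis by (simp add: borel_closed closed_def)
qed

lemma singular_line_borel: "singular_line b e \<in> sets borel"
proof -
  have "- singular_line b e = (\<Union>(k, v)\<in>{(k, v). \<not> 2 ^ k dvd line_form b (coord e v)}. cyl k v)"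
    unfolding singular_line_def by auto
  then have "open (- singular_line b e)" using open_cyl by auto
  then show ?thesis by (simp add: borel_closed closed_def)
qed

text \<open>The condition \<open>off_lines k v\<close> only gets weaker with growing \<open>k\<close>, so six different levels,
  one for each line, can be replaced by their maximum.\<close>

lemma singular_subset: "singular \<subseteq> (\<Union>b. \<Union>e. singular_line b e)"
proof
  fix p assume p: "p \<in> singular"
  show "p \<in> (\<Union>b. \<Union>e. singular_line b e)"
  proof (rule ccontr)
    assume "p \<notin> (\<Union>b. \<Union>e. singular_line b e)"
    then have "\<forall>b e. \<exists>k v. p \<in> cyl k v \<and> \<not> 2 ^ k dvd line_form b (coord e v)"
      unfolding singular_line_def by blast
    then obtain K V where KV: "\<And>b e. p \<in> cyl (K b e) (V b e)
      \<and> \<not> 2 ^ K b e dvd line_form b (coord e (V b e))" by metis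
    define k where "k = Max ((\<lambda>(b, e). K b e) ` (UNIV \<times> {D1, D2, D12}))"
    have k: "K b e \<le> k" for b e
      unfolding k_def by (cases e) (auto intro!: Max_ge simp: image_iff)
    obtain v where v: "p \<in> cyl k v" using cyl_exists by blast
    have "\<not> 2 ^ k dvd line_form b (coord e v)" for b e
    proof
      assume "2 ^ k dvd line_form b (coord e v)"
      then have d: "2 ^ K b e dvd line_form b (coord e v)"
        using k[of b e] le_imp_power_dvd dvd_trans by blast
      have "eqmod (K b e) v (V b e)" using cyl_mono[OF v k] KV cyl_eqmod by blast
      then have "2 ^ K b e dvd line_form b (coord e v) - line_form b (coord e (V b e))"
        by (rule eqmod_line_form)
      then have "2 ^ K b e dvd line_form b (coord e (V b e))" using d by (metis dvd_diff_right_iff)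
      then show False using KV by blast
    qed
    then have "off_lines k v" unfolding off_lines_def by blast
    then show False using p v unfolding singular_def by blast
  qed
qed

text \<open>A point \<open>u\<close> on which the line form is a unit has multiples translating the line to
  infinitely many disjoint copies of equal measure in a probability space.\<close>

lemma singular_line_null: "emeasure Haar (singular_line b e) = 0"
proof -
  interpret prob_space Haar by (rule prob_space_Haar)
  define u where "u = point e (0, 1)"
  have u: "\<bar>line_form b (coord e u)\<bar> = 1" unfolding u_def by (simp add: line_form_def)
  \<comment> \<open>the translates of the line by the multiples of \<open>u\<close>\<close>
  define A where "A j = {p. star (pt (scl (int j) u)) + p \<in> singular_line b e}" for j
  have Am: "measure Haar (A j) = measure Haar (singular_line b e)" for j
    unfolding A_def measure_def using Haar_translate[OF singular_line_borel] by simp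
  have As: "A j \<in> sets Haar" for j
    using measurable_sets[OF measurable_translate singular_line_borel, of "star (pt (scl (int j)
      u))" b e]
    by (simp add: A_def vimage_def)
  have disj: "disjoint_family_on A {..<n}" for n
    unfolding disjoint_family_on_def
  proof (intro ballI impI)
    fix i j :: nat assume "i \<noteq> j"
    show "A i \<inter> A j = {}"
    proof (rule ccontr)
      assume "A i \<inter> A j \<noteq> {}"
      then obtain p where p: "p \<in> A i" "p \<in> A j" by blast
      define k where "k = i + j"
      obtain v where v: "p \<in> cyl k v" using cyl_exists by blast
      have "2 ^ k dvd line_form b (coord e (scl (int l) u + v))" if "p \<in> A l" for l
      proof (rule singular_lineD)
        show "star (pt (scl (int l) u)) + p \<in> singular_line b e" using that unfolding A_def by simp
        show "star (pt (scl (int l) u)) + p \<in> cyl k (scl (int l) u + v)"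
          using v by (intro cyl_add) (simp_all add: cyl_star)
      qed
      from this[OF p(1)] this[OF p(2)]
      have "2 ^ k dvd line_form b (coord e (scl (int i) u + v)) - line_form b (coord e (scl (int
        j) u + v))"
        by (rule dvd_diff)
      then have "2 ^ k dvd (int i - int j) * line_form b (coord e u)"
        by (simp add: coord_add line_form_add coord_scl line_form_scl algebra_simps)
      then have "2 ^ k dvd \<bar>int i - int j\<bar>" using u
        by (metis abs_mult dvd_abs_iff mult.right_neutral)
      then have "2 ^ k \<le> \<bar>int i - int j\<bar>" using \<open>i \<noteq> j\<close> by (intro zdvd_imp_le) auto
      also have "\<dots> \<le> int k" unfolding k_def by simp
      also have "\<dots> < 2 ^ k" using of_nat_less_two_power[of k, where 'a = int] by simp
      finally show False by simp
    qed
  qed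
  have le: "real n * measure Haar (singular_line b e) \<le> 1" for n
  proof -
    have "real n * measure Haar (singular_line b e) = (\<Sum>j<n. measure Haar (A j))" by (simp add: Am)
    also have "\<dots> = measure Haar (\<Union>j<n. A j)"
      using disj As by (intro finite_measure_finite_Union[symmetric]) auto
    finally show ?thesis by simp
  qed
  have "measure Haar (singular_line b e) = 0"
  proof (rule ccontr)
    assume "measure Haar (singular_line b e) \<noteq> 0"
    then have pos: "measure Haar (singular_line b e) > 0" by (simp add: zero_less_measure_iff)
    obtain n where "1 / measure Haar (singular_line b e) < real n" using reals_Archimedean2 by blast
    then show False using le[of n] pos by (simp add: field_simps)
  qed
  then show ?thesis by (simp add: emeasure_eq_measure)
qed

lemma singular_null: "emeasure Haar singular = 0"
proof -
  have "(\<Union>b. \<Union>e. singular_line b e) \<in> null_sets Haar"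
  proof (intro null_sets_UN')
    show "countable (UNIV :: direction set)"
      by (rule countable_subset[of _ "{D1, D2, D12}"]) (auto intro: direction.exhaust)
  qed (auto simp: null_sets_def singular_line_null singular_line_borel)
  then show ?thesis
    using null_sets_subset[OF _ _ singular_subset] closed_singular by (simp add: null_sets_def)
qed

lemma singular_uminus: "- p \<in> singular \<longleftrightarrow> p \<in> singular"
proof -
  have "p \<in> singular" if "- p \<in> singular" for p
    using that cyl_uminus off_lines_uminus unfolding singular_def by blast
  from this this[of "- p"] show ?thesis by auto
qed



lemma sqrt3_simps [simp]: "sqrt 3 * sqrt 3 = 3" "sqrt 3 * (sqrt 3 * r) = 3 * r"
  by (simp_all flip: mult.assoc)

section \<open>From marked hexagons to the combinatorial rule\<close>

text \<open>The oriented unit vector of a direction in the plane; it differs from \<open>dir_vec\<close> in the sign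
  at \<open>D12\<close>.\<close>

primrec axis :: "direction \<Rightarrow> complex" where
  "axis D1 = 1"
| "axis D2 = Complex (- 1 / 2) (sqrt 3 / 2)"
| "axis D12 = Complex (- 1 / 2) (- sqrt 3 / 2)"

lemma pt_point: "pt (point e w) = axis e * pt w"
  by (cases e; simp add: pt_def complex_eq_iff a1_def a2_def algebra_simps)

lemma pt_step: "pt (step False e) = axis e" "pt (step True e) = axis e * (\<i> * sqrt 3)"
  by (simp_all add: step_def pt_point) (simp_all add: pt_def a1_def a2_def complex_eq_iff)

lemma cmod_axis [simp]: "cmod (axis e) = 1"
  by (cases e) (simp_all add: cmod_def power2_eq_square)

lemma axis_nonzero [simp]: "axis e \<noteq> 0"
  using cmod_axis[of e] by (metis norm_zero zero_neq_one)

lemma dir_vec_axis: "dir_vec e = (if e = D12 then - axis e else axis e)"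
  by (cases e) (simp_all add: a1_def a2_def complex_eq_iff)

lemma normal_mark:
  "normal (stripe_dir T) (stripe_side T) = (if mark False T then \<i> * axis (stripe_dir T) else -
    (\<i> * axis (stripe_dir T)))"
  "normal (stripe_dir T) (red_side T) = (if mark True T then \<i> * axis (stripe_dir T) else - (\<i> *
    axis (stripe_dir T)))"
  "normal (stripe_dir T) (opposite (red_side T)) = (if mark True T then - (\<i> * axis (stripe_dir
    T)) else \<i> * axis (stripe_dir T))"
  by (cases T; cases "stripe_side T"; cases "red_side T"; simp add: mark_def dir_vec_axis)+

text \<open>The edge common to the hexagons at \<open>x\<close> and \<open>x + u\<close>; in the frame that takes \<open>x\<close> to 0 and \<open>u\<close>
  to 1 it is a vertical segment on the line \<open>Re \<zeta> = 1/2\<close>.\<close>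

definition hex_edge :: "complex \<Rightarrow> complex \<Rightarrow> complex set" where
  "hex_edge x u = closed_segment (x + u * Complex (1 / 2) (- sqrt 3 / 6)) (x + u * Complex (1 /
    2) (sqrt 3 / 6))"

lemma hex_edge_swap: "hex_edge (x + u) (- u) = hex_edge x u"
proof -
  have "x + u + - u * Complex (1 / 2) (- sqrt 3 / 6) = x + u * Complex (1 / 2) (sqrt 3 / 6)"
    "x + u + - u * Complex (1 / 2) (sqrt 3 / 6) = x + u * Complex (1 / 2) (- sqrt 3 / 6)"
    by (simp_all add: complex_eq_iff algebra_simps)
  then show ?thesis unfolding hex_edge_def by (metis closed_segment_commute)
qed

lemma affine_segment:
  "closed_segment (x + u * P) (x + u * R) = (\<lambda>\<zeta>. x + u * \<zeta>) ` closed_segment P (R :: complex)"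
proof -
  have "closed_segment (u * P) (u * R) = (\<lambda>\<zeta>. u * \<zeta>) ` closed_segment P R"
    by (rule closed_segment_linear_image) (rule bounded_linear.linear[OF bounded_linear_mult_right])
  then show ?thesis by (simp add: closed_segment_translation image_image)
qed

lemma hex_edge_eq: "hex_edge x u = (\<lambda>\<zeta>. x + u * \<zeta>) ` {\<zeta>. Re \<zeta> = 1 / 2 \<and> \<bar>Im \<zeta>\<bar> \<le> sqrt 3 / 6}"
proof -
  have "closed_segment (Complex (1 / 2) (- sqrt 3 / 6)) (Complex (1 / 2) (sqrt 3 / 6))
     = {\<zeta>. Re \<zeta> = 1 / 2 \<and> \<bar>Im \<zeta>\<bar> \<le> sqrt 3 / 6}"
    by (auto simp: closed_segment_same_Re closed_segment_eq_real_ivl)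
  then show ?thesis unfolding hex_edge_def affine_segment by simp
qed

text \<open>The supporting line of the edge bounds a half-plane that contains all black lines of the
  tile, so a black segment can meet the edge only at an endpoint.\<close>

lemma segment_miss_hex_edge:
  assumes "u \<noteq> 0" "Re P < 1 / 2" "Re R < 1 / 2"
  shows "closed_segment (x + u * P) (x + u * R) \<inter> hex_edge x u = {}"
proof -
  have "Re \<zeta> < 1 / 2" if "\<zeta> \<in> closed_segment P R" for \<zeta>
  proof -
    have "convex {\<zeta>. Re \<zeta> < 1 / 2}" by (rule convex_halfspace_Re_lt)
    then have "closed_segment P R \<subseteq> {\<zeta>. Re \<zeta> < 1 / 2}"
      using assms by (intro closed_segment_subset) auto
    then show ?thesis using that by auto
  qed
  then show ?thesis unfolding affine_segment hex_edge_eq using assms(1) by fastforce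
qed

lemma segment_hit_hex_edge:
  assumes "u \<noteq> 0" "Re P < 1 / 2" "Re R = 1 / 2" "\<bar>Im R\<bar> \<le> sqrt 3 / 6"
  shows "closed_segment (x + u * P) (x + u * R) \<inter> hex_edge x u = {x + u * R}"
proof -
  have "\<zeta> = R" if z: "\<zeta> \<in> closed_segment P R" "Re \<zeta> = 1 / 2" for \<zeta>
  proof -
    obtain t where t: "0 \<le> t" "t \<le> 1" "\<zeta> = (1 - t) *\<^sub>R P + t *\<^sub>R R" using z(1) in_segment(1)
      by blast
    have "(1 - t) * (1 / 2 - Re P) = 0" using z(2) t(3) assms(3) by (simp add: field_simps)
    then have "t = 1" using assms(2) by simp
    then show ?thesis using t(3) by simp
  qed
  moreover have "R \<in> closed_segment P R" by simp
  ultimately show ?thesis unfolding affine_segment hex_edge_eq using assms by fastforce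
qed

text \<open>The four legs of the two V-shaped lines, for the signs \<open>\<sigma>\<close> (side of the stripe) and \<open>\<tau>\<close>
  (direction along it), in the frame with the stripe along the real axis.\<close>

definition leg :: "real \<Rightarrow> complex \<Rightarrow> complex \<Rightarrow> real \<Rightarrow> real \<Rightarrow> complex set" where
  "leg \<epsilon> x a \<sigma> \<tau> = closed_segment (x + a * Complex 0 (2 * \<epsilon> * \<sigma>))
     (x + a * Complex (\<tau> * (1 / 4 - \<epsilon> * sqrt 3 / 2)) (\<sigma> * (sqrt 3 / 4 + \<epsilon> / 2)))"

lemma sgn_leg:
  assumes a: "cmod a = 1" and n: "n = of_real \<sigma> * (\<i> * a)"
    and \<sigma>: "\<sigma> = 1 \<or> \<sigma> = -1" and \<tau>: "\<tau> = 1 \<or> \<tau> = -1"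
  shows "sgn (x + n / sqrt 3 - (x + (sqrt 3 *\<^sub>R n + of_real \<tau> * a) / 4))
    = a * Complex (- \<tau> * sqrt 3 / 2) (\<sigma> / 2)"
proof -
  let ?c = "a * Complex (- \<tau> * sqrt 3 / 2) (\<sigma> / 2)"
  have "\<tau>\<^sup>2 = 1" "\<sigma>\<^sup>2 = 1" using \<tau> \<sigma> by auto
  then have "cmod (Complex (- \<tau> * sqrt 3 / 2) (\<sigma> / 2)) = 1"
    by (simp add: complex_norm power_mult_distrib power_divide)
  then have c: "cmod ?c = 1" using a by (simp only: norm_mult)
  have "x + n / sqrt 3 - (x + (sqrt 3 *\<^sub>R n + of_real \<tau> * a) / 4) = (1 / (2 * sqrt 3)) *\<^sub>R ?c"
    unfolding n by (simp add: complex_eq_iff field_simps)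
  then have "sgn (x + n / sqrt 3 - (x + (sqrt 3 *\<^sub>R n + of_real \<tau> * a) / 4)) = sgn ?c"
    by (simp add: sgn_scaleR)
  also have "\<dots> = ?c" using c by (simp add: sgn_div_norm)
  finally show ?thesis .
qed

lemma V_line_leg:
  assumes a: "cmod a = 1" "dir_vec (stripe_dir T) = of_real \<kappa> * a" "\<kappa> = 1 \<or> \<kappa> = -1"
    and n: "normal (stripe_dir T) s = of_real \<sigma> * (\<i> * a)" "\<sigma> = 1 \<or> \<sigma> = -1"
  shows "V_line \<epsilon> x T s = leg \<epsilon> x a \<sigma> 1 \<union> leg \<epsilon> x a \<sigma> (-1)"
proof -
  have 1: "x + (2 * \<epsilon>) *\<^sub>R normal (stripe_dir T) s = x + a * Complex 0 (2 * \<epsilon> * \<sigma>)"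
    unfolding n by (simp add: complex_eq_iff)
  have 2: "x + (sqrt 3 *\<^sub>R normal (stripe_dir T) s + of_real \<tau> * a) / 4
      + \<epsilon> *\<^sub>R sgn (x + normal (stripe_dir T) s / sqrt 3 - (x + (sqrt 3 *\<^sub>R normal (stripe_dir T)
        s + of_real \<tau> * a) / 4))
     = x + a * Complex (\<tau> * (1 / 4 - \<epsilon> * sqrt 3 / 2)) (\<sigma> * (sqrt 3 / 4 + \<epsilon> / 2))" 
    if "\<tau> = 1 \<or> \<tau> = -1" for \<tau>
    unfolding sgn_leg[OF a(1) n that] unfolding n by (simp add: complex_eq_iff field_simps)
  have minus: "sqrt 3 *\<^sub>R normal (stripe_dir T) s - of_real \<kappa> * a
      = sqrt 3 *\<^sub>R normal (stripe_dir T) s + of_real (- \<kappa>) * a" by simp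
  have neg: "- \<kappa> = 1 \<or> - \<kappa> = -1" using a(3) by auto
  have "V_line \<epsilon> x T s = leg \<epsilon> x a \<sigma> \<kappa> \<union> leg \<epsilon> x a \<sigma> (- \<kappa>)"
    unfolding V_line_def Let_def a(2) minus 2[OF a(3)] 2[OF neg] leg_def 1 ..
  then show ?thesis using a(3) by (elim disjE) (simp_all add: Un_commute)
qed

lemma black_eq:
  "black \<epsilon> x T = (let a = axis (stripe_dir T); s = (if mark False T then \<epsilon> else - \<epsilon>) in
     closed_segment (x + a * Complex (- 1 / 2) s) (x + a * Complex (1 / 2) s)
     \<union> leg \<epsilon> x a 1 1 \<union> leg \<epsilon> x a 1 (-1) \<union> leg \<epsilon> x a (-1) 1 \<union> leg \<epsilon> x a (-1) (-1))"
proof -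
  let ?a = "axis (stripe_dir T)"
  define \<kappa> :: real where "\<kappa> = (if stripe_dir T = D12 then - 1 else 1)"
  have k: "dir_vec (stripe_dir T) = of_real \<kappa> * ?a" "\<kappa> = 1 \<or> \<kappa> = -1"
    by (simp_all add: \<kappa>_def dir_vec_axis)
  have n: "normal (stripe_dir T) LeftSide = of_real \<kappa> * (\<i> * ?a)" 
    "normal (stripe_dir T) RightSide = of_real (- \<kappa>) * (\<i> * ?a)" using k(1) by simp_all
  have V: "V_line \<epsilon> x T LeftSide = leg \<epsilon> x ?a \<kappa> 1 \<union> leg \<epsilon> x ?a \<kappa> (-1)"
    "V_line \<epsilon> x T RightSide = leg \<epsilon> x ?a (- \<kappa>) 1 \<union> leg \<epsilon> x ?a (- \<kappa>) (-1)"
    using k(2) by (auto intro!: V_line_leg[OF cmod_axis k n(1)] V_line_leg[OF cmod_axis k n(2)])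
  define s where "s = (if mark False T then \<epsilon> else - \<epsilon>)"
  have n': "\<epsilon> *\<^sub>R normal (stripe_dir T) (stripe_side T) = ?a * Complex 0 s"
    unfolding normal_mark s_def by (simp add: complex_eq_iff)
  have e: "x + ?a * Complex 0 s - of_real \<kappa> * ?a / 2 = x + ?a * Complex (- \<kappa> / 2) s"
    "x + ?a * Complex 0 s + of_real \<kappa> * ?a / 2 = x + ?a * Complex (\<kappa> / 2) s"
    by (simp_all add: complex_eq_iff field_simps)
  have S: "stripe \<epsilon> x T = closed_segment (x + ?a * Complex (- 1 / 2) s) (x + ?a * Complex (1 / 2)
    s)"
    using k(2) unfolding stripe_def Let_def n' k(1) e by (auto simp: closed_segment_commute)
  show ?thesis unfolding black_def V S Let_def s_def[symmetric] using k(2) by auto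
qed

lemma eps_bounds:
  fixes \<epsilon> :: real assumes "0 < \<epsilon>" "\<epsilon> \<le> 1 / 4"
  shows "\<epsilon> \<le> sqrt 3 / 6" "\<epsilon> * sqrt 3 < 1 / 2" "0 < \<epsilon> * sqrt 3"
proof -
  have a: "3 / 2 \<le> sqrt 3" by (rule real_le_rsqrt) (simp add: power2_eq_square)
  have b: "sqrt 3 < 2" by (rule real_less_lsqrt) simp_all
  show "\<epsilon> \<le> sqrt 3 / 6" using a assms by simp
  have "\<epsilon> * sqrt 3 \<le> (1 / 4) * sqrt 3" using assms by (intro mult_right_mono) auto
  also have "\<dots> < 1 / 2" using b by simp
  finally show "\<epsilon> * sqrt 3 < 1 / 2" .
  show "0 < \<epsilon> * sqrt 3" using assms by simp
qed

lemma leg_rot: "leg \<epsilon> x (u * q) \<sigma> \<tau> = closed_segment (x + u * (q * Complex 0 (2 * \<epsilon> * \<sigma>)))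
     (x + u * (q * Complex (\<tau> * (1 / 4 - \<epsilon> * sqrt 3 / 2)) (\<sigma> * (sqrt 3 / 4 + \<epsilon> / 2))))"
  unfolding leg_def by (simp only: mult.assoc)

text \<open>Each of the four legs ends on one of the four edges that the stripe does not meet. The edge
  and the direction of the stripe differ by the factor \<open>\<kappa> * axis d\<close>, which decides the leg
  that ends there. The bound \<open>\<epsilon> \<le> 1/4\<close> keeps the apex and the other endpoints off the edge.\<close>

lemma leg_hex_edge:
  assumes \<epsilon>: "0 < \<epsilon>" "\<epsilon> \<le> 1 / 4" and u: "u \<noteq> 0" and \<kappa>: "\<kappa> = 1 \<or> \<kappa> = -1"
    and \<sigma>: "\<sigma> = 1 \<or> \<sigma> = -1" and \<tau>: "\<tau> = 1 \<or> \<tau> = -1"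
  shows "leg \<epsilon> x (u * (of_real \<kappa> * axis d)) \<sigma> \<tau> \<inter> hex_edge x u
    = (if d \<noteq> D1 \<and> \<tau> = - \<kappa> \<and> \<sigma> = (if d = D2 then - \<kappa> else \<kappa>)
       then {x + u * Complex (1 / 2) (if d = D2 then \<epsilon> else - \<epsilon>)} else {})"
proof -
  note b = eps_bounds[OF \<epsilon>]
  let ?q = "of_real \<kappa> * axis d"
  let ?P = "?q * Complex 0 (2 * \<epsilon> * \<sigma>)"
  let ?R = "?q * Complex (\<tau> * (1 / 4 - \<epsilon> * sqrt 3 / 2)) (\<sigma> * (sqrt 3 / 4 + \<epsilon> / 2))"
  have P: "Re ?P < 1 / 2" using b \<kappa> \<sigma> by (cases d) (auto simp: algebra_simps)
  show ?thesis
  proof (cases "d \<noteq> D1 \<and> \<tau> = - \<kappa> \<and> \<sigma> = (if d = D2 then - \<kappa> else \<kappa>)")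
    case True
    have R: "?R = Complex (1 / 2) (if d = D2 then \<epsilon> else - \<epsilon>)"
      using True \<kappa> by (cases d) (auto simp: complex_eq_iff algebra_simps)
    have "closed_segment (x + u * ?P) (x + u * ?R) \<inter> hex_edge x u = {x + u * ?R}"
      using segment_hit_hex_edge[OF u P, of ?R x] b \<epsilon> unfolding R by auto
    then show ?thesis unfolding leg_rot using True R by simp
  next
    case False
    have "Re ?R < 1 / 2" using False b \<kappa> \<sigma> \<tau> by (cases d) (auto simp: algebra_simps)
    then have "closed_segment (x + u * ?P) (x + u * ?R) \<inter> hex_edge x u = {}"
      by (rule segment_miss_hex_edge[OF u P])
    then show ?thesis unfolding leg_rot using False by simp
  qed
qed

lemma stripe_hex_edge:
  assumes \<epsilon>: "0 < \<epsilon>" "\<epsilon> \<le> 1 / 4" and u: "u \<noteq> 0" and \<kappa>: "\<kappa> = 1 \<or> \<kappa> = -1"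
    and s: "s = \<epsilon> \<or> s = - \<epsilon>" and a: "a = u * (of_real \<kappa> * axis d)"
  shows "closed_segment (x + a * Complex (- 1 / 2) s) (x + a * Complex (1 / 2) s) \<inter> hex_edge x u
    = (if d = D1 then {x + u * Complex (1 / 2) (\<kappa> * s)} else {})"
proof -
  note b = eps_bounds[OF \<epsilon>]
  let ?q = "of_real \<kappa> * axis d"
  let ?P = "?q * Complex (- 1 / 2) s" and ?R = "?q * Complex (1 / 2) s"
  have swap: "closed_segment (x + a * Complex (- 1 / 2) s) (x + a * Complex (1 / 2) s) =
    closed_segment (x + u * ?P) (x + u * ?R)"
    unfolding a by (simp only: mult.assoc)
  consider "d = D1" "\<kappa> = 1" | "d = D1" "\<kappa> = -1" | "d \<noteq> D1" using \<kappa> by blast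
  then show ?thesis
  proof cases
    case 1
    have "Re ?P < 1 / 2" "?R = Complex (1 / 2) (\<kappa> * s)" using 1 by (simp_all add: complex_eq_iff)
    then show ?thesis using segment_hit_hex_edge[OF u, of ?P ?R x] 1 s b \<epsilon> unfolding swap by auto
  next
    case 2
    have "Re ?R < 1 / 2" "?P = Complex (1 / 2) (\<kappa> * s)" using 2 by (simp_all add: complex_eq_iff)
    then show ?thesis using segment_hit_hex_edge[OF u, of ?R ?P x] 2 s b \<epsilon>
      unfolding swap closed_segment_commute[of "x + u * ?P"] by auto
  next
    case 3
    have "Re ?P < 1 / 2" "Re ?R < 1 / 2" using 3 b s \<kappa> by (cases d; auto simp: algebra_simps)+
    then show ?thesis using segment_miss_hex_edge[OF u, of ?P ?R x] 3 unfolding swap by simp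
  qed
qed

lemma black_hex_edge_core:
  assumes \<epsilon>: "0 < \<epsilon>" "\<epsilon> \<le> 1 / 4" and u: "u \<noteq> 0" and \<kappa>: "\<kappa> = 1 \<or> \<kappa> = -1"
    and a: "axis (stripe_dir T) = u * (of_real \<kappa> * axis d)"
  shows "black \<epsilon> x T \<inter> hex_edge x u = {x + u * Complex (1 / 2)
      (if d = D1 then \<kappa> * (if mark False T then \<epsilon> else - \<epsilon>) else if d = D2 then \<epsilon> else - \<epsilon>)}"
proof -
  define s where "s = (if mark False T then \<epsilon> else - \<epsilon>)"
  have s: "s = \<epsilon> \<or> s = - \<epsilon>" by (simp add: s_def)
  define a where "a = axis (stripe_dir T)"
  have a: "a = u * (of_real \<kappa> * axis d)" using assms(5) by (simp only: a_def)
  note st = stripe_hex_edge[OF \<epsilon> u \<kappa> s a, of x]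
  note l = leg_hex_edge[OF \<epsilon> u \<kappa>, of _ _ x d, folded a]
  show ?thesis
    unfolding black_eq Let_def s_def[symmetric] a_def[symmetric] Int_Un_distrib2 st
    using l[of 1 1] l[of 1 "-1"] l[of "-1" 1] l[of "-1" "-1"] \<kappa>
    by (cases d; elim disjE) simp_all
qed

lemma axis_ratio:
  "axis e = axis e * axis D1" "axis (rot e) = axis e * axis D2" "axis (rot (rot e)) = axis e *
    axis D12"
  by (cases e; simp add: complex_eq_iff)+

lemma rot_cases: "d = e \<or> d = rot e \<or> d = rot (rot e)"
  by (cases d; cases e) auto

lemma rot_neq [simp]: "rot e \<noteq> e" "rot (rot e) \<noteq> e" "rot (rot e) \<noteq> rot e"
  by (cases e; simp)+

lemma black_out_mark:
  assumes \<epsilon>: "0 < \<epsilon>" "\<epsilon> \<le> 1 / 4"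
  shows "black \<epsilon> x T \<inter> hex_edge x (axis e) = {x + axis e * Complex (1 / 2) (if out_mark False e T
    then \<epsilon> else - \<epsilon>)}"
proof -
  note c = black_hex_edge_core[OF \<epsilon>, of "axis e" 1 T]
  consider "stripe_dir T = e" | "stripe_dir T = rot e" | "stripe_dir T = rot (rot e)"
    using rot_cases by blast
  then show ?thesis
  proof cases
    case 1 then show ?thesis using c[of D1 x] axis_ratio(1)[of e] by (simp add: out_mark_def)
  next
    case 2 then show ?thesis using c[of D2 x] axis_ratio(2)[of e] by (simp add: out_mark_def)
  next
    case 3 then show ?thesis using c[of D12 x] axis_ratio(3)[of e] by (simp add: out_mark_def)
  qed
qed

lemma black_in_mark:
  assumes \<epsilon>: "0 < \<epsilon>" "\<epsilon> \<le> 1 / 4"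
  shows "black \<epsilon> x T \<inter> hex_edge x (- axis e) = {x - axis e * Complex (1 / 2) (if in_mark False e
    T then - \<epsilon> else \<epsilon>)}"
proof -
  note c = black_hex_edge_core[OF \<epsilon>, of "- axis e" "-1" T]
  consider "stripe_dir T = e" | "stripe_dir T = rot e" | "stripe_dir T = rot (rot e)"
    using rot_cases by blast
  then show ?thesis
  proof cases
    case 1 then show ?thesis using c[of D1 x] axis_ratio(1)[of e] by (simp add: in_mark_def)
  next
    case 2 then show ?thesis using c[of D2 x] axis_ratio(2)[of e] by (simp add: in_mark_def)
  next
    case 3 then show ?thesis using c[of D12 x] axis_ratio(3)[of e] by (simp add: in_mark_def)
  qed
qed

text \<open>Each tile has exactly one black point on the edge, displaced by \<open>\<epsilon>\<close> to the side told by the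
  mark.\<close>

lemma hex_edge_match:
  assumes \<epsilon>: "0 < \<epsilon>" "\<epsilon> \<le> 1 / 4"
  shows "black \<epsilon> x T \<inter> hex_edge x (axis e) = black \<epsilon> (x + axis e) T' \<inter> hex_edge x (axis e)
    \<longleftrightarrow> out_mark False e T = in_mark False e T'"
proof -
  have 1: "black \<epsilon> (x + axis e) T' \<inter> hex_edge x (axis e)
     = {x + axis e - axis e * Complex (1 / 2) (if in_mark False e T' then - \<epsilon> else \<epsilon>)}"
    using black_in_mark[OF \<epsilon>, of "x + axis e" T' e] hex_edge_swap[of x "axis e"] by simp
  have 2: "x + axis e - axis e * Complex (1 / 2) t = x + axis e * Complex (1 / 2) (- t)" for t
    by (simp add: complex_eq_iff algebra_simps)
  show ?thesis unfolding black_out_mark[OF \<epsilon>] 1 2 using \<epsilon>(1) by auto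
qed

lemma Omega_pt: "Omega = (\<lambda>z. pt z / 3) ` {(2, 1), (-2, -1), (1, 2), (-1, -2), (-1, 1), (1, -1)}"
proof -
  have "w1 = pt (2, 1) / 3" "- w1 = pt (-2, -1) / 3" "w2 = pt (1, 2) / 3" "- w2 = pt (-1, -2) / 3"
    "w2 - w1 = pt (-1, 1) / 3" "- (w2 - w1) = pt (1, -1) / 3"
    by (simp_all add: w1_def w2_def pt_def complex_eq_iff a1_def a2_def field_simps)
  then show ?thesis unfolding Omega_def by (simp only: image_insert image_empty)
qed

lemma norm_pt: "(cmod (pt z))\<^sup>2 = of_int ((fst z)\<^sup>2 - fst z * snd z + (snd z)\<^sup>2)"
  unfolding cmod_power2 by (simp add: pt_def a1_def a2_def power2_eq_square field_simps)

lemma hex_edge_pt: "hex_edge x (pt z) = closed_segment (x + pt (fst z + snd z, 2 * snd z - fst z)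
  / 3) (x + pt (2 * fst z - snd z, fst z + snd z) / 3)"
proof -
  have "pt z * Complex (1 / 2) (- sqrt 3 / 6) = pt (fst z + snd z, 2 * snd z - fst z) / 3"
    "pt z * Complex (1 / 2) (sqrt 3 / 6) = pt (2 * fst z - snd z, fst z + snd z) / 3"
    by (simp_all add: pt_def a1_def a2_def complex_eq_iff field_simps)
  then show ?thesis unfolding hex_edge_def by (simp only:)
qed

definition units :: "(int \<times> int) set" where
  "units = {(1, 0), (-1, 0), (0, 1), (0, -1), (1, 1), (-1, -1)}"

text \<open>The vertices of a hexagon are thirds of lattice vectors, so adjacency of vertices and edges
  can be decided in integers by the quadratic form \<open>m^2 - m n + n^2\<close>.\<close>

lemma hex_edges_eq: "hex_edges x = (\<lambda>z. hex_edge x (pt z)) ` units"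
proof (intro equalityI subsetI)
  fix E assume "E \<in> hex_edges x"
  then obtain w w' where w: "w \<in> Omega" "w' \<in> Omega" "dist w w' = 1 / sqrt 3"
    "E = closed_segment (x + w) (x + w')" unfolding hex_edges_def by blast
  obtain z z' where z: "w = pt z / 3" "w' = pt z' / 3"
      "z \<in> {(2, 1), (-2, -1), (1, 2), (-1, -2), (-1, 1), (1, -1)}"
      "z' \<in> {(2, 1), (-2, -1), (1, 2), (-1, -2), (-1, 1), (1, -1)}"
    using w(1,2) unfolding Omega_pt by auto
  have "(dist w w')\<^sup>2 = (cmod (pt (z - z')))\<^sup>2 / 9"
    unfolding dist_norm z(1,2) pt_diff
      by (simp add: norm_divide power_divide flip: diff_divide_distrib)
  then have "(cmod (pt (z - z')))\<^sup>2 = 3" unfolding w(3) by (simp add: power_divide)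
  then have n: "(fst z - fst z')\<^sup>2 - (fst z - fst z') * (snd z - snd z') + (snd z - snd z')\<^sup>2 = 3"
    unfolding norm_pt by (simp only: fst_diff snd_diff of_int_eq_numeral_iff)
  have "\<exists>y\<in>units. (z = (fst y + snd y, 2 * snd y - fst y) \<and> z' = (2 * fst y - snd y, fst y + snd y))
     \<or> (z' = (fst y + snd y, 2 * snd y - fst y) \<and> z = (2 * fst y - snd y, fst y + snd y))"
    using z(3,4) n by (elim insertE emptyE) (simp_all add: units_def power2_eq_square)
  then obtain y where "y \<in> units" "(z = (fst y + snd y, 2 * snd y - fst y)
    \<and> z' = (2 * fst y - snd y, fst y + snd y))
     \<or> (z' = (fst y + snd y, 2 * snd y - fst y) \<and> z = (2 * fst y - snd y, fst y + snd y))" by blast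
  then have "E = hex_edge x (pt y)" unfolding hex_edge_pt w(4) z(1,2)
    by (auto simp: closed_segment_commute)
  then show "E \<in> (\<lambda>z. hex_edge x (pt z)) ` units" using \<open>y \<in> units\<close> by blast
next
  fix E assume "E \<in> (\<lambda>z. hex_edge x (pt z)) ` units"
  then obtain y where y: "y \<in> units" "E = hex_edge x (pt y)" by blast
  define z z' where zz: "z = (fst y + snd y, 2 * snd y - fst y)" "z' = (2 * fst y - snd y, fst y
    + snd y)"
  have m: "pt z / 3 \<in> Omega" "pt z' / 3 \<in> Omega" using y(1)[unfolded units_def]
    unfolding Omega_pt zz
    by (elim insertE emptyE; simp)+
  have "(cmod (pt (z - z')))\<^sup>2 = 3" unfolding norm_pt zz using y(1)[unfolded units_def]
    by (elim insertE emptyE) (simp_all add: power2_eq_square)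
  then have "cmod (pt (z - z')) = sqrt 3" by (metis norm_ge_zero real_sqrt_unique)
  then have "dist (pt z / 3) (pt z' / 3) = sqrt 3 / 3"
    unfolding dist_norm pt_diff by (simp add: norm_divide flip: diff_divide_distrib)
  also have "\<dots> = 1 / sqrt 3" by (simp add: field_simps)
  finally show "E \<in> hex_edges x"
    unfolding hex_edges_def y(2) hex_edge_pt zz[symmetric] using m by blast
qed

lemma range_direction: "range f = {f D1, f D2, f D12}"
proof -
  have "(UNIV :: direction set) = {D1, D2, D12}" using direction.exhaust by blast
  show ?thesis unfolding \<open>UNIV = _\<close> by (simp only: image_insert image_empty)
qed

lemma units_step: "units = range (step False) \<union> range (\<lambda>e. - step False e)"
proof -
  show ?thesis unfolding units_def range_direction by (auto simp: step_def)
qed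

text \<open>Equal edges have equal midpoints, hence \<open>2 (x' - x) = y - y'\<close>, and the six units are
  congruent modulo 2 only in opposite pairs.\<close>

lemma common_edge:
  assumes "y \<in> units" "y' \<in> units" "hex_edge (pt x) (pt y) = hex_edge (pt x') (pt y')" "x \<noteq> x'"
  shows "x' = x + y" "y' = - y"
proof -
  have sum2: "a + b = c + d" if "{a, b} = {c, d}" for a b c d :: complex
    using that by (auto simp: doubleton_eq_iff)
  have "{pt x + pt (fst y + snd y, 2 * snd y - fst y) / 3, pt x + pt (2 * fst y - snd y, fst y +
    snd y) / 3}
    = {pt x' + pt (fst y' + snd y', 2 * snd y' - fst y') / 3, pt x' + pt (2 * fst y' - snd y',
      fst y' + snd y') / 3}"
    using assms(3) unfolding hex_edge_pt closed_segment_eq .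
  then have "pt x + pt (fst y + snd y, 2 * snd y - fst y) / 3 + (pt x + pt (2 * fst y - snd y,
    fst y + snd y) / 3)
     = pt x' + pt (fst y' + snd y', 2 * snd y' - fst y') / 3 + (pt x' + pt (2 * fst y' - snd y',
       fst y' + snd y') / 3)"
    by (rule sum2)
  moreover have "pt (fst y + snd y, 2 * snd y - fst y) / 3 + pt (2 * fst y - snd y, fst y + snd
    y) / 3 = pt y" for y
    unfolding add_divide_distrib[symmetric] pt_add[symmetric] by (simp add: pt_def field_simps)
  ultimately have "pt x + pt x + pt y = pt x' + pt x' + pt y'"
    by (metis (no_types, lifting) add.assoc add.commute)
  then have "pt (x + x + y) = pt (x' + x' + y')" by (simp add: pt_add)
  then have "x + x + y = x' + x' + y'" by simp
  then have e: "2 * (fst x' - fst x) = fst y - fst y'" "2 * (snd x' - snd x) = snd y - snd y'"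
    by (auto simp: prod_eq_iff)
  have "y' = - y"
  proof (rule ccontr)
    assume n: "y' \<noteq> - y"
    have "even (fst y - fst y')" "even (snd y - snd y')" using e by (metis dvd_triv_left)+
    then have "fst y = fst y' \<and> snd y = snd y'"
      using assms(1,2) n unfolding units_def by (elim insertE emptyE) simp_all
    then have "fst x' = fst x" "snd x' = snd x" using e by auto
    then show False using assms(4) by (simp add: prod_eq_iff)
  qed
  then show "y' = - y" "x' = x + y" using e by (auto simp: prod_eq_iff)
qed

lemma rule_R1_iff:
  assumes \<epsilon>: "0 < \<epsilon>" "\<epsilon> \<le> 1 / 4"
  shows "rule_R1 \<epsilon> \<Lambda> \<longleftrightarrow> (\<forall>e x. out_mark False e (\<Lambda> (pt x)) = in_mark False e (\<Lambda> (pt (x + step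
    False e))))"
proof
  assume R: "rule_R1 \<epsilon> \<Lambda>"
  show "\<forall>e x. out_mark False e (\<Lambda> (pt x)) = in_mark False e (\<Lambda> (pt (x + step False e)))"
  proof (intro allI)
    fix e x
    have p: "pt (x + step False e) = pt x + axis e" by (simp add: pt_add pt_step)
    have "hex_edge (pt x) (axis e) \<in> hex_edges (pt x)"
      unfolding hex_edges_eq units_step using pt_step(1)[of e] by (metis UnI1 image_eqI rangeI)
    moreover have "hex_edge (pt x) (axis e) \<in> hex_edges (pt (x + step False e))"
      unfolding hex_edges_eq units_step p hex_edge_swap[symmetric, of _ "axis e"]
      using pt_step(1)[of e] pt_uminus by (metis UnI2 image_eqI rangeI)
    moreover have "pt x \<noteq> pt (x + step False e)" unfolding p by simp
    ultimately have "black \<epsilon> (pt x) (\<Lambda> (pt x)) \<inter> hex_edge (pt x) (axis e)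
      = black \<epsilon> (pt (x + step False e)) (\<Lambda> (pt (x + step False e))) \<inter> hex_edge (pt x) (axis e)"
      using R unfolding rule_R1_def by (meson IntI pt_in_Q)
    then show "out_mark False e (\<Lambda> (pt x)) = in_mark False e (\<Lambda> (pt (x + step False e)))"
      unfolding p using hex_edge_match[OF \<epsilon>] by blast
  qed
next
  assume R: "\<forall>e x. out_mark False e (\<Lambda> (pt x)) = in_mark False e (\<Lambda> (pt (x + step False e)))"
  have match: "black \<epsilon> (pt x) (\<Lambda> (pt x)) \<inter> hex_edge (pt x) (axis e)
      = black \<epsilon> (pt (x + step False e)) (\<Lambda> (pt (x + step False e)))
        \<inter> hex_edge (pt x) (axis e)" for x e
    using hex_edge_match[OF \<epsilon>, of "pt x" "\<Lambda> (pt x)" e "\<Lambda> (pt (x + step False e))"] R 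
    by (simp add: pt_add pt_step)
  show "rule_R1 \<epsilon> \<Lambda>" unfolding rule_R1_def
  proof (intro ballI impI)
    fix x x' E assume "x \<in> Q" "x' \<in> Q" "x \<noteq> x'" "E \<in> hex_edges x \<inter> hex_edges x'"
    then obtain y y' where y: "y \<in> units" "y' \<in> units" "E = hex_edge x (pt y)" "E = hex_edge x'
      (pt y')"
      unfolding hex_edges_eq by blast
    obtain z z' where zz: "x = pt z" "x' = pt z'" using Q_pt \<open>x \<in> Q\<close> \<open>x' \<in> Q\<close> by blast
    note z = zz(1) zz(2) \<open>x \<noteq> x'\<close>[unfolded zz] y
    have c: "z' = z + y" "y' = - y" using common_edge[of y y' z z'] z by metis+
    consider e where "y = step False e" | e where "y' = step False e"
      using z(4) c unfolding units_step by auto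
    then show "black \<epsilon> x (\<Lambda> x) \<inter> E = black \<epsilon> x' (\<Lambda> x') \<inter> E"
    proof cases
      case 1 then show ?thesis using match[of z e] z c by (simp add: pt_step)
    next
      case 2
      then have "y = - step False e" using c(2) by (metis minus_minus)
      then have "z = z' + step False e" using c(1) by simp
      then show ?thesis using match[of z' e] z(1,2,7) 2 by (simp add: pt_step)
    qed
  qed
qed

text \<open>A long diagonal meets the circle through the hexagon vertices only in its endpoints.\<close>

lemma endpoint_of_diameter:
  fixes c w x :: complex assumes "cmod w = cmod c"
  shows "x + w \<in> closed_segment (x - c) (x + c) \<longleftrightarrow> w = c \<or> w = - c"
    and "x + w \<in> closed_segment x (x + c) \<longleftrightarrow> w = c"
proof -
  show "x + w \<in> closed_segment x (x + c) \<longleftrightarrow> w = c"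
  proof
    assume "x + w \<in> closed_segment x (x + c)"
    then obtain t where t: "0 \<le> t" "t \<le> 1" "x + w = (1 - t) *\<^sub>R x + t *\<^sub>R (x + c)"
      unfolding in_segment by blast
    then have w: "w = t *\<^sub>R c" by (simp add: algebra_simps)
    then have "cmod c = t * cmod c" using assms t(1) by simp
    then show "w = c" using w by (cases "c = 0") auto
  qed simp
  show "x + w \<in> closed_segment (x - c) (x + c) \<longleftrightarrow> w = c \<or> w = - c"
  proof
    assume "x + w \<in> closed_segment (x - c) (x + c)"
    then obtain t where t: "0 \<le> t" "t \<le> 1" "x + w = (1 - t) *\<^sub>R (x - c) + t *\<^sub>R (x + c)"
      unfolding in_segment by blast
    then have w: "w = (2 * t - 1) *\<^sub>R c" by (simp add: algebra_simps complex_eq_iff)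
    then have "cmod c = \<bar>2 * t - 1\<bar> * cmod c" using assms by simp
    then have "c = 0 \<or> 2 * t - 1 = 1 \<or> 2 * t - 1 = -1" by auto
    then show "w = c \<or> w = - c" using w by auto
  next
    assume "w = c \<or> w = - c"
    then show "x + w \<in> closed_segment (x - c) (x + c)" by auto
  qed
qed

lemma cis_pi_6: "cis (pi / 6) = Complex (sqrt 3 / 2) (1 / 2)" "cis (- (pi / 6)) = Complex (sqrt 3
  / 2) (- 1 / 2)"
  by (simp_all add: complex_eq_iff cos_30 sin_30)

text \<open>The end, to the left of direction \<open>e\<close>, of the diagonal perpendicular to \<open>e\<close>.\<close>

definition vertex :: "direction \<Rightarrow> complex" where "vertex e = \<i> * axis e / sqrt 3"

lemma in_long_diagonal:
  assumes "cmod u = 1" "cmod w = 1 / sqrt 3"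
  shows "x + w \<in> long_diagonal x u \<longleftrightarrow> w * sqrt 3 = u \<or> w * sqrt 3 = - u"
proof -
  have "cmod w = cmod (u / sqrt 3)" using assms by (simp add: norm_divide)
  moreover have "w = - (u / sqrt 3) \<longleftrightarrow> w * sqrt 3 = - u" using eq_divide_eq[of w "- u" "sqrt 3"]
    by simp
  ultimately show ?thesis unfolding long_diagonal_def
    by (simp add: endpoint_of_diameter(1) eq_divide_eq)
qed

lemma in_half_diagonal:
  assumes "cmod u = 1" "cmod w = 1 / sqrt 3"
  shows "x + w \<in> closed_segment x (x + u / sqrt 3) \<longleftrightarrow> w * sqrt 3 = u"
proof -
  have "cmod w = cmod (u / sqrt 3)" using assms by (simp add: norm_divide)
  then show ?thesis by (simp add: endpoint_of_diameter(2) eq_divide_eq)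
qed

lemma in_red_blue:
  assumes "cmod w = 1 / sqrt 3"
  shows "x + w \<in> red x T \<longleftrightarrow> (let a = axis (stripe_dir T); c = a * Complex (sqrt 3 / 2) (- 1 / 2) in
      w * sqrt 3 = c \<or> w * sqrt 3 = - c \<or> w * sqrt 3 = (if mark True T then \<i> * a else - (\<i> * a)))"
    and "x + w \<in> blue x T \<longleftrightarrow> (let a = axis (stripe_dir T); c = a * Complex (sqrt 3 / 2) (1 / 2) in
      w * sqrt 3 = c \<or> w * sqrt 3 = - c \<or> w * sqrt 3 = (if mark True T then - (\<i> * a) else \<i> * a))"
proof -
  have v: "cmod (dir_vec e) = 1" for e
    by (cases "e = D12") (simp_all add: dir_vec_axis del: axis.simps)
  have dv: "cmod (dir_vec e * cis t) = 1" for e t by (simp add: norm_mult v)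
  have n: "cmod (normal d s) = 1" for d s by (cases s) (simp_all add: norm_mult v)
  show "x + w \<in> red x T \<longleftrightarrow> (let a = axis (stripe_dir T); c = a * Complex (sqrt 3 / 2) (- 1 / 2) in
      w * sqrt 3 = c \<or> w * sqrt 3 = - c \<or> w * sqrt 3 = (if mark True T then \<i> * a else - (\<i> * a)))"
    unfolding red_def Un_iff in_long_diagonal[OF dv assms]
      in_half_diagonal[OF n assms] unfolding normal_mark(2) cis_pi_6 Let_def
    by (auto simp: dir_vec_axis simp del: axis.simps)
  show "x + w \<in> blue x T \<longleftrightarrow> (let a = axis (stripe_dir T); c = a * Complex (sqrt 3 / 2) (1 / 2) in
      w * sqrt 3 = c \<or> w * sqrt 3 = - c \<or> w * sqrt 3 = (if mark True T then - (\<i> * a) else \<i> * a))"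
    unfolding blue_def Un_iff in_long_diagonal[OF dv assms]
      in_half_diagonal[OF n assms] unfolding normal_mark(3) cis_pi_6 Let_def
    by (auto simp: dir_vec_axis simp del: axis.simps)
qed

lemma colour_marks:
  "x + vertex e \<in> red x T \<longleftrightarrow> out_mark True e T" "x + vertex e \<in> blue x T \<longleftrightarrow> \<not> out_mark True e T"
  "x - vertex e \<in> red x T \<longleftrightarrow> \<not> in_mark True e T" "x - vertex e \<in> blue x T \<longleftrightarrow> in_mark True e T"
proof -
  have v: "cmod (vertex e) = 1 / sqrt 3" "cmod (- vertex e) = 1 / sqrt 3"
    by (simp_all add: vertex_def norm_mult norm_divide)
  have w: "vertex e * sqrt 3 = \<i> * axis e" "- vertex e * sqrt 3 = - (\<i> * axis e)"
    by (simp_all add: vertex_def)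
  have n: "x - vertex e = x + - vertex e" by simp
  consider "stripe_dir T = e" | "stripe_dir T = rot e" | "stripe_dir T = rot (rot e)"
    using rot_cases by blast
  note c = this
  show "x + vertex e \<in> red x T \<longleftrightarrow> out_mark True e T"
    unfolding in_red_blue[OF v(1)] w Let_def
      by (cases e; cases rule: c) (auto simp: out_mark_def complex_eq_iff)
  show "x + vertex e \<in> blue x T \<longleftrightarrow> \<not> out_mark True e T"
    unfolding in_red_blue[OF v(1)] w Let_def
      by (cases e; cases rule: c) (auto simp: out_mark_def complex_eq_iff)
  show "x - vertex e \<in> red x T \<longleftrightarrow> \<not> in_mark True e T"
    unfolding n in_red_blue[OF v(2)] w Let_def
      by (cases e; cases rule: c) (auto simp: in_mark_def complex_eq_iff)
  show "x - vertex e \<in> blue x T \<longleftrightarrow> in_mark True e T"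
    unfolding n in_red_blue[OF v(2)] w Let_def
      by (cases e; cases rule: c) (auto simp: in_mark_def complex_eq_iff)
qed

lemma Omega_vertex: "Omega = range vertex \<union> range (\<lambda>e. - vertex e)"
proof -
  have "vertex D1 = w2" "vertex D2 = - w1" "vertex D12 = - (w2 - w1)"
    by (simp_all add: vertex_def w1_def w2_def a1_def a2_def complex_eq_iff Re_divide Im_divide
      power2_eq_square field_simps)
  then show ?thesis unfolding Omega_def range_direction by auto
qed

text \<open>The rule at the vertex \<open>- vertex e\<close> of a tile is the rule at \<open>vertex e\<close> of the tile on the
  other side.\<close>

lemma rule_R2_iff:
  "rule_R2 \<Lambda> \<longleftrightarrow> (\<forall>e x. out_mark True e (\<Lambda> (pt x)) = in_mark True e (\<Lambda> (pt (x + step True e))))"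
proof -
  have v3: "3 * vertex e = pt (step True e)" for e
    by (simp add: vertex_def pt_step field_simps) (simp flip: of_real_mult)
  have s: "x + 2 * vertex e = (x + 3 * vertex e) - vertex e"
    "x + 2 * (- vertex e) = (x + 3 * (- vertex e)) + vertex e" "x + - vertex e = x - vertex e"
      for x e
    by simp_all
  have 1: "((x + vertex e \<in> red x (\<Lambda> x) \<and> x + 2 * vertex e \<in> blue (x + 3 * vertex e) (\<Lambda> (x + 3 *
    vertex e)))
    \<or> (x + vertex e \<in> blue x (\<Lambda> x) \<and> x + 2 * vertex e \<in> red (x + 3 * vertex e) (\<Lambda> (x + 3 * vertex
      e))))
    \<longleftrightarrow> out_mark True e (\<Lambda> x) = in_mark True e (\<Lambda> (x + pt (step True e)))" for x e
    unfolding s(1) colour_marks v3 by auto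
  have 2: "((x + - vertex e \<in> red x (\<Lambda> x) \<and> x + 2 * - vertex e \<in> blue (x + 3 * - vertex e) (\<Lambda> (x
    + 3 * - vertex e)))
    \<or> (x + - vertex e \<in> blue x (\<Lambda> x) \<and> x + 2 * - vertex e \<in> red (x + 3 * - vertex e) (\<Lambda> (x + 3 *
      - vertex e))))
    \<longleftrightarrow> out_mark True e (\<Lambda> (x - pt (step True e))) = in_mark True e (\<Lambda> x)" for x e
    unfolding s(2,3) colour_marks unfolding mult_minus_right v3 by auto
  have split: "(\<forall>w\<in>Omega. P w) \<longleftrightarrow> (\<forall>e. P (vertex e) \<and> P (- vertex e))" for P
    unfolding Omega_vertex by blast
  have "rule_R2 \<Lambda> \<longleftrightarrow> (\<forall>x\<in>Q. \<forall>e. out_mark True e (\<Lambda> x) = in_mark True e (\<Lambda> (x + pt (step True e)))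
      \<and> out_mark True e (\<Lambda> (x - pt (step True e))) = in_mark True e (\<Lambda> x))"
    unfolding rule_R2_def split 1 2 ..
  also have "\<dots> \<longleftrightarrow> (\<forall>e x. out_mark True e (\<Lambda> (pt x)) = in_mark True e (\<Lambda> (pt x + pt (step True
    e))))" (is "?l \<longleftrightarrow> ?r")
  proof
    assume ?l then show ?r by simp
  next
    assume r: ?r
    show ?l
    proof (intro ballI allI)
      fix x e assume "x \<in> Q"
      then obtain z where z: "x = pt z" using Q_pt by blast
      show "out_mark True e (\<Lambda> x) = in_mark True e (\<Lambda> (x + pt (step True e)))
          \<and> out_mark True e (\<Lambda> (x - pt (step True e))) = in_mark True e (\<Lambda> x)"
        using r[rule_format, of e z] r[rule_format, of e "z - step True e"] unfolding z pt_diff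
          by simp
    qed
  qed
  finally show ?thesis by (simp add: pt_add)
qed

lemma XQ_iff:
  assumes "0 < \<epsilon>" "\<epsilon> \<le> 1 / 4"
  shows "\<Lambda> \<in> XQ \<epsilon> \<longleftrightarrow> \<Lambda> \<in> extensional Q \<and> matching (\<lambda>z. \<Lambda> (pt z))"
proof -
  have "matching (\<lambda>z. \<Lambda> (pt z)) \<longleftrightarrow> rule_R1 \<epsilon> \<Lambda> \<and> rule_R2 \<Lambda>"
    unfolding matching_def rule_R1_iff[OF assms] rule_R2_iff by (metis (full_types))
  then show ?thesis unfolding XQ_def PiE_def by auto
qed



section \<open>Windows and addresses\<close>

text \<open>The open set of \<open>p\<close> such that a tiling with address 0 must have the tile \<open>T\<close> at a point with
  star image \<open>p\<close>.\<close>

definition window :: "tile \<Rightarrow> qbar set" where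
  "window T = {p. \<exists>k z. p \<in> cyl k z \<and> off_lines k z \<and> model_tile z = T}"

lemma window_iff:
  assumes "p \<in> cyl k z" "off_lines k z" shows "p \<in> window T \<longleftrightarrow> model_tile z = T"
proof
  assume "p \<in> window T"
  then obtain j y where y: "p \<in> cyl j y" "off_lines j y" "model_tile y = T" unfolding window_def
    by blast
  show "model_tile z = T"
  proof (cases "j \<le> k")
    case True
    then have "eqmod j z y" using assms(1) y(1) cyl_mono cyl_eqmod by blast
    then show ?thesis using model_tile_period y by metis
  next
    case False
    then have "eqmod k y z" using assms(1) y(1) cyl_mono[of p j y k] cyl_eqmod by (metis nle_le)
    then show ?thesis using model_tile_period assms(2) y(3) by metis
  qed
next
  assume "model_tile z = T" then show "p \<in> window T" unfolding window_def using assms by blast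
qed

lemma nonsingular_window: "p \<notin> singular \<longleftrightarrow> (\<exists>T. p \<in> window T)"
  unfolding singular_def window_def by blast

lemma window_disjoint: "p \<in> window T \<Longrightarrow> p \<in> window T' \<Longrightarrow> T = T'"
  using window_iff unfolding window_def by blast

lemma window_Union: "window T = (\<Union>(k, z)\<in>{(k, z). off_lines k z \<and> model_tile z = T}. cyl k z)"
  unfolding window_def by auto

lemma open_translate_window: "open {p. p - q \<in> window T}"
proof -
  have "open {p. p - q \<in> cyl k z}" for k z
  proof -
    obtain w where "q \<in> cyl k w" using cyl_exists by blast
    then have "{p. p - q \<in> cyl k z} = cyl k (z + w)" using cyl_diff_iff by blast
    then show ?thesis using open_cyl by simp
  qed
  moreover have "{p. p - q \<in> window T} = (\<Union>(k, z)\<in>{(k, z). off_lines k z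
    \<and> model_tile z = T}. {p. p - q \<in> cyl k z})"
    unfolding window_Union by auto
  ultimately show ?thesis by auto
qed

text \<open>The limit of the level-\<open>k\<close> vertices of a tiling. It is the value of the map \<open>\<xi>\<close>, given here
  through the stripe directions alone (lemma \<open>xi_address\<close>).\<close>

definition address :: "(complex \<Rightarrow> tile) \<Rightarrow> qbar" where
  "address \<Lambda> = (THE p. \<forall>k v. p \<in> cyl k v \<longleftrightarrow> hierarchy k v (\<lambda>z. \<Lambda> (pt z)))"

lemma address_unique:
  assumes "\<And>k v. p \<in> cyl k v \<longleftrightarrow> hierarchy k v (\<lambda>z. \<Lambda> (pt z))" shows "address \<Lambda> = p"
  unfolding address_def
proof (rule the_equality)
  fix q assume "\<forall>k v. q \<in> cyl k v \<longleftrightarrow> hierarchy k v (\<lambda>z. \<Lambda> (pt z))"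
  then show "q = p" using assms by (intro cyl_eqI) blast
qed (use assms in blast)

lemma address_cyl:
  assumes "matching (\<lambda>z. \<Lambda> (pt z))"
  shows "address \<Lambda> \<in> cyl k v \<longleftrightarrow> hierarchy k v (\<lambda>z. \<Lambda> (pt z))"
proof -
  obtain v where v: "\<And>k. hierarchy k (v k) (\<lambda>z. \<Lambda> (pt z))" using hierarchy_exists[OF assms] by metis
  have "eqmod k (v (Suc k)) (v k)" for k
    using hierarchy_unique[OF v hierarchy_mono[OF v[of "Suc k"]]] by simp
  then obtain p where p: "\<And>k. p \<in> cyl k (v k)" using cyl_limit[of v] by blast
  have *: "p \<in> cyl k w \<longleftrightarrow> hierarchy k w (\<lambda>z. \<Lambda> (pt z))" for k w
    using cyl_eqmod[OF p] hierarchy_unique[OF v] hierarchy_eqmod[OF v] by blast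
  then show ?thesis using address_unique[of p \<Lambda>] by metis
qed

text \<open>The relative address of the point \<open>x\<close> determines the tile at \<open>x\<close>, unless it is singular.\<close>

lemma address_window:
  assumes "matching (\<lambda>z. \<Lambda> (pt z))" "star (pt x) - address \<Lambda> \<in> window T"
  shows "\<Lambda> (pt x) = T"
proof -
  obtain k z where z: "star (pt x) - address \<Lambda> \<in> cyl k z" "off_lines k z" "model_tile z = T"
    using assms(2) unfolding window_def by blast
  obtain v where v: "address \<Lambda> \<in> cyl k v" using cyl_exists by blast
  have "star (pt x) - address \<Lambda> \<in> cyl k (x - v)" using v
    by (intro cyl_diff) (simp_all add: cyl_star)
  then have e: "eqmod k (x - v) z" using z(1) cyl_eqmod by blast
  then have "\<Lambda> (pt x) = model_tile (x - v)"
    using forced[OF assms(1), of k v x] v address_cyl[OF assms(1)] off_lines_period z(2) by blast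
  then show ?thesis using model_tile_period[OF e z(2)] z(3) by simp
qed

text \<open>The addresses relative to which no point of \<open>Q\<close> is singular; each of them belongs to exactly
  one tiling, \<open>decode p\<close>.\<close>

definition decodable :: "qbar set" where
  "decodable = {p. \<forall>x. star (pt x) - p \<notin> singular}"

definition decode :: "qbar \<Rightarrow> complex \<Rightarrow> tile" where
  "decode p = (\<lambda>y\<in>Q. THE T. star y - p \<in> window T)"

lemma decode_extensional: "decode p \<in> extensional Q"
  unfolding decode_def by simp

text \<open>Finitely many points of \<open>Q\<close> become determined at a common finite level. So local properties
  of \<open>decode\<close> can be checked at one level, where it is a translate of the model tiling.\<close>

lemma decodable_off_lines:
  assumes "p \<in> decodable" "finite F"
  obtains k v where "p \<in> cyl k v" "\<And>x. x \<in> F \<Longrightarrow> off_lines k (x - v)"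
proof -
  have "\<exists>k. \<forall>v. p \<in> cyl k v \<longrightarrow> off_lines k (x - v)" for x
  proof -
    obtain k z where z: "star (pt x) - p \<in> cyl k z" "off_lines k z"
      using assms(1) unfolding decodable_def singular_def by blast
    have "off_lines k (x - v)" if "p \<in> cyl k v" for v
    proof -
      have "star (pt x) - p \<in> cyl k (x - v)" using that by (intro cyl_diff) (simp_all add: cyl_star)
      then show ?thesis using z cyl_eqmod off_lines_period by blast
    qed
    then show ?thesis by blast
  qed
  then obtain K where K: "\<And>x v. p \<in> cyl (K x) v \<Longrightarrow> off_lines (K x) (x - v)" by metis
  define k where "k = Max (insert 0 (K ` F))"
  obtain v where v: "p \<in> cyl k v" using cyl_exists by blast
  have "off_lines k (x - v)" if "x \<in> F" for x
  proof -
    have "K x \<le> k" unfolding k_def using that assms(2) by (intro Max_ge) auto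
    then show ?thesis using v cyl_mono K off_lines_mono by blast
  qed
  then show ?thesis using that v by blast
qed

lemma decode_eq:
  assumes "p \<in> cyl k v" "off_lines k (x - v)" shows "decode p (pt x) = model_tile (x - v)"
proof -
  have "star (pt x) - p \<in> cyl k (x - v)" using assms(1) by (intro cyl_diff) (simp_all add: cyl_star)
  then show ?thesis using window_iff[OF _ assms(2)] unfolding decode_def by simp
qed

text \<open>The matching rule relates only two points at a time, and there the model tiling satisfies
  it.\<close>

lemma decode_matching:
  assumes "p \<in> decodable" shows "matching (\<lambda>z. decode p (pt z))"
  unfolding matching_def
proof (intro allI)
  fix b e x
  obtain k v where kv: "p \<in> cyl k v" "\<And>y. y \<in> {x, x + step b e} \<Longrightarrow> off_lines k (y - v)"
    using decodable_off_lines[OF assms, of "{x, x + step b e}"] by auto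
  have g: "off_lines k (x - v)" "off_lines k (x + step b e - v)" using kv(2) by auto
  have "line_form b (coord e (x - v)) \<noteq> 0" using g(1) unfolding off_lines_def by (metis dvd_0_right)
  from model_tile_rule[OF this]
  show "out_mark b e (decode p (pt x)) = in_mark b e (decode p (pt (x + step b e)))"
    unfolding decode_eq[OF kv(1) g(1)] decode_eq[OF kv(1) g(2)] by (simp add: algebra_simps)
qed

lemma decode_address:
  assumes "matching (\<lambda>z. \<Lambda> (pt z))" "\<Lambda> \<in> extensional Q" "address \<Lambda> \<in> decodable"
  shows "decode (address \<Lambda>) = \<Lambda>"
proof (rule extensionalityI[OF decode_extensional assms(2)])
  fix y assume "y \<in> Q"
  then obtain x where x: "y = pt x" using Q_pt by blast
  obtain T where T: "star (pt x) - address \<Lambda> \<in> window T"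
    using assms(3) nonsingular_window unfolding decodable_def by blast
  have "(THE T. star (pt x) - address \<Lambda> \<in> window T) = T"
    using T window_disjoint by (intro the_equality) auto
  then show "decode (address \<Lambda>) y = \<Lambda> y"
    using address_window[OF assms(1) T] unfolding x decode_def by simp
qed

lemma star_pt_add: "star (pt (x + y)) = star (pt x) + star (pt y)"
  by (simp add: pt_add star_add)

lemma star_pt_diff: "star (pt (x - y)) = star (pt x) - star (pt y)"
  using star_pt_add[of "x - y" y] by simp

lemma star_zero: "star 0 = 0"
  by transfer (simp add: zero_in_Q)

text \<open>The addresses excluded form a countable union of translates of the singular set, which is
  symmetric.\<close>

lemma decodable_borel: "decodable \<in> sets borel"
  and decodable_full: "emeasure Haar (- decodable) = 0"
proof -
  let ?S = "\<lambda>x. {p. star (pt (- x)) + p \<in> singular}"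
  have "star (pt x) - p \<in> singular \<longleftrightarrow> star (pt (- x)) + p \<in> singular" for x p
  proof -
    have "star (pt (- x)) + star (pt x) = star (pt 0)"
      unfolding star_pt_add[symmetric] by simp
    also have "star (pt 0) = 0" by (simp add: star_zero)
    finally have "star (pt x) = - star (pt (- x))" by (simp only: add_eq_0_iff)
    then have "star (pt x) - p = - (star (pt (- x)) + p)" by simp
    then show ?thesis using singular_uminus by metis
  qed
  then have eq: "- decodable = (\<Union>x. ?S x)" unfolding decodable_def by auto
  have S: "?S x \<in> sets borel" for x
    using measurable_sets[OF measurable_translate closed_singular, of "star (pt (- x))"]
    by (simp add: vimage_def)
  then have b: "- decodable \<in> sets borel" unfolding eq by (intro sets.countable_UN') auto
  then show "decodable \<in> sets borel" using sets.compl_sets[OF b]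
    by (simp add: double_diff Compl_eq_Diff_UNIV)
  have "?S x \<in> null_sets Haar" for x
    using Haar_translate[OF closed_singular] S singular_null by (simp add: null_sets_def)
  then have "(\<Union>x. ?S x) \<in> null_sets Haar" by (intro null_sets_UN') auto
  then show "emeasure Haar (- decodable) = 0" unfolding eq by (simp add: null_sets_def)
qed

section \<open>Model sets\<close>

text \<open>The windows of the twelve tiles, translated to the address of the tiling, are disjoint open
  sets whose union misses only a null set. Hence the boundary of each of them lies in that
  null set.\<close>

lemma regular_model_set_tile:
  assumes v: "matching (\<lambda>z. \<Lambda> (pt z))" and r: "address \<Lambda> \<in> decodable"
  shows "regular_model_set {x \<in> Q. \<Lambda> x = T}"
proof -
  let ?q = "address \<Lambda>"
  define W where "W T = {p. p - ?q \<in> window T}" for T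
  have oW: "open (W T)" for T unfolding W_def by (rule open_translate_window)
  have i: "interior (W T) = W T" using oW by (rule interior_open)
  have mw: "model_window (W T)"
    unfolding model_window_def i using closure_subset compact_closure_qbar by blast
  have eq: "{x \<in> Q. \<Lambda> x = T} = {x \<in> Q. star x \<in> W T}"
  proof -
    have "\<Lambda> (pt x) = T \<longleftrightarrow> star (pt x) \<in> W T" for x
    proof -
      obtain T' where "star (pt x) - ?q \<in> window T'"
        using r nonsingular_window unfolding decodable_def by blast
      then show ?thesis using address_window[OF v] window_disjoint unfolding W_def by blast
    qed
    then show ?thesis unfolding Q_eq_range by auto
  qed
  have sub: "closure (W T) - interior (W T) \<subseteq> {p. - ?q + p \<in> singular}"
  proof
    fix p assume p: "p \<in> closure (W T) - interior (W T)"
    show "p \<in> {p. - ?q + p \<in> singular}"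
    proof (rule ccontr)
      assume "p \<notin> {p. - ?q + p \<in> singular}"
      then have "p - ?q \<notin> singular" by simp
      then obtain T' where T': "p \<in> W T'" using nonsingular_window unfolding W_def by blast
      then have "W T' \<inter> W T \<noteq> {}" using p open_Int_closure_eq_empty[OF oW[of T'], of "W T"] by blast
      then have "T' = T" using window_disjoint unfolding W_def by blast
      then show False using T' p i by simp
    qed
  qed
  have meas: "{p. - ?q + p \<in> singular} \<in> sets borel"
    using measurable_sets[OF measurable_translate closed_singular, of "- ?q"]
    by (simp add: vimage_def)
  have "emeasure Haar {p. - ?q + p \<in> singular} = 0"
    unfolding Haar_translate[OF closed_singular] by (rule singular_null)
  then have "emeasure Haar (closure (W T) - interior (W T)) = 0"
    using emeasure_mono[OF sub, of Haar] meas by simp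
  then show ?thesis unfolding regular_model_set_def using mw eq haar_Haar by blast
qed

section \<open>Unique ergodicity\<close>

lemma translate_pt: "translate (pt t) \<Lambda> (pt x) = \<Lambda> (pt (x - t))"
  by (simp add: translate_def pt_diff)

lemma matching_translate:
  assumes "matching (\<lambda>z. \<Lambda> (pt z))" shows "matching (\<lambda>z. translate (pt t) \<Lambda> (pt z))"
  unfolding matching_def translate_pt
proof (intro allI)
  fix b e x
  show "out_mark b e (\<Lambda> (pt (x - t))) = in_mark b e (\<Lambda> (pt (x + step b e - t)))"
    using assms unfolding matching_def by (metis add_diff_eq add.commute diff_add_eq)
qed

lemma hierarchy_translate:
  "hierarchy k v (\<lambda>z. translate (pt t) \<Lambda> (pt z)) \<longleftrightarrow> hierarchy k (v - t) (\<lambda>z. \<Lambda> (pt z))"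
proof
  assume s: "hierarchy k v (\<lambda>z. translate (pt t) \<Lambda> (pt z))"
  show "hierarchy k (v - t) (\<lambda>z. \<Lambda> (pt z))" unfolding hierarchy_def
  proof (intro allI impI)
    fix x assume "\<not> eqmod k x (v - t)"
    then have "\<not> eqmod k (x + t) v" using eqmod_diff[of k "x + t" v t t] by auto
    from structD[OF s this] show "stripe_dir (\<Lambda> (pt x)) = odd_dir (x - (v - t))"
      unfolding translate_pt by (simp add: algebra_simps)
  qed
next
  assume s: "hierarchy k (v - t) (\<lambda>z. \<Lambda> (pt z))"
  show "hierarchy k v (\<lambda>z. translate (pt t) \<Lambda> (pt z))" unfolding hierarchy_def translate_pt
  proof (intro allI impI)
    fix x assume "\<not> eqmod k x v"
    then have "\<not> eqmod k (x - t) (v - t)" by (simp add: eqmod_def)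
    from structD[OF s this] show "stripe_dir (\<Lambda> (pt (x - t))) = odd_dir (x - v)" by simp
  qed
qed

lemma address_translate:
  assumes "matching (\<lambda>z. \<Lambda> (pt z))"
  shows "address (translate (pt t) \<Lambda>) = star (pt t) + address \<Lambda>"
proof (rule address_unique)
  fix k v
  have "star (pt t) \<in> cyl k t" by (simp add: cyl_star)
  then show "star (pt t) + address \<Lambda> \<in> cyl k v \<longleftrightarrow> hierarchy k v (\<lambda>z. translate (pt t) \<Lambda> (pt z))"
    unfolding hierarchy_translate using cyl_add_iff address_cyl[OF assms] by blast
qed

lemma decode_translate: "translate (pt t) (decode p) = decode (star (pt t) + p)"
proof (rule extensionalityI[of _ Q])
  fix y assume "y \<in> Q"
  then obtain x where x: "y = pt x" using Q_pt by blast
  have *: "star (pt (x - t)) - p = star (pt x) - (star (pt t) + p)" unfolding star_pt_diff by simp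
  show "translate (pt t) (decode p) y = decode (star (pt t) + p) y"
    unfolding x translate_pt decode_def restrict_def by (simp only: pt_in_Q if_True *)
qed (simp_all add: translate_def decode_def)

lemma decodable_translate: "star (pt t) + p \<in> decodable \<longleftrightarrow> p \<in> decodable"
proof -
  have *: "star (pt x) - (star (pt t) + p) = star (pt (x - t)) - p" for x unfolding star_pt_diff
    by simp
  show ?thesis
  proof
    assume a: "star (pt t) + p \<in> decodable"
    have "star (pt x) - p \<notin> singular" for x
    proof -
      have "star (pt (x + t)) - (star (pt t) + p) \<notin> singular" using a unfolding decodable_def
        by blast
      then show ?thesis unfolding * by simp
    qed
    then show "p \<in> decodable" unfolding decodable_def by blast
  next
    assume p: "p \<in> decodable"
    have "star (pt x) - (star (pt t) + p) \<notin> singular" for x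
      using p unfolding * decodable_def by blast
    then show "star (pt t) + p \<in> decodable" unfolding decodable_def by blast
  qed
qed

text \<open>Each coordinate is bounded by the norm because \<open>4 (m^2 - m n + n^2)\<close> is \<open>3 m^2 + (m - 2
  n)^2\<close>, and symmetrically.\<close>

lemma finite_ball_pt: "finite {x. pt x \<in> ball 0 R}"
proof -
  obtain N :: nat where N: "2 * R < real N" using reals_Archimedean2 by blast
  have "{x. pt x \<in> ball 0 R} \<subseteq> {- int N..int N} \<times> {- int N..int N}"
  proof
    fix x assume "x \<in> {x. pt x \<in> ball 0 R}"
    then have lt: "cmod (pt x) < R" by (simp add: dist_norm)
    obtain m n where x: "x = (m, n)" by (metis surj_pair)
    define N2 where "N2 = of_int m ^ 2 - of_int m * of_int n + (of_int n ^ 2 :: real)"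
    have "(cmod (pt x))\<^sup>2 = N2" unfolding norm_pt x N2_def by simp
    moreover have "(cmod (pt x))\<^sup>2 < R\<^sup>2" using lt by (intro power_strict_mono) auto
    ultimately have val_less: "N2 < R\<^sup>2" by simp
    have R: "0 < R" using lt norm_ge_zero[of "pt x"] by linarith
    have "4 * N2 = (of_int m)\<^sup>2 * 3 + (of_int m - 2 * of_int n)\<^sup>2" "4 * N2 = (of_int n)\<^sup>2 * 3 +
      (2 * of_int m - of_int n)\<^sup>2"
      unfolding N2_def by (simp_all add: power2_eq_square algebra_simps)
    moreover have "0 \<le> (of_int m - 2 * of_int n :: real)\<^sup>2" "0 \<le> (2 * of_int m - of_int n ::
      real)\<^sup>2" by simp_all
    ultimately have "(of_int m :: real)\<^sup>2 \<le> 4 * N2" "(of_int n :: real)\<^sup>2 \<le> 4 * N2" 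
      using zero_le_power2[of "of_int m :: real"] zero_le_power2[of "of_int n :: real"] by linarith+
    then have "(of_int m :: real)\<^sup>2 \<le> (2 * R)\<^sup>2" "(of_int n :: real)\<^sup>2 \<le> (2 * R)\<^sup>2"
      using val_less by (simp_all add: power_mult_distrib)
    then have "\<bar>of_int m :: real\<bar> \<le> \<bar>2 * R\<bar>" "\<bar>of_int n :: real\<bar> \<le> \<bar>2 * R\<bar>"
      unfolding abs_le_square_iff .
    then have "\<bar>of_int m :: real\<bar> \<le> 2 * R" "\<bar>of_int n :: real\<bar> \<le> 2 * R" using R by simp_all
    then have "\<bar>of_int m :: real\<bar> \<le> real N" "\<bar>of_int n :: real\<bar> \<le> real N" using N by linarith+
    then have "\<bar>m\<bar> \<le> int N" "\<bar>n\<bar> \<le> int N" by linarith+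
    then show "x \<in> {- int N..int N} \<times> {- int N..int N}" unfolding x by auto
  qed
  then show ?thesis by (rule finite_subset) simp
qed

locale tiling_space =
  fixes \<epsilon> :: real
  assumes eps: "0 < \<epsilon>" "\<epsilon> \<le> 1 / 4"
begin

abbreviation X where "X \<equiv> XQ \<epsilon>"

definition S where "S = sigma X {U. local_open X U}"

lemma X_iff: "\<Lambda> \<in> X \<longleftrightarrow> \<Lambda> \<in> extensional Q \<and> matching (\<lambda>z. \<Lambda> (pt z))"
  using XQ_iff[OF eps] .

lemma open_sub: "{U. local_open X U} \<subseteq> Pow X"
  unfolding local_open_def by blast

lemma space_S [simp]: "space S = X"
  unfolding S_def using open_sub by (simp add: space_measure_of)

lemma sets_S: "sets S = sigma_sets X {U. local_open X U}"
  unfolding S_def using open_sub by (simp add: sets_measure_of)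

lemma S_eq: "S = sigma (topspace (local_topology X)) {U. openin (local_topology X) U}"
proof -
  have "local_open X X" unfolding local_open_def by blast
  then have "topspace (local_topology X) = X"
    unfolding topspace_def openin_local_topology using open_sub by blast
  then show ?thesis unfolding S_def openin_local_topology by simp
qed

lemma open_in_S: "local_open X U \<Longrightarrow> U \<in> sets S"
  unfolding sets_S by (rule sigma_sets.Basic) simp

text \<open>A condition on the tile at a single site is an open condition on the tiling.\<close>

lemma site_open: "local_open X {\<Lambda> \<in> X. P (\<Lambda> (pt x))}"
proof (rule local_openI)
  fix \<Lambda> assume L: "\<Lambda> \<in> {\<Lambda> \<in> X. P (\<Lambda> (pt x))}"
  have "pt x \<in> Q \<inter> ball 0 (cmod (pt x) + 1)" by (simp add: dist_norm)
  then have "\<forall>\<Lambda>'\<in>X. (\<forall>y\<in>Q \<inter> ball 0 (cmod (pt x) + 1). \<Lambda>' y = \<Lambda> y) \<longrightarrow> \<Lambda>' \<in> {\<Lambda> \<in> X. P (\<Lambda> (pt x))}"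
    using L by (metis (mono_tags, lifting) mem_Collect_eq)
  then show "\<exists>R. \<forall>\<Lambda>'\<in>X. (\<forall>y\<in>Q \<inter> ball 0 R. \<Lambda>' y = \<Lambda> y) \<longrightarrow> \<Lambda>' \<in> {\<Lambda> \<in> X. P (\<Lambda> (pt x))}" ..
qed simp

lemma measurable_S:
  assumes "f \<in> space M \<rightarrow> X" "\<And>U. local_open X U \<Longrightarrow> f -` U \<inter> space M \<in> sets M"
  shows "f \<in> measurable M S"
  unfolding S_def using assms open_sub by (intro measurable_measure_of) auto

text \<open>The preimage of a cylinder is given by countably many conditions at single sites.\<close>

lemma address_measurable: "address \<in> measurable S borel"
proof (rule measurable_cyl)
  fix k v
  have "address -` cyl k v \<inter> space S = {\<Lambda> \<in> space S. \<forall>x. \<not> eqmod k x v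
    \<longrightarrow> stripe_dir (\<Lambda> (pt x)) = odd_dir (x - v)}"
  proof -
    have "address \<Lambda> \<in> cyl k v \<longleftrightarrow> (\<forall>x. \<not> eqmod k x v \<longrightarrow> stripe_dir (\<Lambda> (pt x)) = odd_dir (x - v))"
      if "\<Lambda> \<in> X" for \<Lambda>
      using address_cyl[of \<Lambda> k v] that unfolding X_iff hierarchy_def by blast
    then show ?thesis unfolding space_S by blast
  qed
  also have "\<dots> \<in> sets S"
    by (rule sets.sets_Collect_countable_All, unfold space_S, rule open_in_S, rule site_open)
  finally show "address -` cyl k v \<inter> space S \<in> sets S" .
qed

lemma translate_X: "\<Lambda> \<in> X \<Longrightarrow> translate (pt t) \<Lambda> \<in> X"
  using matching_translate unfolding X_iff by (simp add: translate_def)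

lemma translate_measurable: "translate (pt t) \<in> measurable S S"
proof (rule measurable_S)
  show "translate (pt t) \<in> space S \<rightarrow> X" using translate_X by simp
  fix U assume U: "local_open X U"
  have "local_open X (translate (pt t) -` U \<inter> X)"
  proof (rule local_openI)
    fix \<Lambda> assume L: "\<Lambda> \<in> translate (pt t) -` U \<inter> X"
    then have "translate (pt t) \<Lambda> \<in> U" by simp
    then obtain R where R: "\<And>\<Lambda>'. \<Lambda>' \<in> X \<Longrightarrow> (\<And>x. x \<in> Q \<Longrightarrow> x \<in> ball 0 R
      \<Longrightarrow> \<Lambda>' x = translate (pt t) \<Lambda> x) \<Longrightarrow> \<Lambda>' \<in> U"
      using local_openD[OF U] by metis
    have "\<Lambda>' \<in> translate (pt t) -` U \<inter> X"
      if "\<Lambda>' \<in> X" "\<forall>x\<in>Q \<inter> ball 0 (R + cmod (pt t)). \<Lambda>' x = \<Lambda> x" for \<Lambda>'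
    proof -
      have "translate (pt t) \<Lambda>' \<in> U"
      proof (rule R)
        fix y assume y: "y \<in> Q" "y \<in> ball 0 R"
        obtain x where x: "y = pt x" using y(1) Q_pt by blast
        have "cmod (pt x - pt t) < R + cmod (pt t)"
          using y(2) norm_triangle_ineq4[of "pt x" "pt t"] unfolding x by (simp add: dist_norm)
        then have "pt (x - t) \<in> Q \<inter> ball 0 (R + cmod (pt t))"
          by (simp add: dist_norm pt_diff[symmetric])
        then show "translate (pt t) \<Lambda>' y = translate (pt t) \<Lambda> y"
          unfolding x translate_pt using that(2) by blast
      qed (use translate_X that in blast)
      then show ?thesis using that by simp
    qed
    then show "\<exists>R. \<forall>\<Lambda>'\<in>X. (\<forall>x\<in>Q \<inter> ball 0 R. \<Lambda>' x = \<Lambda> x) \<longrightarrow> \<Lambda>' \<in> translate (pt t) -` U \<inter> X" by blast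
  qed simp
  then show "translate (pt t) -` U \<inter> space S \<in> sets S" using open_in_S by simp
qed

definition p0 :: qbar where "p0 = (SOME p. p \<in> decodable)"

lemma p0: "p0 \<in> decodable"
proof -
  have "decodable \<noteq> {}"
    using decodable_full prob_space.emeasure_space_1[OF prob_space_Haar]
      by (metis Compl_empty_eq sets_Haar(2) zero_neq_one)
  then show ?thesis unfolding p0_def by (simp add: some_in_eq)
qed

text \<open>The undecodable addresses, a null set, are sent to an arbitrary tiling, so that all values
  lie in the space of tilings.\<close>

definition dec :: "qbar \<Rightarrow> complex \<Rightarrow> tile" where
  "dec p = (if p \<in> decodable then decode p else decode p0)"

lemma decode_X: "p \<in> decodable \<Longrightarrow> decode p \<in> X"
  using decode_matching decode_extensional X_iff by blast

lemma dec_X: "dec p \<in> X"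
  unfolding dec_def using decode_X p0 by simp

text \<open>On the decodable addresses \<open>decode\<close> is continuous, since a finite level of the address
  determines the tiles in a given ball.\<close>

lemma dec_measurable: "dec \<in> measurable borel S"
proof (rule measurable_S)
  show "dec \<in> space borel \<rightarrow> X" using dec_X by simp
  fix U assume U: "local_open X U"
  \<comment> \<open>all cylinders on which every decodable address gives a tiling in \<open>U\<close>\<close>
  define O' where "O' = \<Union>{cyl k v | k v. \<forall>p \<in> cyl k v \<inter> decodable. decode p \<in> U}"
  have oO: "open O'" unfolding O'_def using open_cyl by (intro open_Union) auto
  have "decode p \<in> U \<longleftrightarrow> p \<in> O'" if p: "p \<in> decodable" for p
  proof
    assume "decode p \<in> U"
    then obtain R where R: "\<And>\<Lambda>'. \<Lambda>' \<in> X \<Longrightarrow> (\<And>x. x \<in> Q \<Longrightarrow> x \<in> ball 0 R \<Longrightarrow> \<Lambda>' x = decode p x) \<Longrightarrow> \<Lambda>' \<in> U"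
      using local_openD[OF U] by metis
    obtain k v where kv: "p \<in> cyl k v" "\<And>x. x \<in> {x. pt x \<in> ball 0 R} \<Longrightarrow> off_lines k (x - v)"
      using decodable_off_lines[OF p finite_ball_pt[of R]] by blast
    have "decode p' \<in> U" if p': "p' \<in> cyl k v \<inter> decodable" for p'
    proof (rule R)
      show "decode p' \<in> X" using p' decode_X by blast
      fix y assume "y \<in> Q" "y \<in> ball 0 R"
      then obtain x where x: "y = pt x" "off_lines k (x - v)" using Q_pt kv(2) by blast
      then show "decode p' y = decode p y" using decode_eq[OF kv(1)] decode_eq[of p' k v] p' by simp
    qed
    then show "p \<in> O'" unfolding O'_def using kv(1) by blast
  next
    assume "p \<in> O'" then show "decode p \<in> U" unfolding O'_def using p by blast
  qed
  then have "dec -` U \<inter> space borel = (O' \<inter> decodable)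
    \<union> (if decode p0 \<in> U then - decodable else {})"
    unfolding dec_def by (auto split: if_splits)
  moreover have "O' \<in> sets borel" using oO by simp
  moreover have "- decodable \<in> sets borel" using sets.compl_sets[OF decodable_borel]
    by (simp add: Compl_eq_Diff_UNIV)
  ultimately show "dec -` U \<inter> space borel \<in> sets borel" using decodable_borel by simp
qed

lemma AE_decodable: "AE p in Haar. p \<in> decodable"
proof (rule AE_I)
  show "{p \<in> space Haar. p \<notin> decodable} \<subseteq> - decodable" by auto
  show "emeasure Haar (- decodable) = 0" by (rule decodable_full)
  show "- decodable \<in> sets Haar" using sets.compl_sets[OF decodable_borel]
    by (simp add: Compl_eq_Diff_UNIV)
qed

lemma Haar_measurable: "measurable Haar N = measurable borel N"
  by (rule measurable_cong_sets) simp_all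

definition \<nu> :: "(complex \<Rightarrow> tile) measure" where "\<nu> = distr Haar S dec"

lemma nu_prob: "prob_space \<nu>"
  unfolding \<nu>_def using dec_measurable
    by (intro prob_space.prob_space_distr prob_space_Haar) (simp add: Haar_measurable)

text \<open>Translating the tiling amounts to translating the address, under which Haar measure is
  invariant.\<close>

lemma nu_invariant: "distr \<nu> \<nu> (translate (pt t)) = \<nu>"
proof -
  have m [measurable]: "dec \<in> measurable Haar S" "(+) (star (pt t)) \<in> measurable Haar borel" "dec
    \<in> measurable borel S"
    "translate (pt t) \<in> measurable S S"
    using dec_measurable translate_measurable measurable_translate
      by (simp_all add: Haar_measurable)
  have "distr \<nu> \<nu> (translate (pt t)) = distr \<nu> S (translate (pt t))"
    by (rule distr_cong) (simp_all add: \<nu>_def)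
  also have "\<dots> = distr Haar S (translate (pt t) \<circ> dec)" unfolding \<nu>_def
    by (rule distr_distr) measurable
  also have "\<dots> = distr Haar S (dec \<circ> (+) (star (pt t)))"
  proof (rule distr_cong_AE)
    show "AE p in Haar. (translate (pt t) \<circ> dec) p = (dec \<circ> (+) (star (pt t))) p"
      using AE_decodable by (rule AE_mp) (auto simp: dec_def decode_translate decodable_translate)
  qed (measurable; simp)+
  also have "\<dots> = distr (distr Haar borel ((+) (star (pt t)))) S dec"
    by (rule distr_distr[symmetric]) measurable
  also have "\<dots> = \<nu>" unfolding Haar_invariant \<nu>_def ..
  finally show ?thesis .
qed

text \<open>The image of an invariant measure under \<open>address\<close> is invariant, hence Haar measure. So
  almost every tiling has a decodable address and is recovered from it by decoding, which
  makes the measure the image of Haar measure under decoding.\<close>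

lemma nu_unique:
  assumes s: "sets \<mu> = sets S" and p: "prob_space \<mu>"
    and inv: "\<And>t. distr \<mu> \<mu> (translate (pt t)) = \<mu>"
  shows "\<mu> = \<nu>"
proof -
  have sp: "space \<mu> = X" using sets_eq_imp_space_eq[OF s] by simp
  have ms: "measurable \<mu> N = measurable S N" for N :: "'z measure"
    by (rule measurable_cong_sets) (simp_all add: s)
  have m [measurable]: "address \<in> measurable \<mu> borel" using address_measurable ms by blast
  have t [measurable]: "translate (pt t) \<in> measurable \<mu> \<mu>" for t
    using translate_measurable measurable_cong_sets[OF s s] by blast
  have d [measurable]: "dec \<in> measurable borel S" by (rule dec_measurable)
  define \<eta> where "\<eta> = distr \<mu> borel address"
  have H: "\<eta> = Haar"
  proof (rule Haar_unique)
    show "sets \<eta> = sets borel" unfolding \<eta>_def by simp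
    show "prob_space \<eta>" unfolding \<eta>_def using m by (rule prob_space.prob_space_distr[OF p])
    fix v
    have "distr \<eta> borel ((+) (star (pt v))) = distr \<mu> borel ((+) (star (pt v)) \<circ> address)"
      unfolding \<eta>_def by (rule distr_distr) measurable
    also have "\<dots> = distr \<mu> borel (address \<circ> translate (pt v))"
      by (rule distr_cong) (auto simp: sp X_iff address_translate)
    also have "\<dots> = distr (distr \<mu> \<mu> (translate (pt v))) borel address"
      by (rule distr_distr[symmetric]) measurable
    also have "\<dots> = \<eta>" unfolding inv \<eta>_def ..
    finally show "distr \<eta> borel ((+) (star (pt v))) = \<eta>" .
  qed
  have AE: "AE \<Lambda> in \<mu>. address \<Lambda> \<in> decodable"
    using AE_decodable unfolding H[symmetric] \<eta>_def
    by (rule AE_distrD[OF m])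
  have "\<nu> = distr \<eta> S dec" unfolding H \<nu>_def ..
  also have "\<dots> = distr \<mu> S (dec \<circ> address)" unfolding \<eta>_def by (rule distr_distr) measurable
  also have "\<dots> = distr \<mu> S (\<lambda>\<Lambda>. \<Lambda>)"
  proof (rule distr_cong_AE)
    show "AE \<Lambda> in \<mu>. (dec \<circ> address) \<Lambda> = \<Lambda>"
      using AE AE_space
    proof eventually_elim
      case (elim \<Lambda>)
      then show ?case using decode_address[of \<Lambda>] by (simp add: dec_def sp X_iff)
    qed
    show "dec \<circ> address \<in> measurable \<mu> S" by measurable
    show "(\<lambda>\<Lambda>. \<Lambda>) \<in> measurable \<mu> S" unfolding ms by simp
  qed simp_all
  also have "\<dots> = \<mu>" using s[symmetric] by (rule distr_id2)
  finally show ?thesis by simp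
qed

lemma unique_ergodicity: "uniquely_ergodic (local_topology X) Q translate"
  unfolding uniquely_ergodic_def S_eq[symmetric]
proof (rule ex1I)
  show "sets \<nu> = sets S \<and> prob_space \<nu> \<and> (\<forall>g\<in>Q. distr \<nu> \<nu> (translate g) = \<nu>)"
    using nu_prob nu_invariant unfolding Q_eq_range by (auto simp: \<nu>_def)
  fix \<mu> assume "sets \<mu> = sets S \<and> prob_space \<mu> \<and> (\<forall>g\<in>Q. distr \<mu> \<mu> (translate g) = \<mu>)"
  then show "\<mu> = \<nu>" unfolding Q_eq_range by (intro nu_unique) auto
qed

end



section \<open>The map xi and generic tilings\<close>

lemma in_line: "y \<in> line x d \<longleftrightarrow> (\<exists>t::real. y = x + of_real t * d)"
  unfolding line_def by auto

lemma pt_coord: "pt z = axis e * pt (coord e z)"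
  using pt_point[of e "coord e z"] by simp

lemma line_dir: "pt a \<in> line (pt z) (dir_vec e) \<longleftrightarrow> snd (coord e (z - a)) = 0"
proof
  assume "pt a \<in> line (pt z) (dir_vec e)"
  then obtain t :: real where t: "pt a = pt z + of_real t * dir_vec e" using in_line by blast
  define r where "r = (if e = D12 then t else - t)"
  have "pt (z - a) = axis e * of_real r" unfolding pt_diff t r_def
    by (simp add: dir_vec_axis del: axis.simps)
  then have "axis e * pt (coord e (z - a)) = axis e * of_real r" unfolding pt_coord[symmetric] .
  then have "pt (coord e (z - a)) = of_real r" using mult_cancel_left[of "axis e"] by simp
  then have "Im (pt (coord e (z - a))) = 0" by simp
  then show "snd (coord e (z - a)) = 0" by (simp add: pt_def a1_def a2_def)
next
  assume "snd (coord e (z - a)) = 0"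
  then have "pt (coord e (z - a)) = of_real (of_int (fst (coord e (z - a))))"
    by (simp add: pt_def a1_def)
  then have "pt z - pt a = axis e * of_real (of_int (fst (coord e (z - a))))"
    using pt_coord[of "z - a" e] by (simp add: pt_diff)
  then have "pt a = pt z + of_real (if e = D12 then of_int (fst (coord e (z - a))) else - of_int
    (fst (coord e (z - a)))) * dir_vec e"
    by (simp add: dir_vec_axis algebra_simps del: axis.simps)
  then show "pt a \<in> line (pt z) (dir_vec e)" using in_line by blast
qed

lemma line_convex: "convex (line x d)"
  unfolding convex_alt
proof (intro ballI allI impI)
  fix a b and u :: real assume ab: "a \<in> line x d" "b \<in> line x d"
  then obtain s t :: real where st: "a = x + of_real s * d" "b = x + of_real t * d" using in_line
    by blast
  have "(1 - u) *\<^sub>R a + u *\<^sub>R b = x + of_real ((1 - u) * s + u * t) * d"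
    unfolding st by (simp add: scaleR_conv_of_real algebra_simps)
  then show "(1 - u) *\<^sub>R a + u *\<^sub>R b \<in> line x d" using in_line by blast
qed

text \<open>An edge on the line has a level-\<open>k\<close> vertex as endpoint; conversely, the line runs through
  such a vertex and hence contains an edge of level \<open>k\<close>.\<close>

lemma contains_edge_iff:
  assumes "q \<in> cyl k v"
  shows "(\<exists>E\<in>level_edges q k. E \<subseteq> line (pt z) (dir_vec e)) \<longleftrightarrow> 2 ^ k dvd snd (coord e (z - v))"
proof
  assume "\<exists>E\<in>level_edges q k. E \<subseteq> line (pt z) (dir_vec e)"
  then obtain P R where PR: "P \<in> cosets_of q k" "closed_segment P R \<subseteq> line (pt z) (dir_vec e)"
    unfolding level_edges_def by auto
  have "P \<in> Q" using PR(1) assms unfolding cosets_of_cyl coset_def Q_eq_range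
    by (auto simp flip: pt_scl[where c = "2 ^ k", simplified] pt_add)
  then obtain a where a: "P = pt a" using Q_pt by blast
  have "snd (coord e (z - a)) = 0" using PR(2) line_dir unfolding a
    by (metis ends_in_segment(1) subsetD)
  moreover have "q \<in> cyl k a" using PR(1) unfolding cyl_def a by simp
  then have "eqmod k (z - v) (z - a)" using eqmod_diff[OF eqmod_refl] assms cyl_eqmod by blast
  then have "2 ^ k dvd line_form False (coord e (z - v)) - line_form False (coord e (z - a))"
    by (rule eqmod_line_form)
  ultimately show "2 ^ k dvd snd (coord e (z - v))" by (simp add: line_form_def)
next
  assume "2 ^ k dvd snd (coord e (z - v))"
  then obtain s where s: "snd (coord e (z - v)) = 2 ^ k * s" by (elim dvdE)
  define a where "a = v + scl (2 ^ k) (point e (0, s))"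
  define b where "b = a + scl (2 ^ k) (point e (1, 0))"
  have c: "q \<in> cyl k a" "q \<in> cyl k b"
    using assms cyl_eqmod eqmod_iff eqmod_trans unfolding a_def b_def by metis+
  have za: "z - a = (z - v) - scl (2 ^ k) (point e (0, s))" "z - b = (z - v) - scl (2 ^ k) (point
    e (0, s)) - scl (2 ^ k) (point e (1, 0))"
    unfolding a_def b_def by simp_all
  have "snd (coord e (z - a)) = 0" "snd (coord e (z - b)) = 0"
    unfolding za by (simp_all add: coord_diff[of _ _ "scl _ _"] coord_scl s) (simp_all add:
      scl_def s)
  then have "pt a \<in> line (pt z) (dir_vec e)" "pt b \<in> line (pt z) (dir_vec e)" using line_dir
    by blast+
  then have "closed_segment (pt a) (pt b) \<subseteq> line (pt z) (dir_vec e)"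
    using line_convex by (intro closed_segment_subset)
  moreover have "dist (pt a) (pt b) = 2 ^ k"
    unfolding dist_norm b_def
      by (simp add: pt_add pt_scl pt_point norm_mult norm_power) (simp add: pt_def a1_def)
  then have "closed_segment (pt a) (pt b) \<in> level_edges q k"
    using c unfolding level_edges_def cyl_def by blast
  ultimately show "\<exists>E\<in>level_edges q k. E \<subseteq> line (pt z) (dir_vec e)" by blast
qed

lemma a_level_iff:
  assumes "q \<in> cyl k v"
  shows "enat k \<le> a_level q (line (pt z) (dir_vec e)) \<longleftrightarrow> 2 ^ k dvd snd (coord e (z - v))"
proof -
  let ?H = "\<lambda>k. \<exists>E\<in>level_edges q k. E \<subseteq> line (pt z) (dir_vec e)"
  have down: "?H k" if "?H j" "k \<le> j" for j
  proof -
    obtain w where w: "q \<in> cyl j w" using cyl_exists by blast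
    then have "2 ^ j dvd snd (coord e (z - w))" using contains_edge_iff that(1) by blast
    then have "2 ^ k dvd snd (coord e (z - w))" using that(2) le_imp_power_dvd dvd_trans by blast
    then show ?thesis using contains_edge_iff[OF cyl_mono[OF w that(2)]] by blast
  qed
  have "enat k \<le> a_level q (line (pt z) (dir_vec e)) \<longleftrightarrow> ?H k"
  proof
    assume le: "enat k \<le> a_level q (line (pt z) (dir_vec e))"
    show "?H k"
    proof (rule ccontr)
      assume n: "\<not> ?H k"
      have k0: "k \<noteq> 0"
        using n contains_edge_iff[OF assms, of z e] by (intro notI) simp
      have "a_level q (line (pt z) (dir_vec e)) \<le> enat (k - 1)"
        unfolding a_level_def
      proof (rule Sup_least)
        fix x assume "x \<in> {enat k | k. ?H k}"
        then obtain j where j: "x = enat j" "?H j" by blast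
        then have "j < k" using down n by (meson not_le)
        then show "x \<le> enat (k - 1)" using j by simp
      qed
      then have "enat k \<le> enat (k - 1)" using le order_trans by blast
      then show False using k0 by simp
    qed
  next
    assume "?H k" then show "enat k \<le> a_level q (line (pt z) (dir_vec e))"
      unfolding a_level_def by (intro Sup_upper) blast
  qed
  then show ?thesis using contains_edge_iff[OF assms] by blast
qed

lemma enat_infinity: "(\<And>k. enat k \<le> n) \<Longrightarrow> n = \<infinity>"
  by (cases n) (auto, metis Suc_n_not_le_n)

text \<open>At a point \<open>z\<close> with \<open>z - v = 2^j y\<close> for odd \<open>y\<close>, exactly one of the three lines has a level
  larger than \<open>j\<close>, and its direction is the one given by the parities of \<open>y\<close>.\<close>

lemma line_levels:
  assumes "q \<in> cyl k v" "\<not> eqmod k z v" "e = odd_dir (z - v)" "f \<noteq> e"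
  shows "a_level q (line (pt z) (dir_vec f)) < a_level q (line (pt z) (dir_vec e))"
    "a_level q (line (pt z) (dir_vec f)) < \<infinity>"
proof -
  have "\<not> eqmod k (z - v) 0" using assms(2) by (simp add: eqmod_def)
  then obtain j y where y: "j < k" "z - v = scl (2 ^ j) y" "\<not> eqmod 1 y 0" using odd_part by metis
  have e: "e = parity_dir y" using assms(3) odd_dir_scl[OF y(3)] y(2) by simp
  have c: "q \<in> cyl (Suc j) v" using cyl_mono[OF assms(1)] y(1) by simp
  have s: "snd (coord d (z - v)) = 2 ^ j * snd (coord d y)" for d unfolding y(2) coord_scl
    by (simp add: scl_def)
  have "even (snd (coord e y))" "odd (snd (coord f y))"
    using y(3) assms(4) unfolding e by (cases f; auto simp: parity_dir_def eqmod_def split: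
      if_splits)+
  then have "2 ^ Suc j dvd snd (coord e (z - v))" "\<not> 2 ^ Suc j dvd snd (coord f (z - v))"
    unfolding s by simp_all
  then have 1: "enat (Suc j) \<le> a_level q (line (pt z) (dir_vec e))" "a_level q (line (pt z)
    (dir_vec f)) < enat (Suc j)"
    using a_level_iff[OF c, of z e] a_level_iff[OF c, of z f] by (simp_all add: not_le)
  then show "a_level q (line (pt z) (dir_vec f)) < a_level q (line (pt z) (dir_vec e))" by order
  show "a_level q (line (pt z) (dir_vec f)) < \<infinity>" using 1(2) less_trans enat_ord_simps(4) by blast
qed

lemma xi_rel_hierarchy:
  assumes "xi_rel \<Lambda> q" "q \<in> cyl k v" shows "hierarchy k v (\<lambda>z. \<Lambda> (pt z))"
  unfolding hierarchy_def
proof (intro allI impI)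
  fix z assume n: "\<not> eqmod k z v"
  define e where "e = odd_dir (z - v)"
  note ll = line_levels[OF assms(2) n e_def]
  have "rot e \<noteq> e" by (rule rot_neq)
  then have fin: "\<not> (\<forall>d. a_level q (line (pt z) (dir_vec d)) = \<infinity>)" using ll(2)
    by (metis less_irrefl)
  have "\<forall>d'. d' \<noteq> stripe_dir (\<Lambda> (pt z)) \<longrightarrow> a_level q (line (pt z) (dir_vec d'))
      < a_level q (line (pt z) (dir_vec (stripe_dir (\<Lambda> (pt z)))))"
    using assms(1)[unfolded xi_rel_def Let_def, rule_format, OF pt_in_Q fin] by blast
  then show "stripe_dir (\<Lambda> (pt z)) = odd_dir (z - v)"
    using ll(1) unfolding e_def[symmetric] by (metis less_asym)
qed

lemma inner_axis: "(axis e * w) \<bullet> (axis e * w') = w \<bullet> w'"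
  by (cases e; simp add: inner_complex_def algebra_simps)

text \<open>In coordinates along the line and in units of \<open>2^k\<close>, let the level-\<open>k\<close> edge through \<open>z\<close> run
  from \<open>p\<close> to \<open>p + 1\<close> in the odd row \<open>u\<close>. The triangle with this midsegment has even
  vertices, so the parity of \<open>p\<close> decides whether it points up or down; the same parity
  determines the side of the stripe.\<close>

lemma stripe_triangle:
  fixes z v :: "int \<times> int"
  assumes q: "q \<in> cyl (Suc k) v" and t: "snd (coord e (z - v)) = 2 ^ k * u" "odd u"
    and n: "n = (if even (fst (coord e (z - v)) div 2 ^ k) then \<i> * axis e else - (\<i> * axis e))"
  shows "\<exists>B C D. level_triangle q (Suc k) B C D
      \<and> closed_segment (midpoint B C) (midpoint B D) \<in> level_edges q k
      \<and> pt z \<in> closed_segment (midpoint B C) (midpoint B D)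
      \<and> n \<bullet> (centroid B C D - pt z) > 0"
proof -
  define p where "p = fst (coord e (z - v)) div 2 ^ k"
  define r where "r = fst (coord e (z - v)) mod 2 ^ k"
  define P where "P w = v + scl (2 ^ k) (point e w)" for w
  have ptP: "pt (P w) = pt v + 2 ^ k * (axis e * pt w)" for w
    unfolding P_def by (simp add: pt_add pt_scl pt_point)
  have P1: "q \<in> cyl k (P w)" for w
  proof -
    have "eqmod k (P w) v" unfolding P_def eqmod_iff by blast
    then show ?thesis using cyl_mono[OF q, of k] cyl_eqmod by auto
  qed
  have P2: "q \<in> cyl (Suc k) (P w)" if "even (fst w)" "even (snd w)" for w
  proof -
    have "w = scl 2 (fst w div 2, snd w div 2)" using that by (simp add: scl_def prod_eq_iff)
    then obtain w' where "w = scl 2 w'" ..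
    then have "P w = v + scl (2 ^ Suc k) (point e w')"
      unfolding P_def by (cases e) (simp_all add: scl_def algebra_simps)
    then show ?thesis using q cyl_eqmod eqmod_iff by blast
  qed
  have distP: "dist (pt (P w)) (pt (P w')) = 2 ^ k * cmod (pt (w - w'))" for w w'
  proof -
    have "pt (P w) - pt (P w') = 2 ^ k * (axis e * pt (w - w'))" unfolding ptP pt_diff
      by (simp add: algebra_simps)
    then show ?thesis unfolding dist_norm by (simp add: norm_mult norm_power)
  qed
  have unit: "cmod (pt w) = 2" if "w \<in> {(0, 2), (0, -2), (2, 0), (-2, 0), (2, 2), (-2, -2)}" for w
  proof -
    have "(cmod (pt w))\<^sup>2 = 2\<^sup>2" unfolding norm_pt using that by (elim insertE emptyE) simp_all
    then show ?thesis by (simp only: power2_eq_iff_nonneg norm_ge_zero zero_le_numeral)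
  qed
  have unit1: "cmod (pt (-1, 0)) = 1" by (simp add: pt_def a1_def)
  define B where "B = (if even p then (p, u - 1) else (p + 1, u + 1))"
  define C where "C = (if even p then (p, u + 1) else (p - 1, u - 1))"
  define D where "D = (if even p then (p + 2, u + 1) else (p + 1, u - 1))"
  have ev: "even (fst B)" "even (snd B)" "even (fst C)" "even (snd C)" "even (fst D)" "even (snd D)"
    unfolding B_def C_def D_def using t(2) by auto
  have BCD: "B - C \<in> {(0, 2), (0, -2), (2, 0), (-2, 0), (2, 2), (-2, -2)}"
    "C - D \<in> {(0, 2), (0, -2), (2, 0), (-2, 0), (2, 2), (-2, -2)}"
    "B - D \<in> {(0, 2), (0, -2), (2, 0), (-2, 0), (2, 2), (-2, -2)}"
    unfolding B_def C_def D_def by auto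
  have tri: "level_triangle q (Suc k) (pt (P B)) (pt (P C)) (pt (P D))"
    unfolding level_triangle_def distP
      using P2[of B] P2[of C] P2[of D] ev unit[OF BCD(1)] unit[OF BCD(2)] unit[OF BCD(3)]
    by (simp add: cyl_def)
  have m: "midpoint (pt (P B)) (pt (P C)) = pt (P (p, u))" "midpoint (pt (P B)) (pt (P D)) = pt
    (P (p + 1, u))"
    unfolding midpoint_def ptP B_def C_def D_def
    by (auto simp: scaleR_conv_of_real pt_def field_simps)
  have hex_edge: "closed_segment (pt (P (p, u))) (pt (P (p + 1, u))) \<in> level_edges q k"
  proof -
    have "dist (pt (P (p, u))) (pt (P (p + 1, u))) = 2 ^ k" unfolding distP using unit1 by simp
    then show ?thesis using P1 unfolding level_edges_def cyl_def by blast
  qed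
  have z: "pt z = pt v + axis e * (of_int (2 ^ k * p + r) + of_int (2 ^ k * u) * a2)"
  proof -
    have "pt z = pt v + axis e * pt (coord e (z - v))" unfolding pt_coord[symmetric] pt_diff by simp
    moreover have "fst (coord e (z - v)) = 2 ^ k * p + r" unfolding p_def r_def by simp
    ultimately show ?thesis using t(1) by (simp add: pt_def a1_def)
  qed
  have r: "0 \<le> r" "r < 2 ^ k" unfolding r_def by simp_all
  have seg: "pt z \<in> closed_segment (pt (P (p, u))) (pt (P (p + 1, u)))"
    unfolding in_segment
  proof (intro exI[of _ "of_int r / 2 ^ k"] conjI)
    have "of_int r \<le> (of_int (2 ^ k) :: real)" using r(2) by (simp only: of_int_le_iff)
    then show "of_int r / 2 ^ k \<le> (1 :: real)" by simp
    show "0 \<le> of_int r / (2 ^ k :: real)" using r by simp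
    show "pt z = (1 - of_int r / 2 ^ k) *\<^sub>R pt (P (p, u)) + (of_int r / 2 ^ k) *\<^sub>R pt (P (p + 1,
      u))"
      unfolding z ptP by (simp add: scaleR_conv_of_real pt_def a1_def field_simps)
  qed
  define s :: int where "s = (if even p then 1 else -1)"
  have "centroid (pt (P B)) (pt (P C)) (pt (P D)) - pt z
     = axis e * (2 ^ k * (of_int (fst B + fst C + fst D) / 3) - of_int (2 ^ k * p + r)
        + (2 ^ k * (of_int (snd B + snd C + snd D) / 3) - of_int (2 ^ k * u)) * a2)"
    unfolding centroid_def ptP z by (simp add: pt_def a1_def field_simps)
  also have "snd B + snd C + snd D = 3 * u + s" unfolding B_def C_def D_def s_def by simp
  finally have cz: "centroid (pt (P B)) (pt (P C)) (pt (P D)) - pt z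
     = axis e * (2 ^ k * (of_int (fst B + fst C + fst D) / 3) - of_int (2 ^ k * p + r) + (2 ^ k *
       (of_int s / 3)) * a2)"
    by (simp add: field_simps)
  have n': "n = axis e * (of_int s * \<i>)" unfolding n s_def p_def by simp
  have "n \<bullet> (centroid (pt (P B)) (pt (P C)) (pt (P D)) - pt z) = of_int (s * s) * (2 ^ k * sqrt 3
    / 6)"
  proof -
    have Im2: "Im (2 ^ k) = 0" "Re (2 ^ k) = 2 ^ k"
      using Im_complex_of_real[of "2 ^ k"] Re_complex_of_real[of "2 ^ k"] by simp_all
    show ?thesis unfolding n' cz inner_axis by (simp add: inner_complex_def a2_def Im2)
  qed
  also have "s * s = 1" unfolding s_def by simp
  finally have val: "n \<bullet> (centroid (pt (P B)) (pt (P C)) (pt (P D)) - pt z) = of_int 1 * (2 ^ k *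
    sqrt 3 / 6)" .
  have pos: "n \<bullet> (centroid (pt (P B)) (pt (P C)) (pt (P D)) - pt z) > 0" unfolding val by simp
  show ?thesis using tri hex_edge seg pos unfolding m[symmetric] by blast
qed

lemma xi_rel_address:
  assumes v: "matching (\<lambda>z. \<Lambda> (pt z))" shows "xi_rel \<Lambda> (address \<Lambda>)"
  unfolding xi_rel_def Let_def
proof (intro ballI impI)
  let ?q = "address \<Lambda>"
  fix x assume "x \<in> Q" and fin: "\<not> (\<forall>d. a_level ?q (line x (dir_vec d)) = \<infinity>)"
  then obtain z where z: "x = pt z" using Q_pt by blast
  have "\<exists>k v. ?q \<in> cyl k v \<and> \<not> eqmod k z v"
  proof (rule ccontr)
    assume neg: "\<not> ?thesis"
    have "a_level ?q (line x (dir_vec d)) = \<infinity>" for d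
    proof (rule enat_infinity)
      fix k
      obtain w where w: "?q \<in> cyl k w" using cyl_exists by blast
      then have "eqmod k z w" using neg by blast
      then have "2 ^ k dvd line_form False (coord d z) - line_form False (coord d w)"
        by (rule eqmod_line_form)
      then show "enat k \<le> a_level ?q (line x (dir_vec d))" unfolding z a_level_iff[OF w]
        by (simp add: line_form_def coord_diff)
    qed
    then show False using fin by blast
  qed
  then obtain k w where w: "?q \<in> cyl k w" "\<not> eqmod k z w" by blast
  define e where "e = stripe_dir (\<Lambda> (pt z))"
  have e: "e = odd_dir (z - w)" unfolding e_def
    using structD[OF address_cyl[OF v, THEN iffD1, OF w(1)] w(2)] .
  show "(\<forall>d'. d' \<noteq> stripe_dir (\<Lambda> x) \<longrightarrow> a_level ?q (line x (dir_vec d')) < a_level ?q (line x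
    (dir_vec (stripe_dir (\<Lambda> x)))))
     \<and> (\<forall>k. a_level ?q (line x (dir_vec (stripe_dir (\<Lambda> x)))) = enat k \<longrightarrow>
          (\<exists>A B C. level_triangle ?q (Suc k) A B C
            \<and> closed_segment (midpoint A B) (midpoint A C) \<in> level_edges ?q k
            \<and> x \<in> closed_segment (midpoint A B) (midpoint A C)
            \<and> normal (stripe_dir (\<Lambda> x)) (stripe_side (\<Lambda> x)) \<bullet> (centroid A B C - x) > 0))"
    unfolding z e_def[symmetric]
  proof (intro conjI allI impI)
    fix d' assume "d' \<noteq> e"
    then show "a_level ?q (line (pt z) (dir_vec d')) < a_level ?q (line (pt z) (dir_vec e))"
      by (rule line_levels(1)[OF w e])
  next
    fix j assume j: "a_level ?q (line (pt z) (dir_vec e)) = enat j"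
    obtain y where y: "?q \<in> cyl (Suc j) y" using cyl_exists by blast
    have yj: "?q \<in> cyl j y" using cyl_mono[OF y] by simp
    have d: "2 ^ j dvd snd (coord e (z - y))" "\<not> 2 ^ Suc j dvd snd (coord e (z - y))"
      using a_level_iff[OF yj, of z e] a_level_iff[OF y, of z e] j by auto
    then obtain u where u: "snd (coord e (z - y)) = 2 ^ j * u" by (elim dvdE)
    then have "odd u" using d(2) by auto
    have mult: "multiplicity 2 (snd (coord e (z - y))) = j" using d by (rule multiplicity_eqI)
    have "out_mark False e (\<Lambda> (pt z)) = model_mark False e (z - y)"
      using forced_out_mark[OF v address_cyl[OF v, THEN iffD1, OF y], of False e z] d(2)
        by (simp add: line_form_def)
    then have mk: "mark False (\<Lambda> (pt z)) \<longleftrightarrow> even (fst (coord e (z - y)) div 2 ^ j)"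
      unfolding model_mark_def block_even_def using mult
        by (simp add: out_mark_def e_def[symmetric] line_form_def)
    have n: "normal e (stripe_side (\<Lambda> (pt z)))
      = (if even (fst (coord e (z - y)) div 2 ^ j) then \<i> * axis e else - (\<i> * axis e))"
      unfolding mk[symmetric] using normal_mark(1)[of "\<Lambda> (pt z)"] unfolding e_def[symmetric] .
    show "\<exists>A B C. level_triangle ?q (Suc j) A B C
            \<and> closed_segment (midpoint A B) (midpoint A C) \<in> level_edges ?q j
            \<and> pt z \<in> closed_segment (midpoint A B) (midpoint A C)
            \<and> normal e (stripe_side (\<Lambda> (pt z))) \<bullet> (centroid A B C - pt z) > 0"
      using stripe_triangle[OF y u \<open>odd u\<close> n] .
  qed
qed

lemma xi_address:
  assumes v: "matching (\<lambda>z. \<Lambda> (pt z))" shows "xi \<Lambda> = address \<Lambda>"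
  unfolding xi_def
proof (rule the_equality)
  show "xi_rel \<Lambda> (address \<Lambda>)" using v by (rule xi_rel_address)
  fix q assume "xi_rel \<Lambda> q"
  then show "q = address \<Lambda>" using xi_rel_hierarchy address_cyl[OF v] by (intro cyl_eqI) blast
qed

lemma line_uminus: "line x (- d) = line x d"
  unfolding line_def by (auto, metis minus_mult_minus of_real_minus mult_minus_left
    mult_minus_right, metis minus_mult_minus of_real_minus mult_minus_left mult_minus_right)

lemma w_line_vertex: "line (pt z) (vertex e) \<in> w_lines"
proof -
  have "vertex D1 = w2" "vertex D2 = - w1" "vertex D12 = - (w2 - w1)"
    by (simp_all add: vertex_def w1_def w2_def a1_def a2_def complex_eq_iff Re_divide Im_divide
      power2_eq_square field_simps)
  then have "line (pt z) (vertex e) \<in> {line (pt z) w2, line (pt z) w1, line (pt z) (w2 - w1)}"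
    using line_uminus[of "pt z" "w2 - w1"] line_uminus[of "pt z" w1] by (cases e) auto
  then show ?thesis unfolding w_lines_def using pt_in_Q by blast
qed

text \<open>If the form \<open>2 p - t\<close> at \<open>z - v\<close> is \<open>2^k s\<close>, then the triangle with lower left vertex \<open>(0, 1
  - s)\<close>, in units of \<open>2^k\<close> from \<open>v\<close>, has its centroid on the same level set of the form as
  \<open>z\<close>.\<close>

lemma w_level_infinite:
  assumes "\<And>k v. q \<in> cyl k v \<Longrightarrow> 2 ^ k dvd line_form True (coord e (z - v))"
  shows "w_level q (line (pt z) (vertex e)) = \<infinity>"
proof (rule enat_infinity)
  fix k
  obtain v where v: "q \<in> cyl k v" using cyl_exists by blast
  define p t where "p = fst (coord e (z - v))" and "t = snd (coord e (z - v))"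
  obtain s where s: "2 * p - t = 2 ^ k * s" using assms[OF v] unfolding p_def t_def line_form_def
    by (auto elim: dvdE)
  define P where "P w = v + scl (2 ^ k) (point e w)" for w
  have ptP: "pt (P w) = pt v + 2 ^ k * (axis e * pt w)" for w
    unfolding P_def by (simp add: pt_add pt_scl pt_point)
  have P1: "q \<in> cyl k (P w)" for w
    unfolding P_def using v cyl_eqmod eqmod_iff by blast
  have distP: "dist (pt (P w)) (pt (P w')) = 2 ^ k * cmod (pt (w - w'))" for w w'
  proof -
    have "pt (P w) - pt (P w') = 2 ^ k * (axis e * pt (w - w'))" unfolding ptP pt_diff
      by (simp add: algebra_simps)
    then show ?thesis unfolding dist_norm by (simp add: norm_mult norm_power)
  qed
  have unit: "cmod (pt w) = 1" if "w \<in> {(-1, 0), (0, -1), (-1, -1)}" for w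
  proof -
    have "(cmod (pt w))\<^sup>2 = 1\<^sup>2" unfolding norm_pt using that by (elim insertE emptyE) simp_all
    then show ?thesis by (simp only: power2_eq_iff_nonneg norm_ge_zero zero_le_one)
  qed
  let ?B = "(0, 1 - s)" and ?C = "(1, 1 - s)" and ?D = "(1, 2 - s)"
  have tri: "level_triangle q k (pt (P ?B)) (pt (P ?C)) (pt (P ?D))"
    unfolding level_triangle_def distP using P1 unit by (simp add: cyl_def)
  define \<alpha> where "\<alpha> = 2 ^ k * 2 / 3 - real_of_int p"
  have z: "pt z = pt v + axis e * (of_int p + of_int t * a2)"
  proof -
    have "pt z = pt v + axis e * pt (coord e (z - v))" unfolding pt_coord[symmetric] pt_diff by simp
    then show ?thesis unfolding p_def t_def by (simp add: pt_def a1_def)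
  qed
  have t: "of_int t = 2 * of_int p - 2 ^ k * (of_int s :: complex)"
  proof -
    have "t = 2 * p - 2 ^ k * s" using s by simp
    then show ?thesis by simp
  qed
  have "centroid (pt (P ?B)) (pt (P ?C)) (pt (P ?D)) - pt z = axis e * (of_real \<alpha> * (1 + 2 * a2))"
    unfolding centroid_def ptP z t \<alpha>_def by (simp add: pt_def a1_def field_simps)
  also have "1 + 2 * a2 = \<i> * sqrt 3" by (simp add: a2_def complex_eq_iff)
  also have "axis e * (of_real \<alpha> * (\<i> * sqrt 3)) = of_real (3 * \<alpha>) * vertex e"
    unfolding vertex_def by (simp add: field_simps) (simp flip: of_real_mult)
  finally have "centroid (pt (P ?B)) (pt (P ?C)) (pt (P ?D)) = pt z + of_real (3 * \<alpha>) * vertex e"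
    by (simp add: algebra_simps)
  then have "centroid (pt (P ?B)) (pt (P ?C)) (pt (P ?D)) \<in> line (pt z) (vertex e)" using in_line
    by blast
  then show "enat k \<le> w_level q (line (pt z) (vertex e))"
    unfolding w_level_def using tri by (intro Sup_upper) blast
qed

text \<open>A singular relative address lies on one of the six infinite lines, and then the
  corresponding a-line or w-line through the point of \<open>Q\<close> has infinite level.\<close>

lemma generic_decodable:
  assumes "generic q" shows "q \<in> decodable"
  unfolding decodable_def
proof (intro CollectI allI notI)
  fix z assume "star (pt z) - q \<in> singular"
  then obtain b e where be: "star (pt z) - q \<in> singular_line b e" using singular_subset by blast
  have d: "2 ^ k dvd line_form b (coord e (z - v))" if "q \<in> cyl k v" for k v
    using singular_lineD[OF be cyl_diff[OF _ that, of "star (pt z)" z]] by (simp add: cyl_star)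
  show False
  proof (cases b)
    case True
    then have "w_level q (line (pt z) (vertex e)) = \<infinity>" using d by (intro w_level_infinite) auto
    then show False using assms w_line_vertex unfolding generic_def by (metis less_irrefl)
  next
    case False
    have "a_level q (line (pt z) (dir_vec e)) = \<infinity>"
    proof (rule enat_infinity)
      fix k
      obtain v where v: "q \<in> cyl k v" using cyl_exists by blast
      then show "enat k \<le> a_level q (line (pt z) (dir_vec e))"
        using a_level_iff[OF v] d[OF v] False by (simp add: line_form_def)
    qed
    moreover have "line (pt z) (dir_vec e) \<in> a_lines" unfolding a_lines_def using pt_in_Q by blast
    ultimately show False using assms unfolding generic_def by (metis less_irrefl)
  qed
qed

theorem corollary6p2:
  fixes \<epsilon> :: real
  assumes "0 < \<epsilon>" and "\<epsilon> \<le> 1 / 4"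
  shows "uniquely_ergodic (local_topology (XQ \<epsilon>)) Q translate
    \<and> (\<forall>\<Lambda> \<in> XQ_gen \<epsilon>. \<forall>T. regular_model_set {x \<in> Q. \<Lambda> x = T})"
proof (intro conjI ballI allI)
  interpret tiling_space \<epsilon> by unfold_locales (use assms in auto)
  show "uniquely_ergodic (local_topology (XQ \<epsilon>)) Q translate" by (rule unique_ergodicity)
  fix \<Lambda> T assume "\<Lambda> \<in> XQ_gen \<epsilon>"
  then have v: "matching (\<lambda>z. \<Lambda> (pt z))" and g: "generic (xi \<Lambda>)"
    using X_iff unfolding XQ_gen_def by auto
  then have "address \<Lambda> \<in> decodable" using generic_decodable xi_address by metis
  then show "regular_model_set {x \<in> Q. \<Lambda> x = T}" by (rule regular_model_set_tile[OF v])
qed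

end
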